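(* Let $E/\mathbb{Q}$ be the elliptic curve $E:\ y^2=x^3+a_4x+a_6$ with $a_4,a_6\in\mathbb{Z}$, and suppose $E(\mathbb{Q})$ has rank $r\geq 1$. For $t\in\mathbb{Z}$ put $D_E(t):=4(t^3+a_4t-a_6)$. For every $\varepsilon>0$ there is an effectively computable constant $N(E,\varepsilon)<0$ such that for every $t\in\mathbb{Z}$ for which $-D_E(t)$ is a negative fundamental discriminant with $-D_E(t)<N(E,\varepsilon)$, we have $$h(-D_E(t))\geq \frac12\left(\frac{c(E)}{\sqrt{12^r}}-\varepsilon\right)\cdot\log(D_E(t))^{\frac r2}.$$
   Context: $h(-D)$ denotes the class number of $\mathbb{Q}(\sqrt{-D})$ (equivalently the number of $\mathrm{SL}_2(\mathbb{Z})$-classes of primitive positive definite binary quadratic forms of discriminant $-D$). Heights: for $P=(A/C^2,B/C^3)\in E(\mathbb{Q})$ in lowest terms, $h_W(P)=\log\max(|A|,C^2)$ (and $h_W(O)=0$); the canonical height is $\widehat h(P)=\tfrac12\lim_{n\to\infty}h_W(nP)/n^2$, with pairing $\langle P,Q\rangle=\tfrac12(\widehat h(P+Q)-\widehat h(P)-\widehat h(Q))$. The regulator is $R_{\mathbb{Q}}(E)=|\det(\langle P_i,P_j\rangle)|$ for a basis $P_1,\dots,P_r$ of $E(\mathbb{Q})/E_{\mathrm{tor}}(\mathbb{Q})$. $\Omega_r=\pi^{r/2}/\Gamma(\tfrac r2+1)$ and $c(E):=\frac{|E_{\mathrm{tor}}(\mathbb{Q})|}{\sqrt{R_{\mathbb{Q}}(E)}}\,\Omega_r$.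 *)

theory Defs
  imports
    "HOL-Analysis.Gamma_Function"
    "HOL-Algebra.FiniteProduct"
    "HOL-Library.Nat_Bijection"
    "HOL-Computational_Algebra.Squarefree"
    "Jordan_Normal_Form.Determinant"
begin

section \<open>The Mordell--Weil group of \<open>y\<^sup>2 = x\<^sup>3 + a\<^sub>4 x + a\<^sub>6\<close>\<close>

definition elliptic_curve :: "int \<Rightarrow> int \<Rightarrow> bool" where
  "elliptic_curve a4 a6 \<longleftrightarrow> 4 * a4 ^ 3 + 27 * a6 ^ 2 \<noteq> 0"

datatype point = Infinity | Affine rat rat

definition rational_points :: "int \<Rightarrow> int \<Rightarrow> point set" where
  "rational_points a4 a6 =
     insert Infinity {Affine x y | x y. y ^ 2 = x ^ 3 + of_int a4 * x + of_int a6}"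

text \<open>Chord and tangent law. On the curve, two affine points with the same abscissa are
  equal or opposite, so the second branch of the inner conditional is the tangent case.\<close>

fun ec_add :: "int \<Rightarrow> point \<Rightarrow> point \<Rightarrow> point" where
  "ec_add a4 Infinity Q = Q"
| "ec_add a4 P Infinity = P"
| "ec_add a4 (Affine x1 y1) (Affine x2 y2) =
     (if x1 = x2 \<and> y1 = - y2 then Infinity
      else let l = (if x1 = x2 then (3 * x1 ^ 2 + of_int a4) / (2 * y1)
                    else (y2 - y1) / (x2 - x1));
               x3 = l ^ 2 - x1 - x2
           in Affine x3 (l * (x1 - x3) - y1))"

text \<open>The group is written multiplicatively, as everywhere in HOL-Algebra: the multiple
  \<open>nP\<close> is \<open>P [^] n\<close> and a sum of points is a \<open>finprod\<close>.\<close>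

definition mw_group :: "int \<Rightarrow> int \<Rightarrow> point monoid" where
  "mw_group a4 a6 = \<lparr>carrier = rational_points a4 a6, mult = ec_add a4, one = Infinity\<rparr>"

definition torsion_points :: "int \<Rightarrow> int \<Rightarrow> point set" where
  "torsion_points a4 a6 =
     {P \<in> rational_points a4 a6.
        \<exists>n::nat. n > 0 \<and> P [^]\<^bsub>mw_group a4 a6\<^esub> n = \<one>\<^bsub>mw_group a4 a6\<^esub>}"

definition lin_comb :: "int \<Rightarrow> int \<Rightarrow> point list \<Rightarrow> (nat \<Rightarrow> int) \<Rightarrow> point" where
  "lin_comb a4 a6 Ps n =
     finprod (mw_group a4 a6) (\<lambda>i. (Ps ! i) [^]\<^bsub>mw_group a4 a6\<^esub> n i) {..<length Ps}"

text \<open>The classes of the listed points form a \<open>\<int>\<close>-basis of the group modulo torsion.\<close>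

definition mw_basis :: "int \<Rightarrow> int \<Rightarrow> point list \<Rightarrow> bool" where
  "mw_basis a4 a6 Ps \<longleftrightarrow>
     set Ps \<subseteq> rational_points a4 a6 \<and>
     (\<forall>Q \<in> rational_points a4 a6. \<exists>n. \<exists>T \<in> torsion_points a4 a6.
        Q = lin_comb a4 a6 Ps n \<otimes>\<^bsub>mw_group a4 a6\<^esub> T) \<and>
     (\<forall>n. lin_comb a4 a6 Ps n \<in> torsion_points a4 a6 \<longrightarrow> (\<forall>i<length Ps. n i = 0))"

definition has_rank :: "int \<Rightarrow> int \<Rightarrow> nat \<Rightarrow> bool" where
  "has_rank a4 a6 r \<longleftrightarrow> (\<exists>Ps. mw_basis a4 a6 Ps \<and> length Ps = r)"


section \<open>Heights, regulator and the constant \<open>c(E)\<close>\<close>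

text \<open>A rational point on a curve with integral coefficients is \<open>(A/C\<^sup>2, B/C\<^sup>3)\<close> in
  lowest terms, so \<open>quotient_of\<close> maps its abscissa to \<open>(A, C\<^sup>2)\<close>.\<close>

fun weil_height :: "point \<Rightarrow> real" where
  "weil_height Infinity = 0"
| "weil_height (Affine x y) =
     (case quotient_of x of (A, C2) \<Rightarrow> ln (of_int (max \<bar>A\<bar> C2)))"

definition canonical_height :: "int \<Rightarrow> int \<Rightarrow> point \<Rightarrow> real" where
  "canonical_height a4 a6 P =
     1 / 2 * lim (\<lambda>n::nat. weil_height (P [^]\<^bsub>mw_group a4 a6\<^esub> n) / (real n) ^ 2)"

definition height_pairing :: "int \<Rightarrow> int \<Rightarrow> point \<Rightarrow> point \<Rightarrow> real" where
  "height_pairing a4 a6 P Q =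
     1 / 2 * (canonical_height a4 a6 (P \<otimes>\<^bsub>mw_group a4 a6\<^esub> Q)
              - canonical_height a4 a6 P - canonical_height a4 a6 Q)"

definition regulator_of :: "int \<Rightarrow> int \<Rightarrow> point list \<Rightarrow> real" where
  "regulator_of a4 a6 Ps =
     \<bar>Determinant.det (mat (length Ps) (length Ps)
        (\<lambda>(i, j). height_pairing a4 a6 (Ps ! i) (Ps ! j)))\<bar>"

text \<open>The value does not depend on the basis: a change of basis has determinant \<open>\<plusminus>1\<close>.\<close>

definition regulator :: "int \<Rightarrow> int \<Rightarrow> real" where
  "regulator a4 a6 = regulator_of a4 a6 (SOME Ps. mw_basis a4 a6 Ps)"

definition Omega :: "nat \<Rightarrow> real" where
  "Omega r = pi powr (real r / 2) / Gamma (real r / 2 + 1)"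

definition c_const :: "int \<Rightarrow> int \<Rightarrow> nat \<Rightarrow> real" where
  "c_const a4 a6 r = real (card (torsion_points a4 a6)) / sqrt (regulator a4 a6) * Omega r"


section \<open>Class numbers\<close>

text \<open>The triple \<open>(a, b, c)\<close> is the form \<open>a X\<^sup>2 + b X Y + c Y\<^sup>2\<close>.\<close>

type_synonym bqf = "int \<times> int \<times> int"

fun bqf_eval :: "bqf \<Rightarrow> int \<Rightarrow> int \<Rightarrow> int" where
  "bqf_eval (a, b, c) x y = a * x ^ 2 + b * x * y + c * y ^ 2"

fun bqf_disc :: "bqf \<Rightarrow> int" where
  "bqf_disc (a, b, c) = b ^ 2 - 4 * a * c"

fun bqf_primitive :: "bqf \<Rightarrow> bool" where
  "bqf_primitive (a, b, c) \<longleftrightarrow> gcd a (gcd b c) = 1"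

definition bqf_pos_def :: "bqf \<Rightarrow> bool" where
  "bqf_pos_def f \<longleftrightarrow> (\<forall>x y. (x, y) \<noteq> (0, 0) \<longrightarrow> bqf_eval f x y > 0)"

definition bqf_forms :: "int \<Rightarrow> bqf set" where
  "bqf_forms D = {f. bqf_primitive f \<and> bqf_pos_def f \<and> bqf_disc f = D}"

definition bqf_equiv :: "int \<Rightarrow> (bqf \<times> bqf) set" where
  "bqf_equiv D = {(f, g). f \<in> bqf_forms D \<and> g \<in> bqf_forms D \<and>
     (\<exists>p q r s. p * s - q * r = 1 \<and>
        (\<forall>x y. bqf_eval g x y = bqf_eval f (p * x + q * y) (r * x + s * y)))}"

definition class_number :: "int \<Rightarrow> nat" where
  "class_number D = card (bqf_forms D // bqf_equiv D)"

definition fundamental_discriminant :: "int \<Rightarrow> bool" where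
  "fundamental_discriminant D \<longleftrightarrow>
     (D mod 4 = 1 \<and> squarefree D) \<or>
     (4 dvd D \<and> (D div 4) mod 4 \<in> {2, 3} \<and> squarefree (D div 4))"

definition D_E :: "int \<Rightarrow> int \<Rightarrow> int \<Rightarrow> int" where
  "D_E a4 a6 t = 4 * (t ^ 3 + a4 * t - a6)"


section \<open>Effective computability\<close>

text \<open>Kleene's partial recursive functions on tuples of natural numbers.\<close>

datatype recf =
    RZero
  | RSucc
  | RProj nat
  | RComp recf "recf list"
  | RPrim recf recf
  | RMin recf

text \<open>\<open>rec_eval f xs y\<close>: the program \<open>f\<close> halts on input \<open>xs\<close> with output \<open>y\<close>.\<close>

inductive rec_eval :: "recf \<Rightarrow> nat list \<Rightarrow> nat \<Rightarrow> bool" where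
  zero: "rec_eval RZero xs 0"
| succ: "rec_eval RSucc [x] (Suc x)"
| proj: "i < length xs \<Longrightarrow> rec_eval (RProj i) xs (xs ! i)"
| comp: "list_all2 (\<lambda>g y. rec_eval g xs y) gs ys \<Longrightarrow> rec_eval f ys z
         \<Longrightarrow> rec_eval (RComp f gs) xs z"
| prim_0: "rec_eval f xs z \<Longrightarrow> rec_eval (RPrim f g) (0 # xs) z"
| prim_Suc: "rec_eval (RPrim f g) (n # xs) y \<Longrightarrow> rec_eval g (n # y # xs) z
         \<Longrightarrow> rec_eval (RPrim f g) (Suc n # xs) z"
| min: "rec_eval f (n # xs) 0 \<Longrightarrow> (\<forall>i<n. \<exists>y. rec_eval f (i # xs) (Suc y))
         \<Longrightarrow> rec_eval (RMin f) xs n"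

text \<open>The inputs are the coefficients of a curve, its rank and a rational number. One
  program serves all inputs in \<open>A\<close>; outside \<open>A\<close> it may diverge.\<close>

fun encode_input :: "int \<times> int \<times> nat \<times> rat \<Rightarrow> nat list" where
  "encode_input (a4, a6, r, q) =
     [int_encode a4, int_encode a6, r,
      int_encode (fst (quotient_of q)), int_encode (snd (quotient_of q))]"

definition effectively_computable_on ::
  "(int \<times> int \<times> nat \<times> rat) set \<Rightarrow> (int \<times> int \<times> nat \<times> rat \<Rightarrow> int) \<Rightarrow> bool" where
  "effectively_computable_on A N \<longleftrightarrow>
     (\<exists>f. \<forall>x \<in> A. rec_eval f (encode_input x) (int_encode (N x)))"

end

theory Submission
  imports Defs "HOL-Analysis.Ball_Volume" "HOL-Number_Theory.Cong"
begin

text \<open>Let \<open>P = (A/d, y)\<close> be a rational point with \<open>max(|A|, d) \<le> \<surd>t / 2\<close>. As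
  \<open>(y d\<^sup>2)\<^sup>2 = d (A\<^sup>3 + a\<^sub>4 A d\<^sup>2 + a\<^sub>6 d\<^sup>3)\<close>, the number \<open>- D\<^sub>E(t) / 4\<close> is a square modulo
  \<open>a = A + t d\<close>, so \<open>a\<close> is the leading coefficient of a form of discriminant \<open>- D\<^sub>E(t)\<close>, and
  \<open>4 a\<^sup>2 < D\<^sub>E(t)\<close>. Equivalent forms with such small leading coefficients have the same leading
  coefficient, which determines \<open>A\<close> and \<open>d\<close>, hence \<open>P\<close> up to sign. So \<open>1 + 2 h(- D\<^sub>E(t))\<close> is at
  least the number of points of naive height at most \<open>log (D\<^sub>E(t)) / 6 - O(1)\<close>, which is bounded
  below by counting lattice points in a ball of the Mordell--Weil lattice.

  For the effectivity no generators of the group have to be found. If \<open>c(E) \<le> \<epsilon>\<close>, there is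
  nothing to prove. Otherwise the regulator is bounded above in terms of \<open>\<epsilon>\<close>, and the heights of
  non-torsion points are bounded below in terms of the coefficients, since only finitely many
  points have bounded height. A reduced basis of the lattice then has Gram--Schmidt lengths
  bounded above and below, which bounds the error term of the lattice point count. All these
  bounds are dominated by a tower of exponentials in the size of the input.\<close>

section \<open>The group law\<close>

text \<open>The number \<open>- D_E a4 a6 t / 4\<close> is the value of the cubic at
  \<open>- t\<close>, and \<open>A + t d\<close> is the modulus in which \<open>A / d\<close>
  becomes \<open>- t\<close>; this is why a rational point, a square value of the cubic, yields a
  square root of \<open>- D_E a4 a6 t / 4\<close>. Since \<open>D_E a4 a6 t\<close> is about
  \<open>4 t^3\<close>, the height bound \<open>sqrt t / 2\<close> is \<open>(log D) / 6\<close> up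
  to a constant on the logarithmic scale. The canonical height is normalised with a factor 1/2, so
  the points fill a ball of radius \<open>sqrt ((log D) / 12)\<close>, whence the factor
  \<open>sqrt (12 ^ r)\<close>; the factor 1/2 in front comes from the pairs \<open>P\<close>,
  \<open>- P\<close>. The obstacle to effectivity is that the error in the lattice point count
  depends on the shape of the lattice and not only on its covolume, and \<open>regulator\<close>
  refers to an arbitrary basis. A lower bound for all non-zero vectors and an upper bound for the
  covolume control the shape of a suitable basis, even though that basis is never computed.\<close>

fun ec_neg :: "point \<Rightarrow> point" where
  "ec_neg Infinity = Infinity"
| "ec_neg (Affine x y) = Affine x (- y)"

lemma ec_neg_neg [simp]: "ec_neg (ec_neg P) = P"
  by (cases P) auto

lemma Infinity_in_rational_points [simp]: "Infinity \<in> rational_points a b"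
  by (simp add: rational_points_def)

lemma Affine_in_rational_points [simp]:
  "Affine x y \<in> rational_points a b \<longleftrightarrow> y ^ 2 = x ^ 3 + of_int a * x + of_int b"
  by (auto simp: rational_points_def)

lemma ec_neg_in_rational_points [simp]:
  "ec_neg P \<in> rational_points a b \<longleftrightarrow> P \<in> rational_points a b"
  by (cases P) auto

text \<open>The second equation is the first one multiplied by \<open>y\<^sub>1 + y\<^sub>2\<close> and divided by
  \<open>x\<^sub>1 - x\<^sub>2\<close>, using the curve equation. Together they characterise the slope both of
  the chord and of the tangent, so that no case distinction is needed below.\<close>

definition slope_rel :: "rat \<Rightarrow> rat \<Rightarrow> rat \<Rightarrow> rat \<Rightarrow> rat \<Rightarrow> rat \<Rightarrow> bool" where
  "slope_rel a x1 y1 x2 y2 l \<longleftrightarrow>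
     y1 - y2 = l * (x1 - x2) \<and> l * (y1 + y2) = x1 ^ 2 + x1 * x2 + x2 ^ 2 + a"

lemma slope_rel_exists:
  assumes "y1 ^ 2 = x1 ^ 3 + a * x1 + b" "y2 ^ 2 = x2 ^ 3 + a * x2 + b"
    and "\<not> (x1 = x2 \<and> y1 = - y2)"
  shows "\<exists>l. slope_rel a x1 y1 x2 y2 l"
proof (cases "x1 = x2")
  case True
  have "(y1 - y2) * (y1 + y2) = 0"
    using assms True by (simp add: algebra_simps power2_eq_square)
  hence y: "y1 = y2" using assms(3) True by (auto simp: eq_neg_iff_add_eq_0)
  hence "y2 \<noteq> 0" using assms(3) True by auto
  hence "slope_rel a x1 y1 x2 y2 ((3 * x2 ^ 2 + a) / (2 * y2))"
    using True y by (simp add: slope_rel_def field_simps power2_eq_square)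
  thus ?thesis ..
next
  case False
  have "(y1 - y2) * (y1 + y2) = (x1 - x2) * (x1 ^ 2 + x1 * x2 + x2 ^ 2 + a)"
  proof -
    have "(y1 - y2) * (y1 + y2) = y1 ^ 2 - y2 ^ 2" by Groebner_Basis.algebra
    also have "\<dots> = (x1 - x2) * (x1 ^ 2 + x1 * x2 + x2 ^ 2 + a)" unfolding assms(1,2) by Groebner_Basis.algebra
    finally show ?thesis .
  qed
  hence "slope_rel a x1 y1 x2 y2 ((y1 - y2) / (x1 - x2))"
    using False by (simp add: slope_rel_def divide_simps mult.commute)
  thus ?thesis ..
qed

lemma ec_add_slope:
  assumes "slope_rel (of_int a) x1 y1 x2 y2 l" "\<not> (x1 = x2 \<and> y1 = - y2)"
  shows "ec_add a (Affine x1 y1) (Affine x2 y2) =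
           Affine (l ^ 2 - x1 - x2) (l * (x1 - (l ^ 2 - x1 - x2)) - y1)"
proof -
  have "(if x1 = x2 then (3 * x1 ^ 2 + of_int a) / (2 * y1) else (y2 - y1) / (x2 - x1)) = l"
  proof (cases "x1 = x2")
    case True
    hence y: "y1 = y2" using assms(1) by (simp add: slope_rel_def)
    hence "y1 \<noteq> 0" using assms(2) True by auto
    thus ?thesis using assms(1) True y
      by (simp add: slope_rel_def field_simps power2_eq_square)
  next
    case False
    have "y2 - y1 = l * (x2 - x1)" using assms(1) by (simp add: slope_rel_def algebra_simps)
    thus ?thesis using False by simp
  qed
  thus ?thesis using assms(2) by (auto simp: Let_def simp del: ec_neg.simps)
qed

lemma slope_rel_commute: "slope_rel a x1 y1 x2 y2 l \<longleftrightarrow> slope_rel a x2 y2 x1 y1 l"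
  unfolding slope_rel_def by (auto simp: algebra_simps)

lemma slope_rel_neg:
  "slope_rel a x1 y1 x2 y2 l \<Longrightarrow> slope_rel a x1 (- y1) x2 (- y2) (- l)"
  unfolding slope_rel_def by (auto simp: algebra_simps)

lemma ec_add_Infinity_right [simp]: "ec_add a P Infinity = P"
  by (cases P) auto

lemma ec_add_neg_right [simp]: "ec_add a P (ec_neg P) = Infinity"
  by (cases P) auto

lemma ec_add_commute:
  assumes "P \<in> rational_points a b" "Q \<in> rational_points a b"
  shows "ec_add a P Q = ec_add a Q P"
proof (cases P; cases Q)
  fix x1 y1 x2 y2 assume P: "P = Affine x1 y1" and Q: "Q = Affine x2 y2"
  show ?thesis
  proof (cases "x1 = x2 \<and> y1 = - y2")
    case True thus ?thesis using P Q by auto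
  next
    case False
    then obtain l where l: "slope_rel (of_int a) x1 y1 x2 y2 l"
      using slope_rel_exists[of y1 x1 "of_int a" "of_int b" y2 x2] assms False P Q by auto
    have F: "\<not> (x2 = x1 \<and> y2 = - y1)" using False by auto
    have "y1 - y2 = l * (x1 - x2)" using l by (simp add: slope_rel_def)
    then show ?thesis
      unfolding P Q ec_add_slope[OF l False] ec_add_slope[OF l[unfolded slope_rel_commute[of _ x1]] F]
      by (simp add: algebra_simps)
  qed
qed auto

lemma ec_neg_add:
  assumes "P \<in> rational_points a b" "Q \<in> rational_points a b"
  shows "ec_neg (ec_add a P Q) = ec_add a (ec_neg P) (ec_neg Q)"
proof (cases P; cases Q)
  fix x1 y1 x2 y2 assume P: "P = Affine x1 y1" and Q: "Q = Affine x2 y2"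
  show ?thesis
  proof (cases "x1 = x2 \<and> y1 = - y2")
    case True thus ?thesis using P Q by auto
  next
    case False
    then obtain l where l: "slope_rel (of_int a) x1 y1 x2 y2 l"
      using slope_rel_exists[of y1 x1 "of_int a" "of_int b" y2 x2] assms False P Q by auto
    have F: "\<not> (x1 = x2 \<and> - y1 = - (- y2))" using False by auto
    show ?thesis
      unfolding P Q ec_neg.simps ec_add_slope[OF l False] ec_add_slope[OF slope_rel_neg[OF l] F]
      by (simp add: algebra_simps)
  qed
qed auto

text \<open>By Vieta, the line through P and Q meets the cubic in a third point with x-coordinate
  \<open>l^2 - x1 - x2\<close>. The second conclusion concerns the reflection of that line in the
  x-axis, which passes through P + Q and - Q with slope \<open>- l\<close>; it is what makes the
  addition of Q invertible.\<close>

lemma slope_rel_third: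
  assumes "slope_rel a x1 y1 x2 y2 l"
    and "y2 ^ 2 = x2 ^ 3 + a * x2 + b" and "x3 = l ^ 2 - x1 - x2" "y3 = l * (x1 - x3) - y1"
  shows "y3 ^ 2 = x3 ^ 3 + a * x3 + b" "slope_rel a x3 y3 x2 (- y2) (- l)"
proof -
  have l: "y1 - y2 = l * (x1 - x2)" "l * (y1 + y2) = x1 ^ 2 + x1 * x2 + x2 ^ 2 + a"
    using assms(1) by (auto simp: slope_rel_def)
  have y3: "y3 = l * (x2 - x3) - y2" using l(1) assms(4) by (simp add: algebra_simps)
  have 2: "l * (2 * y2 + l * (x3 - x2)) = x3 ^ 2 + x3 * x2 + x2 ^ 2 + a"
  proof -
    have sum: "l ^ 2 = x1 + x2 + x3" using assms(3) by simp
    have y1: "y1 = y2 + l * (x1 - x2)" using l(1) by simp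
    have "l * (2 * y2 + l * (x3 - x2)) = l * (y1 + y2) + l ^ 2 * (x3 - x1)"
      unfolding y1 by Groebner_Basis.algebra
    also have "\<dots> = x3 ^ 2 + x3 * x2 + x2 ^ 2 + a" unfolding l(2) sum by Groebner_Basis.algebra
    finally show ?thesis .
  qed
  have "- l * (y3 + - y2) = l * (2 * y2 + l * (x3 - x2))"
    unfolding y3 by Groebner_Basis.algebra
  moreover have "y3 - - y2 = - l * (x3 - x2)" unfolding y3 by Groebner_Basis.algebra
  ultimately show "slope_rel a x3 y3 x2 (- y2) (- l)"
    unfolding slope_rel_def 2 by simp
  have "y3 ^ 2 - y2 ^ 2 = (y3 + y2) * (y3 - y2)" by (simp add: algebra_simps power2_eq_square)
  also have "\<dots> = (x3 - x2) * (l * (2 * y2 + l * (x3 - x2)))"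
    by (simp add: y3 algebra_simps)
  also have "\<dots> = (x3 - x2) * (x3 ^ 2 + x3 * x2 + x2 ^ 2 + a)" by (simp add: 2)
  finally have "y3 ^ 2 = y2 ^ 2 + (x3 - x2) * (x3 ^ 2 + x3 * x2 + x2 ^ 2 + a)" by simp
  thus "y3 ^ 2 = x3 ^ 3 + a * x3 + b" unfolding assms(2) by Groebner_Basis.algebra
qed

lemma ec_add_closed:
  assumes "P \<in> rational_points a b" "Q \<in> rational_points a b"
  shows "ec_add a P Q \<in> rational_points a b"
proof (cases P; cases Q)
  fix x1 y1 x2 y2 assume P: "P = Affine x1 y1" and Q: "Q = Affine x2 y2"
  show ?thesis
  proof (cases "x1 = x2 \<and> y1 = - y2")
    case True thus ?thesis using P Q by auto
  next
    case False
    then obtain l where l: "slope_rel (of_int a) x1 y1 x2 y2 l"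
      using slope_rel_exists[of y1 x1 "of_int a" "of_int b" y2 x2] assms False P Q by auto
    show ?thesis
      unfolding P Q ec_add_slope[OF l False] Affine_in_rational_points
      by (rule slope_rel_third[OF l _ refl refl]) (use assms Q in auto)
  qed
qed (use assms in auto)

lemma ec_add_cancel:
  assumes E: "elliptic_curve a b"
    and PQ: "P \<in> rational_points a b" "Q \<in> rational_points a b"
  shows "ec_add a (ec_add a P Q) (ec_neg Q) = P"
proof (cases P; cases Q)
  fix x1 y1 x2 y2 assume P: "P = Affine x1 y1" and Q: "Q = Affine x2 y2"
  show ?thesis
  proof (cases "x1 = x2 \<and> y1 = - y2")
    case True thus ?thesis using P Q by auto
  next
    case False
    then obtain l where l: "slope_rel (of_int a) x1 y1 x2 y2 l"
      using slope_rel_exists[of y1 x1 "of_int a" "of_int b" y2 x2] PQ False P Q by auto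
    define x3 y3 where 3: "x3 = l ^ 2 - x1 - x2" "y3 = l * (x1 - x3) - y1"
    have on: "y2 ^ 2 = x2 ^ 3 + of_int a * x2 + of_int b" using PQ Q by auto
    note l' = slope_rel_third(2)[OF l on 3]
    have add: "ec_add a P Q = Affine x3 y3" unfolding P Q ec_add_slope[OF l False] 3 ..
    \<comment> \<open>If P + Q = Q, the relation with slope \<open>- l\<close> says that both
      partial derivatives of the curve equation vanish at Q. This is the place where nonsingularity
      enters the group law.\<close>
    have nopp: "\<not> (x3 = x2 \<and> y3 = - (- y2))"
    proof
      assume *: "x3 = x2 \<and> y3 = - (- y2)"
      hence xy: "x3 = x2" "y3 = y2" by auto
      have "2 * y2 = 0" "3 * x2 ^ 2 + of_int a = 0"
        using l'[unfolded xy slope_rel_def] by (simp_all add: power2_eq_square)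
      hence "y2 = 0" "3 * x2 ^ 2 + of_int a = 0" by auto
      hence a: "of_int a = - 3 * x2 ^ 2" by simp
      hence b: "of_int b = 2 * x2 ^ 3"
        using on \<open>y2 = 0\<close> by (simp add: power2_eq_square power3_eq_cube)
      have "4 * of_int a ^ 3 + 27 * of_int b ^ 2 = (0::rat)" unfolding a b by Groebner_Basis.algebra
      hence "of_int (4 * a ^ 3 + 27 * b ^ 2) = (0::rat)" by simp
      thus False using E unfolding elliptic_curve_def of_int_eq_0_iff by simp
    qed
    have X: "(- l) ^ 2 - x3 - x2 = x1" using 3(1) by simp
    have Y: "- l * (x3 - x1) - y3 = y1" using 3(2) by (simp add: algebra_simps)
    show ?thesis
      by (simp only: add[unfolded P Q] ec_neg.simps Q ec_add_slope[OF l' nopp] P X Y)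
  qed
qed (use assms in \<open>auto\<close>)

text \<open>In coordinates centred at the middle point, with \<open>u = x\<^sub>1 - x\<^sub>2\<close>, \<open>v = x\<^sub>3 - x\<^sub>2\<close>,
  \<open>p = x\<^sub>4 - x\<^sub>2\<close> and \<open>q = x\<^sub>5 - x\<^sub>2\<close>, the two outer slopes are
  \<open>(\<lambda>\<mu> - v - p - 3x\<^sub>2) / (\<lambda> - \<mu>)\<close> and \<open>(u + q + 3x\<^sub>2 - \<lambda>\<mu>) / (\<lambda> - \<mu>)\<close>, whose difference is
  \<open>\<mu> - \<lambda>\<close>.\<close>

lemma ec_add_assoc_affine:
  fixes x1 y1 x2 y2 x3 y3 l m :: rat
  assumes l: "slope_rel (of_int a) x1 y1 x2 y2 l" and m: "slope_rel (of_int a) x2 y2 x3 y3 m"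
    and 4: "x4 = l ^ 2 - x1 - x2" "y4 = l * (x1 - x4) - y1"
    and 5: "x5 = m ^ 2 - x2 - x3" "y5 = m * (x2 - x5) - y2"
    and n1: "\<not> (x4 = x3 \<and> y4 = - y3)" and n2: "\<not> (x1 = x5 \<and> y1 = - y5)"
    and n3: "\<not> (x1 = x3 \<and> y1 = y3)"
  shows "ec_add a (Affine x4 y4) (Affine x3 y3) = ec_add a (Affine x1 y1) (Affine x5 y5)"
proof -
  define A :: rat where "A = of_int a"
  define u v p q s where uv: "u = x1 - x2" "v = x3 - x2" "p = x4 - x2" "q = x5 - x2" "s = 3 * x2"
  have x: "x1 = x2 + u" "x3 = x2 + v" "x4 = x2 + p" "x5 = x2 + q" using uv by auto
  have l1: "y1 = y2 + l * u" and l2: "l * (y1 + y2) = x1 ^ 2 + x1 * x2 + x2 ^ 2 + A"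
    and m1: "y3 = y2 + m * v" and m2: "m * (y2 + y3) = x2 ^ 2 + x2 * x3 + x3 ^ 2 + A"
    using l m unfolding slope_rel_def A_def[symmetric] uv by (auto simp: algebra_simps)
  have pl: "l ^ 2 = p + s + u" and qm: "m ^ 2 = q + s + v"
    using 4 5 uv by (auto simp: algebra_simps)
  have y4: "y4 = - (y2 + l * p)" and y5: "y5 = - (y2 + m * q)"
    using 4(2) 5(2) l1 uv by (auto simp: algebra_simps)
  \<comment> \<open>\<open>K\<close> is the derivative of the cubic at \<open>x2\<close>;
    eliminating it from \<open>K1\<close> and \<open>K2\<close> leaves \<open>e\<close>.\<close>
  define K where "K = 3 * x2 ^ 2 + A"
  have K1: "l * (2 * y2) = K - p * u"
  proof -
    have "l * (2 * y2) = l * (y1 + y2) - l ^ 2 * u" unfolding l1 by Groebner_Basis.algebra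
    also have "\<dots> = K - p * u" unfolding l2 pl x uv(5) K_def by Groebner_Basis.algebra
    finally show ?thesis .
  qed
  have K2: "m * (2 * y2) = K - q * v"
  proof -
    have "m * (2 * y2) = m * (y2 + y3) - m ^ 2 * v" unfolding m1 by Groebner_Basis.algebra
    also have "\<dots> = K - q * v" unfolding m2 qm x uv(5) K_def by Groebner_Basis.algebra
    finally show ?thesis .
  qed
  have e: "2 * y2 * (l - m) = v * q - u * p"
    using K1 K2 by (simp add: algebra_simps)
  \<comment> \<open>Equal slopes make P, Q and R collinear, so R is one of the other two
    intersections of the line through P and Q with the cubic, namely P (case \<open>v = u\<close>)
    or - (P + Q) (case \<open>v = p\<close>); both are excluded. The identities for the outer slopes
    are then verified after multiplication by \<open>l - m\<close>.\<close>
  have lm: "l \<noteq> m"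
  proof
    assume eq: "l = m"
    have 1: "v * q = u * p" using e eq by simp
    have 2: "q = p + u - v" using pl qm eq by (simp add: algebra_simps)
    have "(v - u) * (v - p) = 0" using 1 unfolding 2 by (simp add: algebra_simps)
    then consider "v = u" | "v = p" by auto
    thus False
    proof cases
      case 1 thus False using n3 l1 m1 x eq by auto
    next
      case 2 thus False using n1 y4 m1 x eq by auto
    qed
  qed
  define W where "W = u + q + s"
  define n where "n = (l * m - v - p - s) / (l - m)"
  define r where "r = (W - l * m) / (l - m)"
  have nl: "n * (l - m) = l * m - v - p - s" and rl: "r * (l - m) = W - l * m"
    using lm by (auto simp: n_def r_def)
  have "(n - r + (l - m)) * (l - m) = n * (l - m) - r * (l - m) + l ^ 2 - 2 * l * m + m ^ 2"
    by Groebner_Basis.algebra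
  also have "\<dots> = 0" unfolding nl rl pl qm W_def by simp
  finally have nr: "n = r - l + m" using lm by auto
  have s1: "slope_rel A x4 y4 x3 y3 n"
  proof -
    have "(y4 - y3) * (l - m) = - (2 * y2 * (l - m)) - l ^ 2 * p + l * m * p - l * m * v + m ^ 2 * v"
      unfolding y4 m1 by Groebner_Basis.algebra
    also have "\<dots> = (l * m - v - p - s) * (p - v)" unfolding e pl qm by Groebner_Basis.algebra
    also have "\<dots> = (n * (x4 - x3)) * (l - m)" unfolding nl[symmetric] x by Groebner_Basis.algebra
    finally have 1: "(y4 - y3) * (l - m) = (n * (x4 - x3)) * (l - m)" .
    have "(n * (y4 + y3)) * (l - m) = (n * (l - m)) * (m * v - l * p)" unfolding y4 m1 by Groebner_Basis.algebra
    also have "\<dots> = l * m ^ 2 * v - m * l ^ 2 * p - (v + p + s) * (m * v - l * p)"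
      unfolding nl by Groebner_Basis.algebra
    also have "\<dots> = (l - m) * (K + s * (p + v) + p ^ 2 + p * v + v ^ 2)
        + m * (K - p * u) - l * (K - q * v)" unfolding pl qm by Groebner_Basis.algebra
    also have "\<dots> = (x4 ^ 2 + x4 * x3 + x3 ^ 2 + A) * (l - m)"
      unfolding K1[symmetric] K2[symmetric] unfolding x uv(5) K_def by Groebner_Basis.algebra
    finally have "(n * (y4 + y3)) * (l - m) = (x4 ^ 2 + x4 * x3 + x3 ^ 2 + A) * (l - m)" .
    with 1 show ?thesis using lm by (simp add: slope_rel_def)
  qed
  have s2: "slope_rel A x1 y1 x5 y5 r"
  proof -
    have "(y1 - y5) * (l - m) = 2 * y2 * (l - m) + l ^ 2 * u - l * m * u + l * m * q - m ^ 2 * q"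
      unfolding y5 l1 by Groebner_Basis.algebra
    also have "\<dots> = (W - l * m) * (u - q)" unfolding e pl qm W_def by Groebner_Basis.algebra
    also have "\<dots> = (r * (x1 - x5)) * (l - m)" unfolding rl[symmetric] x by Groebner_Basis.algebra
    finally have 1: "(y1 - y5) * (l - m) = (r * (x1 - x5)) * (l - m)" .
    have "(r * (y1 + y5)) * (l - m) = (r * (l - m)) * (l * u - m * q)" unfolding y5 l1 by Groebner_Basis.algebra
    also have "\<dots> = W * (l * u - m * q) - m * l ^ 2 * u + l * m ^ 2 * q"
      unfolding rl by Groebner_Basis.algebra
    also have "\<dots> = (l - m) * (K + s * (u + q) + u ^ 2 + u * q + q ^ 2)
        + m * (K - p * u) - l * (K - q * v)" unfolding pl qm W_def by Groebner_Basis.algebra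
    also have "\<dots> = (x1 ^ 2 + x1 * x5 + x5 ^ 2 + A) * (l - m)"
      unfolding K1[symmetric] K2[symmetric] unfolding x uv(5) K_def by Groebner_Basis.algebra
    finally have "(r * (y1 + y5)) * (l - m) = (x1 ^ 2 + x1 * x5 + x5 ^ 2 + A) * (l - m)" .
    with 1 show ?thesis using lm by (simp add: slope_rel_def)
  qed
  have "n ^ 2 - r ^ 2 = - (n * (l - m) + r * (l - m))" unfolding nr by Groebner_Basis.algebra
  hence sq: "n ^ 2 = r ^ 2 + v + p - u - q" unfolding nl rl W_def by simp
  have x6: "n ^ 2 - x4 - x3 = r ^ 2 - x1 - x5" using sq uv by (simp add: algebra_simps)
  have "(r - l) * (r + m) = r ^ 2 - r * (l - m) - l * m" by Groebner_Basis.algebra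
  hence X: "r ^ 2 - W = (r - l) * (r + m)" unfolding rl by simp
  have "(r + m) * (m - l) = - (r * (l - m)) + m ^ 2 - m * l" by Groebner_Basis.algebra
  hence vu: "v - u = (r + m) * (m - l)" unfolding rl qm W_def by (simp add: algebra_simps)
  have "n * (x3 - (r ^ 2 - x1 - x5)) - y3 - (r * (x1 - (r ^ 2 - x1 - x5)) - y1)
      = (r - l) * (v - u) - (r ^ 2 - W) * (m - l)"
    unfolding nr l1 m1 x W_def uv(5) by Groebner_Basis.algebra
  also have "\<dots> = 0" unfolding X vu by Groebner_Basis.algebra
  finally have F1: "n * (x3 - (r ^ 2 - x1 - x5)) - y3 = r * (x1 - (r ^ 2 - x1 - x5)) - y1" by simp
  have F2: "n * (x4 - (n ^ 2 - x4 - x3)) - y4 = n * (x3 - (n ^ 2 - x4 - x3)) - y3"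
    using s1 by (simp add: slope_rel_def algebra_simps)
  show ?thesis
    by (simp only: ec_add_slope[OF s1[unfolded A_def] n1] ec_add_slope[OF s2[unfolded A_def] n2]
        x6 F2[unfolded x6] F1)
qed

text \<open>The degenerate configurations, in which some sum involves \<open>Infinity\<close> or the
  denominator \<open>l - m\<close> of the outer slopes could vanish, are settled by commutativity
  and \<open>ec_add_cancel\<close>. The remaining one is \<open>ec_add_assoc_affine\<close>, which
  covers chords and tangents at once.\<close>

lemma ec_add_assoc:
  assumes E: "elliptic_curve a b"
    and PQR: "P \<in> rational_points a b" "Q \<in> rational_points a b" "R \<in> rational_points a b"
  shows "ec_add a (ec_add a P Q) R = ec_add a P (ec_add a Q R)"
proof -
  note closed = ec_add_closed[of _ a b]
  have canc: "ec_add a (ec_neg Y) (ec_add a Y X) = X" "ec_add a Y (ec_add a (ec_neg Y) X) = X"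
    if "X \<in> rational_points a b" "Y \<in> rational_points a b" for X Y
  proof -
    have neg: "ec_add a (ec_neg Y) (ec_add a Y X) = X"
      if "X \<in> rational_points a b" "Y \<in> rational_points a b" for X Y
      using ec_add_cancel[OF E that] that closed
        ec_add_commute[of "ec_neg Y" a b "ec_add a Y X"] ec_add_commute[OF that] by simp
    show "ec_add a (ec_neg Y) (ec_add a Y X) = X" by (rule neg[OF that])
    show "ec_add a Y (ec_add a (ec_neg Y) X) = X"
      using neg[OF that(1), of "ec_neg Y"] that by simp
  qed
  consider "P = Infinity" | "Q = Infinity" | "R = Infinity" | "P = ec_neg Q" | "Q = ec_neg R"
    | "P = R" | "ec_add a P Q = ec_neg R" | "P = ec_neg (ec_add a Q R)"
    | "P \<noteq> Infinity" "Q \<noteq> Infinity" "R \<noteq> Infinity" "P \<noteq> ec_neg Q" "Q \<noteq> ec_neg R" "P \<noteq> R"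
      "ec_add a P Q \<noteq> ec_neg R" "P \<noteq> ec_neg (ec_add a Q R)" by blast
  thus ?thesis
  proof cases
    case 4 thus ?thesis using canc(1)[of R Q] PQR ec_add_neg_right[of a P]
      by (simp add: ec_add_commute[of "ec_neg Q" a b Q])
  next
    case 5
    have "ec_add a (ec_add a P Q) R = P"
      using ec_add_cancel[OF E, of P Q] PQR 5 by simp
    thus ?thesis using 5 PQR by (simp add: ec_add_commute[of "ec_neg R" a b R])
  next
    case 6 thus ?thesis
      using PQR closed ec_add_commute[of "ec_add a P Q" a b P] ec_add_commute[of P a b Q] by simp
  next
    case 7
    hence R: "R = ec_neg (ec_add a P Q)" by simp
    have nPQ: "ec_neg P \<in> rational_points a b" "ec_neg Q \<in> rational_points a b"
      using PQR by auto
    have "ec_add a Q R = ec_neg P"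
      by (simp only: R ec_neg_add[OF PQR(1,2)] ec_add_commute[OF nPQ] canc(2)[OF nPQ(1) PQR(2)])
    moreover have "ec_add a (ec_add a P Q) R = Infinity" unfolding R by simp
    ultimately show ?thesis by simp
  next
    case 8
    have nQR: "ec_neg Q \<in> rational_points a b" "ec_neg R \<in> rational_points a b"
      using PQR by auto
    have "P = ec_add a (ec_neg R) (ec_neg Q)"
      by (simp only: 8 ec_neg_add[OF PQR(2,3)] ec_add_commute[OF nQR])
    hence "ec_add a P Q = ec_add a (ec_add a (ec_neg R) (ec_neg Q)) Q" by (rule arg_cong)
    also have "\<dots> = ec_neg R"
      using ec_add_cancel[OF E nQR(2,1)] by simp
    finally have "ec_add a P Q = ec_neg R" .
    moreover have "ec_add a (ec_neg R) R = Infinity"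
      using ec_add_neg_right[of a "ec_neg R"] by simp
    moreover have "ec_add a P (ec_add a Q R) = Infinity"
      using ec_add_neg_right[of a P] by (simp only: 8 ec_neg_neg)
    ultimately show ?thesis by simp
  next
    case 9
    obtain x1 y1 where P: "P = Affine x1 y1" using 9(1) by (cases P) auto
    obtain x2 y2 where Q: "Q = Affine x2 y2" using 9(2) by (cases Q) auto
    obtain x3 y3 where R: "R = Affine x3 y3" using 9(3) by (cases R) auto
    have n12: "\<not> (x1 = x2 \<and> y1 = - y2)" and n23: "\<not> (x2 = x3 \<and> y2 = - y3)"
      using 9(4,5) P Q R by auto
    obtain l where l: "slope_rel (of_int a) x1 y1 x2 y2 l"
      using slope_rel_exists[of y1 x1 "of_int a" "of_int b" y2 x2] n12 PQR P Q by auto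
    obtain m where m: "slope_rel (of_int a) x2 y2 x3 y3 m"
      using slope_rel_exists[of y2 x2 "of_int a" "of_int b" y3 x3] n23 PQR R Q by auto
    have PQ: "ec_add a P Q = Affine (l\<^sup>2 - x1 - x2) (l * (x1 - (l\<^sup>2 - x1 - x2)) - y1)"
      unfolding P Q ec_add_slope[OF l n12] ..
    have QR: "ec_add a Q R = Affine (m\<^sup>2 - x2 - x3) (m * (x2 - (m\<^sup>2 - x2 - x3)) - y2)"
      unfolding R Q ec_add_slope[OF m n23] ..
    show ?thesis
      unfolding PQ QR unfolding P R
    proof (rule ec_add_assoc_affine[OF l m refl refl refl refl])
      show "\<not> (l\<^sup>2 - x1 - x2 = x3 \<and> l * (x1 - (l\<^sup>2 - x1 - x2)) - y1 = - y3)"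
        using 9(7) unfolding PQ R by simp
      show "\<not> (x1 = m\<^sup>2 - x2 - x3 \<and> y1 = - (m * (x2 - (m\<^sup>2 - x2 - x3)) - y2))"
        using 9(8) unfolding QR P by simp
      show "\<not> (x1 = x3 \<and> y1 = y3)" using 9(6) unfolding P R by simp
    qed
  qed simp_all
qed

lemma comm_group_mw_group:
  assumes "elliptic_curve a b"
  shows "comm_group (mw_group a b)"
proof (rule comm_groupI)
  fix P assume "P \<in> carrier (mw_group a b)"
  hence "ec_neg P \<in> carrier (mw_group a b)"
    and "ec_neg P \<otimes>\<^bsub>mw_group a b\<^esub> P = \<one>\<^bsub>mw_group a b\<^esub>"
    using ec_add_neg_right[of a "ec_neg P"] by (auto simp: mw_group_def)
  thus "\<exists>Q\<in>carrier (mw_group a b). Q \<otimes>\<^bsub>mw_group a b\<^esub> P = \<one>\<^bsub>mw_group a b\<^esub>" ..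
next
  show "P \<otimes>\<^bsub>mw_group a b\<^esub> Q = Q \<otimes>\<^bsub>mw_group a b\<^esub> P"
    if "P \<in> carrier (mw_group a b)" "Q \<in> carrier (mw_group a b)" for P Q
    using that ec_add_commute[of P a b Q] by (simp add: mw_group_def)
qed (auto simp: mw_group_def ec_add_closed ec_add_assoc[OF assms])

section \<open>The naive height\<close>

fun pt_height :: "point \<Rightarrow> int" where
  "pt_height Infinity = 1"
| "pt_height (Affine x y) = max \<bar>fst (quotient_of x)\<bar> (snd (quotient_of x))"

lemma weil_height_eq: "weil_height P = ln (real_of_int (pt_height P))"
  by (cases P) (auto split: prod.split)

lemma pt_height_ge_1: "pt_height P \<ge> 1"
proof (cases P)
  case (Affine x y)
  have "snd (quotient_of x) > 0" by (rule quotient_of_denom_pos')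
  thus ?thesis using Affine by simp
qed simp

lemma weil_height_nonneg: "weil_height P \<ge> 0"
  using pt_height_ge_1[of P] by (simp add: weil_height_eq)

lemma pt_height_neg [simp]: "pt_height (ec_neg P) = pt_height P"
  by (cases P) auto

lemma abs_add_bound: "\<bar>x\<bar> \<le> X \<Longrightarrow> \<bar>y\<bar> \<le> Y \<Longrightarrow> \<bar>x + y\<bar> \<le> X + Y" for x y :: int
  by linarith

lemma abs_diff_bound: "\<bar>x\<bar> \<le> X \<Longrightarrow> \<bar>y\<bar> \<le> Y \<Longrightarrow> \<bar>x - y\<bar> \<le> X + Y" for x y :: int
  by linarith

lemma abs_mult_bound: "\<bar>x\<bar> \<le> X \<Longrightarrow> \<bar>y\<bar> \<le> Y \<Longrightarrow> \<bar>x * y\<bar> \<le> X * Y" for x y :: int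
  unfolding abs_mult by (rule mult_mono) auto

lemma abs_power_bound: "\<bar>x\<bar> \<le> X \<Longrightarrow> \<bar>x ^ n\<bar> \<le> X ^ n" for x :: int
  unfolding power_abs by (rule power_mono) auto

lemmas of_int_arith = of_int_add of_int_diff of_int_mult of_int_power of_int_numeral

lemmas poly_bound = abs_add_bound abs_diff_bound abs_mult_bound abs_power_bound

text \<open>Bezout coefficients of the primitive vector \<open>w\<close> define a linear form with
  value 1 on \<open>w\<close>; its value on the proportional vector \<open>v\<close> is the factor
  \<open>k\<close>.\<close>

lemma primitive_triple_factor:
  fixes v0 v1 v2 w0 w1 w2 :: int
  assumes "gcd w0 (gcd w1 w2) = 1"
    and "v0 * w1 = v1 * w0" "v0 * w2 = v2 * w0" "v1 * w2 = v2 * w1"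
  obtains k where "v0 = k * w0" "v1 = k * w1" "v2 = k * w2"
proof -
  obtain s t where st: "s * w0 + t * gcd w1 w2 = 1"
    using bezout_int[of w0 "gcd w1 w2"] assms(1) by auto
  obtain u u' where u: "u * w1 + u' * w2 = gcd w1 w2" using bezout_int by blast
  have one: "s * w0 + t * u * w1 + t * u' * w2 = 1"
    using st unfolding u[symmetric] by (simp add: algebra_simps)
  define k where "k = s * v0 + t * u * v1 + t * u' * v2"
  have "v0 = v0 * (s * w0 + t * u * w1 + t * u' * w2)" using one by simp
  also have "\<dots> = s * (v0 * w0) + t * u * (v0 * w1) + t * u' * (v0 * w2)" by (simp add: algebra_simps)
  also have "\<dots> = k * w0" unfolding assms k_def by (simp add: algebra_simps)
  finally have 0: "v0 = k * w0" .
  have "v1 = v1 * (s * w0 + t * u * w1 + t * u' * w2)" using one by simp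
  also have "\<dots> = s * (v1 * w0) + t * u * (v1 * w1) + t * u' * (v1 * w2)" by (simp add: algebra_simps)
  also have "\<dots> = k * w1" unfolding assms(4) assms(2)[symmetric] k_def by (simp add: algebra_simps)
  finally have 1: "v1 = k * w1" .
  have "v2 = v2 * (s * w0 + t * u * w1 + t * u' * w2)" using one by simp
  also have "\<dots> = s * (v2 * w0) + t * u * (v2 * w1) + t * u' * (v2 * w2)" by (simp add: algebra_simps)
  also have "\<dots> = k * w2"
    unfolding assms(4)[symmetric] assms(3)[symmetric] k_def by (simp add: algebra_simps)
  finally show thesis using that 0 1 by blast
qed

text \<open>Gauss's lemma for the product of the primitive linear polynomials \<open>c X + a\<close>
  and \<open>d X + b\<close>.\<close>

lemma gcd_product_sum:
  fixes a b c d :: int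
  assumes "coprime a c" "coprime b d" "c \<noteq> 0" "d \<noteq> 0"
  shows "gcd (c * d) (gcd (a * d + b * c) (a * b)) = 1"
proof (rule ccontr)
  assume *: "gcd (c * d) (gcd (a * d + b * c) (a * b)) \<noteq> 1"
  define g where "g = gcd (c * d) (gcd (a * d + b * c) (a * b))"
  have "g \<noteq> 0" using assms(3,4) by (simp add: g_def)
  moreover have "\<not> is_unit g" using * by (simp add: g_def)
  ultimately obtain p where p: "prime p" "p dvd gcd (c * d) (gcd (a * d + b * c) (a * b))"
    unfolding g_def[symmetric] using prime_divisor_exists by blast
  hence d: "p dvd c * d" "p dvd a * d + b * c" "p dvd a * b" by auto
  have nu: "\<not> is_unit p" using p by auto
  have ac: "\<not> (p dvd a \<and> p dvd c)" and bd: "\<not> (p dvd b \<and> p dvd d)"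
    using assms nu by (auto dest: coprime_common_divisor)
  consider "p dvd c" | "p dvd d" using d(1) p(1) prime_dvd_mult_iff by blast
  thus False
  proof cases
    case 1
    hence "p dvd b * c" by simp
    hence "p dvd a * d" using d(2) dvd_add_left_iff by blast
    thus False using 1 ac bd d(3) p(1) prime_dvd_mult_iff by blast
  next
    case 2
    hence "p dvd a * d" by simp
    hence "p dvd b * c" using d(2) dvd_add_right_iff by blast
    thus False using 2 ac bd d(3) p(1) prime_dvd_mult_iff by blast
  qed
qed

text \<open>A product of two linear polynomials has small coefficients only if the factors do.
  Cancellation can occur only in the middle coefficient. If one of its two terms exceeds
  \<open>M\<close>, then their product, which is that of the outer coefficients, forces the other
  one to be at most \<open>M\<close>; otherwise the triangle inequality suffices.\<close>

lemma height_product_bound: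
  fixes a b c d M :: int
  assumes "c > 0" "d > 0" "\<bar>c * d\<bar> \<le> M" "\<bar>a * d + b * c\<bar> \<le> M" "\<bar>a * b\<bar> \<le> M"
  shows "max \<bar>a\<bar> c * max \<bar>b\<bar> d \<le> 2 * M"
proof -
  have cross: "u \<le> 2 * M" if "\<bar>u'\<bar> = u" "\<bar>v'\<bar> = v" "\<bar>u' + v'\<bar> \<le> M" "u * v \<le> M * M" for u v u' v' :: int
  proof (cases "v \<le> M")
    case True thus ?thesis using that by linarith
  next
    case False
    have "u \<le> M"
    proof (rule ccontr)
      assume "\<not> u \<le> M"
      hence "M * M < u * v" using False that assms(3)
        by (intro mult_strict_mono) auto
      thus False using that by simp
    qed
    thus ?thesis using assms(3) by linarith
  qed
  have "(\<bar>a\<bar> * d) * (\<bar>b\<bar> * c) = \<bar>a * b\<bar> * \<bar>c * d\<bar>" using assms by (simp add: abs_mult)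
  also have "\<dots> \<le> M * M" using assms by (intro mult_mono) auto
  finally have pr: "(\<bar>a\<bar> * d) * (\<bar>b\<bar> * c) \<le> M * M" .
  have 1: "\<bar>a\<bar> * d \<le> 2 * M"
    using cross[of "a * d" "\<bar>a\<bar> * d" "b * c" "\<bar>b\<bar> * c"] pr assms by (simp add: abs_mult)
  have 2: "\<bar>b\<bar> * c \<le> 2 * M"
    using cross[of "b * c" "\<bar>b\<bar> * c" "a * d" "\<bar>a\<bar> * d"] pr assms
    by (simp add: abs_mult add.commute mult.commute)
  have 3: "\<bar>a\<bar> * \<bar>b\<bar> \<le> 2 * M" "c * d \<le> 2 * M" using assms by (auto simp: abs_mult)
  show ?thesis using 1 2 3 by (auto simp: max_def mult.commute)
qed

lemma quotient_of_cases:
  obtains a d where "quotient_of x = (a, d)" "coprime a d" "d > 0" "x = of_int a / of_int d"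
  using quotient_of_coprime quotient_of_denom_pos quotient_of_div by (metis surj_pair)

text \<open>\<open>C\<close> has to dominate every coefficient sum below. The largest is 108 + 429 +
  79 + 3 = 619, from the cofactors in \<open>duplication_bound\<close>, whose degree 5 in
  \<open>m\<close> also fixes the exponent.\<close>

context
  fixes a4 a6 m C :: int
  assumes E: "elliptic_curve a4 a6"
  defines "m \<equiv> 1 + \<bar>a4\<bar> + \<bar>a6\<bar>" and "C \<equiv> 700 * m ^ 5"
begin

lemma m_bounds: "m \<ge> 1" "\<bar>a4\<bar> \<le> m" "\<bar>a6\<bar> \<le> m"
  unfolding m_def by auto

lemma m_powers: "m \<le> m ^ 5" "m ^ 2 \<le> m ^ 5" "m ^ 3 \<le> m ^ 5" "m ^ 4 \<le> m ^ 5" "1 \<le> m ^ 5"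
  using m_bounds(1) power_increasing[of 1 5 m] by (auto intro: power_increasing)

lemma C_ge: "C \<ge> 1"
  unfolding C_def using m_powers by linarith

text \<open>The sum and the product of x(P + Q) and x(P - Q) are symmetric functions of
  \<open>x1\<close> and \<open>x2\<close> with denominator \<open>(x1 - x2)^2\<close>, free of
  \<open>y1\<close> and \<open>y2\<close>. After clearing denominators the integer vector
  \<open>v\<close> is a multiple of the primitive vector \<open>w\<close> formed from the two
  abscissae, so cancellation only lowers the height. This is one half of the parallelogram law, up
  to a constant.\<close>

lemma height_sum_diff_bound:
  assumes P: "Affine x1 y1 \<in> rational_points a4 a6" and Q: "Affine x2 y2 \<in> rational_points a4 a6"
    and ne: "x1 \<noteq> x2"
  shows "pt_height (ec_add a4 (Affine x1 y1) (Affine x2 y2)) *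
      pt_height (ec_add a4 (Affine x1 y1) (Affine x2 (- y2)))
    \<le> C * (pt_height (Affine x1 y1))\<^sup>2 * (pt_height (Affine x2 y2))\<^sup>2"
proof -
  define A B :: rat where "A = of_int a4" and "B = of_int a6"
  define \<delta> s where "\<delta> = x1 - x2" and "s = x1 + x2"
  have \<delta>: "\<delta> \<noteq> 0" using ne by (simp add: \<delta>_def)
  have c1: "y1 ^ 2 = x1 ^ 3 + A * x1 + B" and c2: "y2 ^ 2 = x2 ^ 3 + A * x2 + B"
    using P Q by (auto simp: A_def B_def)
  define x3 x4 where "x3 = ((y2 - y1) / (x2 - x1)) ^ 2 - x1 - x2"
    and "x4 = ((- y2 - y1) / (x2 - x1)) ^ 2 - x1 - x2"
  obtain y3 y4 where add: "ec_add a4 (Affine x1 y1) (Affine x2 y2) = Affine x3 y3"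
      "ec_add a4 (Affine x1 y1) (Affine x2 (- y2)) = Affine x4 y4"
    using ne by (simp add: Let_def x3_def x4_def)
  have x3: "x3 * \<delta> ^ 2 = (y1 - y2) ^ 2 - s * \<delta> ^ 2"
    using ne by (simp add: x3_def \<delta>_def s_def power_divide left_diff_distrib power2_commute
        algebra_simps)
  have "(- y2 - y1) ^ 2 = (y1 + y2) ^ 2" by (simp add: power2_eq_square algebra_simps)
  hence x4: "x4 * \<delta> ^ 2 = (y1 + y2) ^ 2 - s * \<delta> ^ 2"
    using ne by (simp add: x4_def \<delta>_def s_def power_divide left_diff_distrib power2_commute
        algebra_simps)
  have "(x3 + x4) * \<delta> ^ 2 = 2 * (y1 ^ 2 + y2 ^ 2) - 2 * s * \<delta> ^ 2"
    unfolding distrib_right x3 x4 by Groebner_Basis.algebra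
  also have "\<dots> = 2 * (x1 + x2) * (A + x1 * x2) + 4 * B"
    unfolding c1 c2 s_def \<delta>_def by Groebner_Basis.algebra
  finally have sum: "(x3 + x4) * \<delta> ^ 2 = 2 * (x1 + x2) * (A + x1 * x2) + 4 * B" .
  have "(x3 * x4 * \<delta> ^ 2) * \<delta> ^ 2 = (x3 * \<delta> ^ 2) * (x4 * \<delta> ^ 2)" by Groebner_Basis.algebra
  also have "\<dots> = (y1 ^ 2 - y2 ^ 2) ^ 2 - 2 * s * \<delta> ^ 2 * (y1 ^ 2 + y2 ^ 2) + s ^ 2 * \<delta> ^ 4"
    unfolding x3 x4 by Groebner_Basis.algebra
  also have "\<dots> = ((x1 * x2 - A) ^ 2 - 4 * B * (x1 + x2)) * \<delta> ^ 2"
    unfolding c1 c2 s_def \<delta>_def by Groebner_Basis.algebra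
  finally have prod: "x3 * x4 * \<delta> ^ 2 = (x1 * x2 - A) ^ 2 - 4 * B * (x1 + x2)"
    using \<delta> by simp
  obtain a1 d1 where 1: "quotient_of x1 = (a1, d1)" "coprime a1 d1" "d1 > 0"
    "x1 = of_int a1 / of_int d1" by (rule quotient_of_cases)
  obtain a2 d2 where 2: "quotient_of x2 = (a2, d2)" "coprime a2 d2" "d2 > 0"
    "x2 = of_int a2 / of_int d2" by (rule quotient_of_cases)
  obtain a3 d3 where 3: "quotient_of x3 = (a3, d3)" "coprime a3 d3" "d3 > 0"
    "x3 = of_int a3 / of_int d3" by (rule quotient_of_cases)
  obtain a5 d5 where 4: "quotient_of x4 = (a5, d5)" "coprime a5 d5" "d5 > 0"
    "x4 = of_int a5 / of_int d5" by (rule quotient_of_cases)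
  define v0 v1 v2 where "v0 = (a1 * d2 - a2 * d1) ^ 2"
    and "v1 = 2 * (a1 * d2 + a2 * d1) * (a4 * (d1 * d2) + a1 * a2) + 4 * a6 * (d1 * d2) ^ 2"
    and "v2 = (a1 * a2 - a4 * (d1 * d2)) ^ 2 - 4 * a6 * (d1 * d2) * (a1 * d2 + a2 * d1)"
  define e where "e = (of_int (d1 * d2) :: rat)"
  have x12: "of_int a1 = x1 * of_int d1" "of_int a2 = x2 * of_int d2" using 1 2 by auto
  have r0: "of_int v0 = \<delta> ^ 2 * e ^ 2"
    unfolding v0_def e_def \<delta>_def of_int_arith x12 by Groebner_Basis.algebra
  have r1: "of_int v1 = (x3 + x4) * of_int v0"
  proof -
    have "of_int v1 = (2 * (x1 + x2) * (A + x1 * x2) + 4 * B) * e ^ 2"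
      unfolding v1_def e_def A_def B_def of_int_arith x12
      by Groebner_Basis.algebra
    thus ?thesis unfolding r0 sum[symmetric] by Groebner_Basis.algebra
  qed
  have r2: "of_int v2 = x3 * x4 * of_int v0"
  proof -
    have "of_int v2 = ((x1 * x2 - A) ^ 2 - 4 * B * (x1 + x2)) * e ^ 2"
      unfolding v2_def e_def A_def B_def of_int_arith x12
      by Groebner_Basis.algebra
    thus ?thesis unfolding r0 prod[symmetric] by Groebner_Basis.algebra
  qed
  define w0 w1 w2 where "w0 = d3 * d5" and "w1 = a3 * d5 + a5 * d3" and "w2 = a3 * a5"
  have x34: "of_int a3 = x3 * of_int d3" "of_int a5 = x4 * of_int d5" using 3 4 by auto
  have s1: "of_int w1 = (x3 + x4) * of_int w0"
    unfolding w1_def w0_def of_int_arith x34 by (simp add: algebra_simps)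
  have s2: "of_int w2 = x3 * x4 * of_int w0"
    unfolding w2_def w0_def of_int_arith x34 by (simp add: algebra_simps)
  have "of_int (v0 * w1) = (of_int (v1 * w0) :: rat)" "of_int (v0 * w2) = (of_int (v2 * w0) :: rat)"
    "of_int (v1 * w2) = (of_int (v2 * w1) :: rat)"
    unfolding of_int_mult r1 r2 s1 s2 by (simp_all add: mult_ac)
  hence cross: "v0 * w1 = v1 * w0" "v0 * w2 = v2 * w0" "v1 * w2 = v2 * w1"
    unfolding of_int_eq_iff by auto
  have "gcd w0 (gcd w1 w2) = 1"
    unfolding w0_def w1_def w2_def using gcd_product_sum[OF 3(2) 4(2)] 3(3) 4(3) by simp
  from primitive_triple_factor[OF this cross]
  obtain k where k: "v0 = k * w0" "v1 = k * w1" "v2 = k * w2" .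
  have "of_int v0 \<noteq> (0::rat)" using r0 \<delta> 1 2 by (simp add: e_def)
  hence k0: "\<bar>k\<bar> \<ge> 1" using k(1) by (cases "k = 0") auto
  have kw: "\<bar>w\<bar> \<le> \<bar>k * w\<bar>" for w
    using mult_right_mono[OF k0, of "\<bar>w\<bar>"] by (simp add: abs_mult)
  define h1 h2 where "h1 = max \<bar>a1\<bar> d1" and "h2 = max \<bar>a2\<bar> d2"
  have h: "\<bar>a1\<bar> \<le> h1" "\<bar>d1\<bar> \<le> h1" "\<bar>a2\<bar> \<le> h2" "\<bar>d2\<bar> \<le> h2"
    using 1 2 by (auto simp: h1_def h2_def)
  define M where "M = 9 * m ^ 2 * h1 ^ 2 * h2 ^ 2"
  have hh: "h1 ^ 2 * h2 ^ 2 \<ge> 0" by simp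
  have m2: "1 \<le> m ^ 2" "m \<le> m ^ 2" using m_bounds(1) power_increasing[of 1 2 m] by auto
  have num: "\<bar>2\<bar> \<le> (2::int)" "\<bar>4\<bar> \<le> (4::int)" by auto
  have "\<bar>v0\<bar> \<le> (h1 * h2 + h2 * h1) ^ 2"
    unfolding v0_def by (intro poly_bound h)
  also have "\<dots> = 4 * (h1 ^ 2 * h2 ^ 2)" by Groebner_Basis.algebra
  also have "\<dots> \<le> (9 * m ^ 2) * (h1 ^ 2 * h2 ^ 2)"
    using m2 by (intro mult_right_mono[OF _ hh]) linarith
  finally have v0: "\<bar>v0\<bar> \<le> M" by (simp add: M_def mult.assoc)
  have "\<bar>v1\<bar> \<le> 2 * (h1 * h2 + h2 * h1) * (m * (h1 * h2) + h1 * h2) + 4 * m * (h1 * h2) ^ 2"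
    unfolding v1_def by (intro poly_bound h num m_bounds)
  also have "\<dots> = (8 * m + 4) * (h1 ^ 2 * h2 ^ 2)" by Groebner_Basis.algebra
  also have "\<dots> \<le> (9 * m ^ 2 + 3 * m ^ 2) * (h1 ^ 2 * h2 ^ 2)"
    using m2 by (intro mult_right_mono[OF _ hh]) linarith
  finally have v1: "\<bar>v1\<bar> \<le> 2 * M" by (simp add: M_def mult.assoc algebra_simps)
  have "\<bar>v2\<bar> \<le> (h1 * h2 + m * (h1 * h2)) ^ 2 + 4 * m * (h1 * h2) * (h1 * h2 + h2 * h1)"
    unfolding v2_def by (intro poly_bound h num m_bounds)
  also have "\<dots> = (1 + 10 * m + m ^ 2) * (h1 ^ 2 * h2 ^ 2)" by Groebner_Basis.algebra
  also have "\<dots> \<le> (18 * m ^ 2) * (h1 ^ 2 * h2 ^ 2)"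
    using m2 by (intro mult_right_mono[OF _ hh]) linarith
  finally have v2: "\<bar>v2\<bar> \<le> 2 * M" by (simp add: M_def mult.assoc)
  have "max \<bar>a3\<bar> d3 * max \<bar>a5\<bar> d5 \<le> 2 * (2 * M)"
    using height_product_bound[OF 3(3) 4(3), of "2 * M" a3 a5] v0 v1 v2
      kw[of w0] kw[of w1] kw[of w2] unfolding k[symmetric] unfolding w0_def w1_def w2_def by linarith
  also have "\<dots> = (36 * m ^ 2) * (h1 ^ 2 * h2 ^ 2)" by (simp add: M_def)
  also have "\<dots> \<le> C * (h1 ^ 2 * h2 ^ 2)"
    unfolding C_def using m_powers by (intro mult_right_mono[OF _ hh]) linarith
  finally show ?thesis unfolding add using 1 2 3 4 by (simp add: h1_def h2_def mult.assoc)
qed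


text \<open>\<open>F / G\<close> is the duplication formula for the x-coordinate, and
  \<open>k\<close> is the factor lost on reduction to lowest terms.\<close>

lemma duplication:
  assumes P: "Affine x y \<in> rational_points a4 a6" and x: "quotient_of x = (a, d)"
  defines "F \<equiv> a ^ 4 - 2 * a4 * a ^ 2 * d ^ 2 - 8 * a6 * a * d ^ 3 + a4 ^ 2 * d ^ 4"
    and "G \<equiv> 4 * d * (a ^ 3 + a4 * a * d ^ 2 + a6 * d ^ 3)"
  obtains k where
    "max \<bar>F\<bar> \<bar>G\<bar> = \<bar>k\<bar> * pt_height (ec_add a4 (Affine x y) (Affine x y))" "k dvd F" "k dvd G"
proof -
  have ad: "coprime a d" "d > 0" "x = of_int a / of_int d"
    using quotient_of_coprime quotient_of_denom_pos quotient_of_div x by blast+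
  define A B :: rat where "A = of_int a4" and "B = of_int a6"
  have c: "y ^ 2 = x ^ 3 + A * x + B" using P by (auto simp: A_def B_def)
  have xd: "of_int a = x * of_int d" using ad by auto
  define e where "e = (of_int d :: rat)"
  have e: "e \<noteq> 0" using ad by (simp add: e_def)
  have F: "of_int F = (x ^ 4 - 2 * A * x ^ 2 - 8 * B * x + A ^ 2) * e ^ 4"
    unfolding F_def of_int_arith xd A_def B_def e_def by Groebner_Basis.algebra
  have "of_int G = 4 * (x ^ 3 + A * x + B) * e ^ 4"
    unfolding G_def of_int_arith xd A_def B_def e_def by Groebner_Basis.algebra
  hence G: "of_int G = 4 * y ^ 2 * e ^ 4" unfolding c .
  show thesis
  proof (cases "y = 0")
    case True
    hence "G = 0" using G by simp
    \<comment> \<open>Here the double is \<open>Infinity\<close>, of height 1 by convention, so the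
      whole of \<open>F\<close> counts as cancelled.\<close>
    thus thesis using that[of F] True by simp
  next
    case False
    define x' where "x' = ((3 * x ^ 2 + A) / (2 * y)) ^ 2 - x - x"
    obtain y' where add: "ec_add a4 (Affine x y) (Affine x y) = Affine x' y'"
      using False by (simp add: Let_def x'_def A_def)
    have "x' * (4 * y ^ 2) = (3 * x ^ 2 + A) ^ 2 - 8 * x * y ^ 2"
      using False by (simp add: x'_def power_divide power_mult_distrib left_diff_distrib)
    also have "\<dots> = x ^ 4 - 2 * A * x ^ 2 - 8 * B * x + A ^ 2"
      unfolding c by Groebner_Basis.algebra
    finally have FG: "of_int F = x' * of_int G" unfolding F G by (simp add: mult.assoc)
    obtain a' d' where q: "quotient_of x' = (a', d')" "coprime a' d'" "d' > 0"
      "x' = of_int a' / of_int d'" by (rule quotient_of_cases)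
    have "of_int (F * d') = (of_int (a' * G) :: rat)"
      using q(3,4) FG by (simp add: field_simps)
    hence eq: "F * d' = a' * G" by (simp only: of_int_eq_iff)
    hence "d' dvd a' * G" by (metis dvd_triv_right)
    hence "d' dvd G" using q(2) coprime_dvd_mult_right_iff coprime_commute by blast
    then obtain k where k: "G = d' * k" ..
    hence k': "F = a' * k" using eq q(3) by simp
    have "max \<bar>F\<bar> \<bar>G\<bar> = \<bar>k\<bar> * max \<bar>a'\<bar> d'"
    proof -
      have "max \<bar>a'\<bar> d' * \<bar>k\<bar> = max (\<bar>a'\<bar> * \<bar>k\<bar>) (d' * \<bar>k\<bar>)"
        by (subst max_mult_distrib_right) simp
      thus ?thesis unfolding k k' abs_mult using q(3) by (simp add: mult.commute)
    qed
    thus thesis using that[of k] k k' add q by simp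
  qed
qed

text \<open>The upper bound is a coefficient count, as cancellation only helps. For the lower bound,
  \<open>F\<close> and \<open>G\<close> are binary forms without a common zero, and the identities
  \<open>id1\<close> and \<open>id2\<close> serve twice: they show that the cancelled factor
  \<open>k\<close> divides \<open>\<Delta>\<close>, and they bound the larger of \<open>F\<close>
  and \<open>G\<close> from below. The two occurrences of \<open>\<Delta>\<close> cancel, so no
  discriminant appears in the constant.\<close>

lemma duplication_bound:
  assumes P: "P \<in> rational_points a4 a6"
  shows "pt_height (ec_add a4 P P) \<le> C * pt_height P ^ 4"
    and "pt_height P ^ 4 \<le> C * pt_height (ec_add a4 P P)"
proof -
  have "pt_height (ec_add a4 P P) \<le> C * pt_height P ^ 4 \<and>
      pt_height P ^ 4 \<le> C * pt_height (ec_add a4 P P)"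
  proof (cases P)
    case Infinity thus ?thesis using C_ge by simp
  next
    case (Affine x y)
    obtain a d where q: "quotient_of x = (a, d)" "coprime a d" "d > 0"
      by (rule quotient_of_cases)
    define F G where "F = a ^ 4 - 2 * a4 * a ^ 2 * d ^ 2 - 8 * a6 * a * d ^ 3 + a4 ^ 2 * d ^ 4"
      and "G = 4 * d * (a ^ 3 + a4 * a * d ^ 2 + a6 * d ^ 3)"
    define H where "H = pt_height (ec_add a4 P P)"
    obtain k where k: "max \<bar>F\<bar> \<bar>G\<bar> = \<bar>k\<bar> * H" "k dvd F" "k dvd G"
      using duplication[OF P[unfolded Affine] q(1)] unfolding F_def G_def H_def Affine by blast
    txt \<open>The cofactors are those of Silverman, The Arithmetic of Elliptic Curves, VIII.4.3.\<close>
    define f1 g1 f2 g2 where "f1 = 12 * a ^ 2 * d + 16 * a4 * d ^ 3"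
      and "g1 = 3 * a ^ 3 - 5 * a4 * a * d ^ 2 - 27 * a6 * d ^ 3"
      and "f2 = 4 * (4 * a4 ^ 3 + 27 * a6 ^ 2) * a ^ 3 - 4 * a4 ^ 2 * a6 * a ^ 2 * d
        + 4 * a4 * (3 * a4 ^ 3 + 22 * a6 ^ 2) * a * d ^ 2 + 12 * a6 * (a4 ^ 3 + 8 * a6 ^ 2) * d ^ 3"
      and "g2 = a4 ^ 2 * a6 * a ^ 3 + a4 * (5 * a4 ^ 3 + 32 * a6 ^ 2) * a ^ 2 * d
        + 2 * a6 * (13 * a4 ^ 3 + 96 * a6 ^ 2) * a * d ^ 2 - 3 * a4 ^ 2 * (a4 ^ 3 + 8 * a6 ^ 2) * d ^ 3"
    define \<Delta> where "\<Delta> = 4 * (4 * a4 ^ 3 + 27 * a6 ^ 2)"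
    have \<Delta>: "\<Delta> \<noteq> 0" using E unfolding elliptic_curve_def \<Delta>_def by simp
    have id1: "f1 * F - g1 * G = \<Delta> * d ^ 7"
      unfolding f1_def g1_def F_def G_def \<Delta>_def by Groebner_Basis.algebra
    have id2: "f2 * F + g2 * G = \<Delta> * a ^ 7"
      unfolding f2_def g2_def F_def G_def \<Delta>_def by Groebner_Basis.algebra
    have "k dvd \<Delta> * d ^ 7" "k dvd \<Delta> * a ^ 7"
      unfolding id1[symmetric] id2[symmetric] using k(2,3) by auto
    hence "k dvd gcd (\<Delta> * d ^ 7) (\<Delta> * a ^ 7)" by (rule gcd_greatest)
    moreover have "gcd (\<Delta> * d ^ 7) (\<Delta> * a ^ 7) = \<bar>\<Delta>\<bar>"
    proof -
      have "gcd (d ^ 7) (a ^ 7) = 1"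
        using q(2) by (simp add: coprime_commute flip: coprime_iff_gcd_eq_1)
      thus ?thesis by (simp add: gcd_mult_distrib_int[symmetric])
    qed
    ultimately have kD: "\<bar>k\<bar> \<le> \<bar>\<Delta>\<bar>" using \<Delta> dvd_imp_le_int[of \<Delta> k] by simp
    define h where "h = max \<bar>a\<bar> d"
    have h: "\<bar>a\<bar> \<le> h" "\<bar>d\<bar> \<le> h" "h \<ge> 1" using q by (auto simp: h_def)
    have hP: "pt_height P = h" using q Affine by (simp add: h_def)
    have H1: "H \<ge> 1" unfolding H_def by (rule pt_height_ge_1)
    define N where "N = max \<bar>F\<bar> \<bar>G\<bar>"
    have N0: "N \<ge> 0" by (simp add: N_def)
    note mm = m_bounds(2,3)
    have h3: "h ^ 3 \<ge> 0" "h ^ 4 \<ge> 0" using h by auto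
    have f1: "\<bar>f1\<bar> \<le> 12 * h ^ 2 * h + 16 * m * h ^ 3"
      unfolding f1_def by (intro poly_bound h mm) auto
    have g1: "\<bar>g1\<bar> \<le> 3 * h ^ 3 + 5 * m * h * h ^ 2 + 27 * m * h ^ 3"
      unfolding g1_def by (intro poly_bound h mm) auto
    have "\<bar>f1\<bar> + \<bar>g1\<bar> \<le> (15 + 48 * m) * h ^ 3"
      using f1 g1 by (simp add: algebra_simps power2_eq_square power3_eq_cube)
    also have "\<dots> \<le> C * h ^ 3"
      unfolding C_def using m_powers by (intro mult_right_mono[OF _ h3(1)]) linarith
    finally have fg1: "\<bar>f1\<bar> + \<bar>g1\<bar> \<le> C * h ^ 3" .
    have f2: "\<bar>f2\<bar> \<le> 4 * (4 * m ^ 3 + 27 * m ^ 2) * h ^ 3 + 4 * m ^ 2 * m * h ^ 2 * h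
        + 4 * m * (3 * m ^ 3 + 22 * m ^ 2) * h * h ^ 2 + 12 * m * (m ^ 3 + 8 * m ^ 2) * h ^ 3"
      unfolding f2_def by (intro poly_bound h mm) auto
    have g2: "\<bar>g2\<bar> \<le> m ^ 2 * m * h ^ 3 + m * (5 * m ^ 3 + 32 * m ^ 2) * h ^ 2 * h
        + 2 * m * (13 * m ^ 3 + 96 * m ^ 2) * h * h ^ 2 + 3 * m ^ 2 * (m ^ 3 + 8 * m ^ 2) * h ^ 3"
      unfolding g2_def by (intro poly_bound h mm) auto
    have "\<bar>f2\<bar> + \<bar>g2\<bar> \<le> (108 * m ^ 2 + 429 * m ^ 3 + 79 * m ^ 4 + 3 * m ^ 5) * h ^ 3"
    proof (rule order.trans[OF add_mono[OF f2 g2]], rule eq_refl)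
      show "4 * (4 * m ^ 3 + 27 * m ^ 2) * h ^ 3 + 4 * m ^ 2 * m * h ^ 2 * h
        + 4 * m * (3 * m ^ 3 + 22 * m ^ 2) * h * h ^ 2 + 12 * m * (m ^ 3 + 8 * m ^ 2) * h ^ 3 +
        (m ^ 2 * m * h ^ 3 + m * (5 * m ^ 3 + 32 * m ^ 2) * h ^ 2 * h
        + 2 * m * (13 * m ^ 3 + 96 * m ^ 2) * h * h ^ 2 + 3 * m ^ 2 * (m ^ 3 + 8 * m ^ 2) * h ^ 3)
        = (108 * m ^ 2 + 429 * m ^ 3 + 79 * m ^ 4 + 3 * m ^ 5) * h ^ 3" by Groebner_Basis.algebra
    qed
    also have "\<dots> \<le> C * h ^ 3"
      unfolding C_def using m_powers by (intro mult_right_mono[OF _ h3(1)]) linarith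
    finally have fg2: "\<bar>f2\<bar> + \<bar>g2\<bar> \<le> C * h ^ 3" .
    have comb: "\<bar>f * F + g * G\<bar> \<le> C * h ^ 3 * N" if "\<bar>f\<bar> + \<bar>g\<bar> \<le> C * h ^ 3" for f g
    proof -
      have "\<bar>f * F + g * G\<bar> \<le> \<bar>f\<bar> * N + \<bar>g\<bar> * N"
        by (intro abs_add_bound) (auto simp: abs_mult N_def intro: mult_left_mono)
      also have "\<dots> = (\<bar>f\<bar> + \<bar>g\<bar>) * N" by (simp add: distrib_right)
      also have "\<dots> \<le> C * h ^ 3 * N" by (rule mult_right_mono[OF that N0])
      finally show ?thesis .
    qed
    have "\<bar>\<Delta>\<bar> * h ^ 7 \<le> C * h ^ 3 * N"
    proof (cases "\<bar>a\<bar> \<le> d")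
      case True
      have "\<bar>\<Delta>\<bar> * h ^ 7 = \<bar>f1 * F + (- g1) * G\<bar>"
        using id1 True q by (simp add: h_def abs_mult)
      thus ?thesis using comb[of f1 "- g1"] fg1 by simp
    next
      case False
      have "\<bar>\<Delta>\<bar> * h ^ 7 = \<bar>f2 * F + g2 * G\<bar>"
        using id2 False q by (simp add: h_def abs_mult power_abs)
      thus ?thesis using comb[OF fg2] by simp
    qed
    also have "\<dots> \<le> C * h ^ 3 * (\<bar>\<Delta>\<bar> * H)"
      unfolding N_def k(1) using kD H1 h3 C_ge by (intro mult_left_mono mult_right_mono) auto
    finally have "(\<bar>\<Delta>\<bar> * h ^ 3) * h ^ 4 \<le> (\<bar>\<Delta>\<bar> * h ^ 3) * (C * H)"
      by (simp add: algebra_simps flip: power_add)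
    moreover have "\<bar>\<Delta>\<bar> * h ^ 3 > 0" using \<Delta> h by simp
    ultimately have low: "h ^ 4 \<le> C * H" by (rule mult_left_le_imp_le)
    have k1: "1 \<le> \<bar>k\<bar>"
    proof (rule ccontr)
      assume "\<not> 1 \<le> \<bar>k\<bar>"
      hence "k = 0" by linarith
      hence "F = 0" "G = 0" using k(1) by (auto simp: max_def split: if_splits)
      thus False using id1 \<Delta> q by simp
    qed
    have "\<bar>F\<bar> \<le> h ^ 4 + 2 * m * h ^ 2 * h ^ 2 + 8 * m * h * h ^ 3 + m ^ 2 * h ^ 4"
      unfolding F_def by (intro poly_bound h mm) auto
    also have "\<dots> = (1 + 10 * m + m ^ 2) * h ^ 4" by Groebner_Basis.algebra
    also have "\<dots> \<le> C * h ^ 4"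
      unfolding C_def using m_powers by (intro mult_right_mono[OF _ h3(2)]) linarith
    finally have F: "\<bar>F\<bar> \<le> C * h ^ 4" .
    have "\<bar>G\<bar> \<le> 4 * h * (h ^ 3 + m * h * h ^ 2 + m * h ^ 3)"
      unfolding G_def by (intro poly_bound h mm) auto
    also have "\<dots> = (4 + 8 * m) * h ^ 4" by Groebner_Basis.algebra
    also have "\<dots> \<le> C * h ^ 4"
      unfolding C_def using m_powers by (intro mult_right_mono[OF _ h3(2)]) linarith
    finally have G: "\<bar>G\<bar> \<le> C * h ^ 4" .
    have "H \<le> \<bar>k\<bar> * H" using mult_right_mono[OF k1, of H] H1 by simp
    also have "\<dots> \<le> C * h ^ 4" unfolding k(1)[symmetric] using F G by simp
    finally show ?thesis using low hP by (simp add: H_def)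
  qed
  thus "pt_height (ec_add a4 P P) \<le> C * pt_height P ^ 4"
    "pt_height P ^ 4 \<le> C * pt_height (ec_add a4 P P)" by auto
qed

end

section \<open>Canonical heights on commutative groups\<close>

text \<open>Telescoping against a geometric series, whose sum is \<open>K / 3\<close>.\<close>

lemma tate_limit:
  fixes a :: "nat \<Rightarrow> real"
  assumes "\<And>k. \<bar>a (Suc k) - a k\<bar> \<le> K / 4 ^ Suc k"
  shows "convergent a" "\<bar>lim a - a 0\<bar> \<le> K"
proof -
  have K: "K \<ge> 0" using order.trans[OF abs_ge_zero assms[of 0]] by simp
  have g: "(\<lambda>k. K / 4 ^ Suc k) sums (K / 3)"
    using sums_mult[OF geometric_sums[of "1/4::real"], of "K / 4"]
    by (simp add: power_one_over field_simps)
  have s: "summable (\<lambda>k. \<bar>a (Suc k) - a k\<bar>)"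
    by (rule summable_comparison_test'[of _ 0]) (use assms sums_summable[OF g] in auto)
  have tele: "a 0 + (\<Sum>k<n. a (Suc k) - a k) = a n" for n
    by (simp add: sum_lessThan_telescope)
  have "(\<lambda>n. a 0 + (\<Sum>k<n. a (Suc k) - a k)) \<longlonglongrightarrow> a 0 + (\<Sum>k. a (Suc k) - a k)"
    by (intro tendsto_intros summable_LIMSEQ summable_rabs_cancel[OF s])
  hence l: "a \<longlonglongrightarrow> a 0 + (\<Sum>k. a (Suc k) - a k)" by (simp only: tele)
  thus "convergent a" by (auto simp: convergent_def)
  have "\<bar>\<Sum>k. a (Suc k) - a k\<bar> \<le> (\<Sum>k. \<bar>a (Suc k) - a k\<bar>)" by (rule summable_rabs[OF s])
  also have "\<dots> \<le> (\<Sum>k. K / 4 ^ Suc k)"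
    by (rule suminf_le[OF _ s sums_summable[OF g]]) (rule assms)
  also have "\<dots> \<le> K" using K sums_unique[OF g] by simp
  finally show "\<bar>lim a - a 0\<bar> \<le> K" using limI[OF l] by simp
qed

text \<open>Canonical heights are derived from an approximate parallelogram law alone, so that the
  curve enters only through one instance of this locale.\<close>

locale height_group = comm_group G for G (structure) +
  fixes h :: "'a \<Rightarrow> real" and K :: real
  assumes quasi_parallelogram: "\<lbrakk>x \<in> carrier G; y \<in> carrier G\<rbrakk>
      \<Longrightarrow> \<bar>h (x \<otimes> y) + h (x \<otimes> inv y) - 2 * h x - 2 * h y\<bar> \<le> K"
    and h_one: "h \<one> = 0"
begin

text \<open>Along powers of two the limit exists by telescoping; \<open>h_pow_limit\<close>
  identifies it with the limit over all multiples that occurs in \<open>canonical_height\<close>.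
  The factor 1/2 of the latter is absent here: the canonical height is \<open>q / 2\<close> and the
  height pairing is \<open>B / 2\<close>.\<close>

definition q :: "'a \<Rightarrow> real" where
  "q x = lim (\<lambda>k. h (x [^] (2 ^ k :: nat)) / 4 ^ k)"

definition B :: "'a \<Rightarrow> 'a \<Rightarrow> real" where
  "B x y = (q (x \<otimes> y) - q x - q y) / 2"

lemma tate_steps:
  assumes "x \<in> carrier G"
  shows "\<bar>h (x [^] (2 ^ Suc k :: nat)) / 4 ^ Suc k - h (x [^] (2 ^ k :: nat)) / 4 ^ k\<bar>
      \<le> K / 4 ^ Suc k"
proof -
  define y where "y = x [^] (2 ^ k :: nat)"
  have y: "y \<in> carrier G" using assms by (simp add: y_def)
  have yy: "x [^] (2 ^ Suc k :: nat) = y \<otimes> y"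
    using assms by (simp add: y_def nat_pow_mult mult_2)
  have "\<bar>h (y \<otimes> y) - 4 * h y\<bar> \<le> K"
    using quasi_parallelogram[OF y y] y by (simp add: h_one)
  moreover have "h (y \<otimes> y) / 4 ^ Suc k - h y / 4 ^ k = (h (y \<otimes> y) - 4 * h y) / 4 ^ Suc k"
    by (simp add: field_simps)
  ultimately show ?thesis
    unfolding yy y_def[symmetric] by (simp add: abs_divide divide_right_mono)
qed

lemma q_limit:
  assumes "x \<in> carrier G"
  shows "(\<lambda>k. h (x [^] (2 ^ k :: nat)) / 4 ^ k) \<longlonglongrightarrow> q x"
  using tate_limit(1)[of "\<lambda>k. h (x [^] (2 ^ k :: nat)) / 4 ^ k" K] tate_steps[OF assms]
  unfolding q_def convergent_LIMSEQ_iff by simp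

lemma q_diff_h:
  assumes "x \<in> carrier G"
  shows "\<bar>q x - h x\<bar> \<le> K"
  using tate_limit(2)[of "\<lambda>k. h (x [^] (2 ^ k :: nat)) / 4 ^ k" K] tate_steps[OF assms] assms
  unfolding q_def by simp

lemma parallelogram:
  assumes "x \<in> carrier G" "y \<in> carrier G"
  shows "q (x \<otimes> y) + q (x \<otimes> inv y) = 2 * q x + 2 * q y"
proof -
  define d where "d k = h ((x \<otimes> y) [^] (2 ^ k :: nat)) / 4 ^ k
     + h ((x \<otimes> inv y) [^] (2 ^ k :: nat)) / 4 ^ k
     - 2 * (h (x [^] (2 ^ k :: nat)) / 4 ^ k) - 2 * (h (y [^] (2 ^ k :: nat)) / 4 ^ k)" for k
  have "d \<longlonglongrightarrow> q (x \<otimes> y) + q (x \<otimes> inv y) - 2 * q x - 2 * q y"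
    unfolding d_def using assms by (intro tendsto_intros q_limit) auto
  moreover have "d \<longlonglongrightarrow> 0"
  proof (rule tendsto_0_le[where f = "\<lambda>k. K / 4 ^ k" and K = 1])
    show "(\<lambda>k. K / 4 ^ k) \<longlonglongrightarrow> 0"
      using tendsto_mult[OF tendsto_const[of K] LIMSEQ_power_zero[of "1/4::real"]]
      by (simp add: power_one_over field_simps)
    have "\<bar>d k\<bar> \<le> K / 4 ^ k" for k
    proof -
      define u v where "u = x [^] (2 ^ k :: nat)" and "v = y [^] (2 ^ k :: nat)"
      have uv: "u \<in> carrier G" "v \<in> carrier G" using assms by (auto simp: u_def v_def)
      have "d k = (h (u \<otimes> v) + h (u \<otimes> inv v) - 2 * h u - 2 * h v) / 4 ^ k"
        using assms by (simp add: d_def u_def v_def nat_pow_distrib nat_pow_inv field_simps)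
      thus ?thesis using quasi_parallelogram[OF uv] by (simp add: abs_divide divide_right_mono)
    qed
    hence "\<bar>d k\<bar> \<le> \<bar>K\<bar> / 4 ^ k" for k
      by (rule order.trans) (simp add: divide_right_mono)
    thus "\<forall>\<^sub>F k in sequentially. norm (d k) \<le> norm (K / 4 ^ k) * 1"
      by (intro always_eventually allI) (simp add: abs_divide)
  qed
  ultimately have "q (x \<otimes> y) + q (x \<otimes> inv y) - 2 * q x - 2 * q y = 0"
    by (rule LIMSEQ_unique)
  thus ?thesis by simp
qed

lemma q_one: "q \<one> = 0"
  unfolding q_def by (simp add: h_one)

lemma q_pow:
  assumes x: "x \<in> carrier G"
  shows "q (x [^] (n::nat)) = real n ^ 2 * q x"
proof (induction n rule: less_induct)
  case (less n)
  consider "n = 0" | "n = 1" | m where "n = Suc (Suc m)" by (metis One_nat_def not0_implies_Suc)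
  thus ?case
  proof cases
    case 3
    have "x [^] Suc m \<otimes> inv x = x [^] m" using x by (simp add: m_assoc)
    hence "q (x [^] n) + q (x [^] m) = 2 * q (x [^] Suc m) + 2 * q x"
      using parallelogram[of "x [^] Suc m" x] x 3 by simp
    thus ?thesis using less[of m] less[of "Suc m"] 3
      by (simp add: algebra_simps power2_eq_square)
  qed (use x in \<open>auto simp: q_one\<close>)
qed

text \<open>By \<open>q_pow\<close> and \<open>q_diff_h\<close> the error at \<open>n\<close> is at
  most \<open>K / n^2\<close>.\<close>

lemma h_pow_limit:
  assumes x: "x \<in> carrier G"
  shows "(\<lambda>n. h (x [^] (n::nat)) / real n ^ 2) \<longlonglongrightarrow> q x"
proof (rule Lim_transform[OF tendsto_const])
  have "\<bar>q x - h (x [^] n) / real n ^ 2\<bar> \<le> K / real n ^ 2" if "n > 0" for n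
  proof -
    have "q x - h (x [^] n) / real n ^ 2 = (q (x [^] n) - h (x [^] n)) / real n ^ 2"
      using that by (simp add: q_pow[OF x] diff_divide_distrib)
    thus ?thesis using q_diff_h[of "x [^] n"] x by (simp add: abs_divide divide_right_mono)
  qed
  hence ev: "\<forall>\<^sub>F n in sequentially. norm (h (x [^] n) / real n ^ 2 - q x) \<le> K / real n ^ 2"
    by (intro eventually_sequentiallyI[of 1]) (simp add: abs_minus_commute)
  have "(\<lambda>n. K / real n ^ 2) \<longlonglongrightarrow> 0"
    by (intro real_tendsto_divide_at_top[OF tendsto_const] filterlim_pow_at_top
        filterlim_real_sequentially) simp
  thus "(\<lambda>n. h (x [^] n) / real n ^ 2 - q x) \<longlonglongrightarrow> 0"
    by (rule Lim_null_comparison[OF ev])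
qed

lemma B_commute: "\<lbrakk>x \<in> carrier G; y \<in> carrier G\<rbrakk> \<Longrightarrow> B x y = B y x"
  by (simp add: B_def m_comm)

text \<open>The Jordan-von Neumann argument: a linear combination of four instances of the
  parallelogram law.\<close>

lemma B_add:
  assumes "x \<in> carrier G" "y \<in> carrier G" "z \<in> carrier G"
  shows "B (x \<otimes> y) z = B x z + B y z"
proof -
  have 1: "q (x \<otimes> y \<otimes> z) + q (x \<otimes> y \<otimes> inv z) = 2 * q (x \<otimes> y) + 2 * q z"
    using assms by (intro parallelogram) auto
  have "x \<otimes> inv (y \<otimes> inv z) = x \<otimes> z \<otimes> inv y" "x \<otimes> (y \<otimes> inv z) = x \<otimes> y \<otimes> inv z"
    using assms by (simp_all add: inv_mult m_ac)
  hence 2: "q (x \<otimes> y \<otimes> inv z) + q (x \<otimes> z \<otimes> inv y) = 2 * q x + 2 * q (y \<otimes> inv z)"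
    using parallelogram[of x "y \<otimes> inv z"] assms by simp
  have "x \<otimes> z \<otimes> y = x \<otimes> y \<otimes> z" using assms by (simp add: m_ac)
  hence 3: "q (x \<otimes> y \<otimes> z) + q (x \<otimes> z \<otimes> inv y) = 2 * q (x \<otimes> z) + 2 * q y"
    using parallelogram[of "x \<otimes> z" y] assms by simp
  have 4: "q (y \<otimes> z) + q (y \<otimes> inv z) = 2 * q y + 2 * q z"
    using assms by (intro parallelogram) auto
  show ?thesis unfolding B_def using 1 2 3 4 by (simp add: field_simps)
qed

lemma B_self: "x \<in> carrier G \<Longrightarrow> B x x = q x"
  using parallelogram[of x x] by (simp add: B_def q_one)

lemma B_one: "x \<in> carrier G \<Longrightarrow> B \<one> x = 0"
  by (simp add: B_def q_one)

lemma B_pow: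
  assumes "x \<in> carrier G" "y \<in> carrier G"
  shows "B (x [^] (n::nat)) y = real n * B x y"
proof (induction n)
  case (Suc n)
  have "B (x [^] Suc n) y = B (x [^] n) y + B x y" using assms by (simp add: B_add)
  thus ?case by (simp add: Suc.IH distrib_right)
qed (use assms in \<open>simp add: B_one\<close>)

lemma torsion_q:
  assumes "t \<in> carrier G" "n > 0" "t [^] (n::nat) = \<one>"
  shows "q t = 0"
  using q_pow[OF assms(1), of n] assms(2) by (simp add: assms(3) q_one)

lemma torsion_B:
  assumes "t \<in> carrier G" "n > 0" "t [^] (n::nat) = \<one>" "x \<in> carrier G"
  shows "B t x = 0"
  using B_pow[OF assms(1,4), of n] assms(2) by (simp add: assms(3,4) B_one)

lemma q_add_torsion:
  assumes "t \<in> carrier G" "n > 0" "t [^] (n::nat) = \<one>" "x \<in> carrier G"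
  shows "q (x \<otimes> t) = q x"
proof -
  have "B x t = 0" using torsion_B[OF assms] B_commute[OF assms(4,1)] by simp
  thus ?thesis using torsion_q[OF assms(1-3)] by (simp add: B_def)
qed

lemma q_nonneg:
  assumes "\<And>y. y \<in> carrier G \<Longrightarrow> h y \<ge> 0" "x \<in> carrier G"
  shows "q x \<ge> 0"
proof (rule LIMSEQ_le_const[OF h_pow_limit[OF assms(2)]], intro exI allI impI)
  show "0 \<le> h (x [^] n) / real n ^ 2" for n :: nat
    using assms(1)[of "x [^] n"] assms(2) by simp
qed

text \<open>If \<open>q x\<close> were smaller, then too many multiples of \<open>x\<close> would satisfy \<open>q \<le> 1\<close>.\<close>

lemma q_lower_bound:
  assumes fin: "finite {y \<in> carrier G. q y \<le> 1}" and c: "card {y \<in> carrier G. q y \<le> 1} \<le> c"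
    and nonneg: "\<And>y. y \<in> carrier G \<Longrightarrow> h y \<ge> 0"
    and x: "x \<in> carrier G" and nt: "\<And>n. n > 0 \<Longrightarrow> x [^] (n::nat) \<noteq> \<one>"
  shows "q x \<ge> 1 / real c ^ 2"
proof (rule ccontr)
  assume "\<not> ?thesis"
  hence lt: "q x < 1 / real c ^ 2" by simp
  have "\<one> \<in> {y \<in> carrier G. q y \<le> 1}" by (simp add: q_one)
  hence c0: "c > 0" using fin c by (metis card_gt_0_iff empty_iff le_zero_eq neq0_conv)
  have lq: "real c ^ 2 * q x < 1" using lt c0 by (simp add: field_simps)
  have inj: "inj_on (\<lambda>n. x [^] (n::nat)) {0..c}"
  proof -
    have "m = n" if "m \<le> n" "x [^] m = x [^] n" for m n :: nat
    proof (rule ccontr)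
      assume "m \<noteq> n"
      moreover have "x [^] m \<otimes> x [^] (n - m) = x [^] n"
        using that(1) x by (simp add: nat_pow_mult)
      hence "x [^] m \<otimes> x [^] (n - m) = x [^] m \<otimes> \<one>" using that(2) x by simp
      hence "x [^] (n - m) = \<one>" using x by (subst (asm) Units_l_cancel) (auto simp: Units_eq)
      ultimately show False using nt[of "n - m"] that by simp
    qed
    thus ?thesis by (intro inj_onI) (metis nle_le)
  qed
  have sub: "(\<lambda>n. x [^] (n::nat)) ` {0..c} \<subseteq> {y \<in> carrier G. q y \<le> 1}"
  proof safe
    fix n assume "n \<in> {0..c}"
    hence "real n ^ 2 * q x \<le> real c ^ 2 * q x"
      using q_nonneg[OF nonneg x] by (intro mult_right_mono power_mono) auto
    thus "q (x [^] n) \<le> 1" using lq by (simp add: q_pow[OF x])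
  qed (use x in auto)
  have "card {0..c} \<le> card {y \<in> carrier G. q y \<le> 1}"
    using card_mono[OF fin sub] card_image[OF inj] by simp
  thus False using c by simp
qed

end

text \<open>The reverse inequality comes from \<open>upper\<close> applied to the sum and the
  difference of \<open>x\<close> and \<open>y\<close>, whose own sum and difference are the doubles
  of \<open>x\<close> and \<open>y\<close>, together with \<open>dup\<close>. It loses
  \<open>3 c / 2\<close>, which is rounded up to \<open>2 c\<close>.\<close>

lemma (in comm_group) height_groupI:
  assumes "h \<one> = 0" "c \<ge> 0"
    and upper: "\<And>x y. x \<in> carrier G \<Longrightarrow> y \<in> carrier G \<Longrightarrow>
      h (x \<otimes> y) + h (x \<otimes> inv y) \<le> c + 2 * h x + 2 * h y"
    and dup: "\<And>x. x \<in> carrier G \<Longrightarrow> 4 * h x \<le> c + h (x \<otimes> x)"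
  shows "height_group G h (2 * c)"
proof unfold_locales
  fix x y assume xy: "x \<in> carrier G" "y \<in> carrier G"
  define u v where "u = x \<otimes> y" and "v = x \<otimes> inv y"
  have uv: "u \<in> carrier G" "v \<in> carrier G" using xy by (auto simp: u_def v_def)
  have "u \<otimes> v = (x \<otimes> x) \<otimes> (y \<otimes> inv y)"
    unfolding u_def v_def using xy by (simp only: m_ac m_closed inv_closed)
  hence 1: "u \<otimes> v = x \<otimes> x" using xy by simp
  have "inv v = inv x \<otimes> y" using xy by (simp add: v_def inv_mult)
  hence "u \<otimes> inv v = (y \<otimes> y) \<otimes> (x \<otimes> inv x)"
    unfolding u_def using xy by (simp only: m_ac m_closed inv_closed)
  hence 2: "u \<otimes> inv v = y \<otimes> y" using xy by simp
  have "4 * h x + 4 * h y \<le> 3 * c + 2 * h u + 2 * h v"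
    using dup[OF xy(1)] dup[OF xy(2)] upper[OF uv] unfolding 1 2 by linarith
  thus "\<bar>h (x \<otimes> y) + h (x \<otimes> inv y) - 2 * h x - 2 * h y\<bar> \<le> 2 * c"
    using upper[OF xy] assms(2) unfolding u_def v_def by linarith
qed (rule assms(1))

section \<open>Heights on the Mordell-Weil group and finiteness\<close>

lemma inv_mw_group:
  assumes "elliptic_curve a b" "P \<in> rational_points a b"
  shows "inv\<^bsub>mw_group a b\<^esub> P = ec_neg P"
proof -
  interpret comm_group "mw_group a b" by (rule comm_group_mw_group[OF assms(1)])
  have "ec_neg P \<otimes>\<^bsub>mw_group a b\<^esub> P = \<one>\<^bsub>mw_group a b\<^esub>"
    using ec_add_neg_right[of a "ec_neg P"] by (simp add: mw_group_def)
  thus ?thesis by (rule inv_equality) (use assms in \<open>auto simp: mw_group_def\<close>)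
qed

definition height_const :: "int \<Rightarrow> int \<Rightarrow> real" where
  "height_const a4 a6 = 2 * ln (700 * (1 + \<bar>real_of_int a4\<bar> + \<bar>real_of_int a6\<bar>) ^ 5)"

lemma height_group_mw_group:
  assumes E: "elliptic_curve a4 a6"
  shows "height_group (mw_group a4 a6) weil_height (height_const a4 a6)"
proof -
  interpret comm_group "mw_group a4 a6" by (rule comm_group_mw_group[OF E])
  define C where "C = 700 * (1 + \<bar>a4\<bar> + \<bar>a6\<bar>) ^ 5"
  define c where "c = ln (real_of_int C)"
  have C1: "C \<ge> 1" unfolding C_def using C_ge[OF E] .
  hence c0: "c \<ge> 0" by (simp add: c_def)
  have Cp: "real_of_int C > 0" using C1 by simp
  have K: "height_const a4 a6 = 2 * c" by (simp add: height_const_def c_def C_def)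
  define h where "h = weil_height"
  have h: "h P = ln (real_of_int (pt_height P))" for P by (simp add: h_def weil_height_eq)
  have h0: "h P \<ge> 0" for P unfolding h_def by (rule weil_height_nonneg)
  have hneg: "h (ec_neg P) = h P" and hone: "h Infinity = 0" for P by (simp_all add: h)
  have ln_bound: "ln (real_of_int u) \<le> ln (real_of_int v)" if "u \<le> v" "u \<ge> 1" for u v :: int
    using that by simp
  have pos: "real_of_int (pt_height P) > 0" for P using pt_height_ge_1[of P] by linarith
  have dup: "h (ec_add a4 P P) \<le> c + 4 * h P" "4 * h P \<le> c + h (ec_add a4 P P)"
    if P: "P \<in> rational_points a4 a6" for P
  proof -
    have 1: "pt_height (ec_add a4 P P) \<le> C * pt_height P ^ 4"
      "pt_height P ^ 4 \<le> C * pt_height (ec_add a4 P P)"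
      using duplication_bound[OF E P] unfolding C_def by auto
    have "ln (real_of_int (C * pt_height P ^ 4)) = c + 4 * h P"
      using Cp pos[of P] by (simp add: c_def h ln_mult ln_realpow)
    thus "h (ec_add a4 P P) \<le> c + 4 * h P"
      using ln_bound[OF 1(1) pt_height_ge_1] by (simp add: h)
    have "ln (real_of_int (C * pt_height (ec_add a4 P P))) = c + h (ec_add a4 P P)"
      using Cp pos[of "ec_add a4 P P"] by (simp add: c_def h ln_mult)
    moreover have "ln (real_of_int (pt_height P ^ 4)) = 4 * h P"
      using pos[of P] by (simp add: h ln_realpow)
    ultimately show "4 * h P \<le> c + h (ec_add a4 P P)"
      using ln_bound[OF 1(2)] pt_height_ge_1[of P] by simp
  qed
  have upper: "h (ec_add a4 P Q) + h (ec_add a4 P (ec_neg Q)) \<le> c + 2 * h P + 2 * h Q"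
    if PQ: "P \<in> rational_points a4 a6" "Q \<in> rational_points a4 a6" for P Q
  proof (cases "P = Infinity \<or> Q = Infinity")
    case True thus ?thesis using h0 c0 by (auto simp: hneg hone)
  next
    case False
    then obtain x1 y1 x2 y2 where P: "P = Affine x1 y1" and Q: "Q = Affine x2 y2"
      by (metis point.exhaust)
    show ?thesis
    \<comment> \<open>The abscissae agree only if Q is P or - P; then the sum and the difference are
      2P and \<open>Infinity\<close> in some order, and the duplication bound suffices.\<close>
    proof (cases "x1 = x2")
      case True
      have "y1 ^ 2 = y2 ^ 2" using PQ True P Q by simp
      hence "Q = P \<or> Q = ec_neg P" using P Q True by (auto simp: power2_eq_iff)
      hence "h Q = h P" "h (ec_add a4 P Q) + h (ec_add a4 P (ec_neg Q)) = h (ec_add a4 P P)"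
        using hneg hone by auto
      thus ?thesis using dup(1)[OF PQ(1)] by simp
    next
      case False
      define U V where "U = ec_add a4 P Q" and "V = ec_add a4 P (ec_neg Q)"
      have "pt_height U * pt_height V \<le> C * (pt_height P)\<^sup>2 * (pt_height Q)\<^sup>2"
        unfolding U_def V_def P Q C_def ec_neg.simps
        by (rule height_sum_diff_bound[OF E _ _ False]) (use PQ P Q in auto)
      moreover have "pt_height U * pt_height V \<ge> 1"
        using mult_mono[OF pt_height_ge_1 pt_height_ge_1, of U V] pt_height_ge_1[of U] by simp
      ultimately have "ln (real_of_int (pt_height U * pt_height V))
          \<le> ln (real_of_int (C * (pt_height P)\<^sup>2 * (pt_height Q)\<^sup>2))"
        by (rule ln_bound)
      moreover have "ln (real_of_int (pt_height U * pt_height V)) = h U + h V"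
        using pos[of U] pos[of V] by (simp add: h ln_mult)
      moreover have "ln (real_of_int (C * (pt_height P)\<^sup>2 * (pt_height Q)\<^sup>2)) = c + 2 * h P + 2 * h Q"
        using pos[of P] pos[of Q] Cp by (simp add: h c_def ln_mult ln_realpow)
      ultimately show ?thesis by (simp add: U_def V_def)
    qed
  qed
  have carrier: "carrier (mw_group a4 a6) = rational_points a4 a6" by (simp add: mw_group_def)
  show ?thesis
    unfolding K h_def[symmetric]
    by (rule height_groupI[OF _ c0]; (subst inv_mw_group[OF E])?)
      (use upper dup(2) hone in \<open>simp_all add: mw_group_def\<close>)
qed

text \<open>The bound counts numerators, denominators and signs of y, plus the point at infinity. It
  is explicit because it yields, through \<open>q_lower_bound\<close>, an effective lower bound for
  the heights of non-torsion points, and it also bounds the torsion.\<close>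

lemma northcott:
  fixes X :: nat and a b :: int
  defines "S \<equiv> {P \<in> rational_points a b. pt_height P \<le> int X}"
  shows "finite S" "card S \<le> 1 + 2 * (2 * X + 1) * X"
proof -
  define f where "f P = (case P of Infinity \<Rightarrow> ((0, 0), True)
      | Affine x y \<Rightarrow> (quotient_of x, y \<ge> 0))" for P
  define T where "T = ({- int X..int X} \<times> {1..int X}) \<times> (UNIV :: bool set)"
  define S' where "S' = S - {Infinity}"
  have inj: "inj_on f S'"
  proof (rule inj_onI)
    fix P Q assume PQ: "P \<in> S'" "Q \<in> S'" "f P = f Q"
    then obtain x1 y1 x2 y2 where P: "P = Affine x1 y1" and Q: "Q = Affine x2 y2"
      by (cases P; cases Q) (auto simp: S'_def)
    have x: "x1 = x2" and s: "y1 \<ge> 0 \<longleftrightarrow> y2 \<ge> 0"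
      using PQ(3) quotient_of_inject by (auto simp: f_def P Q)
    have "y1 ^ 2 = y2 ^ 2" using PQ x by (auto simp: S'_def S_def P Q)
    hence "y1 = y2" using s by (auto simp: power2_eq_iff)
    thus "P = Q" using P Q x by simp
  qed
  have sub: "f ` S' \<subseteq> T"
  proof
    fix z assume "z \<in> f ` S'"
    then obtain P where P: "P \<in> S'" "z = f P" by blast
    then obtain x y where xy: "P = Affine x y" by (cases P) (auto simp: S'_def)
    obtain n d where nd: "quotient_of x = (n, d)" "d > 0" by (rule quotient_of_cases)
    thus "z \<in> T" using P xy by (auto simp: S'_def S_def T_def f_def)
  qed
  have T: "finite T" "card T = (2 * X + 1) * X * 2"
    by (auto simp: T_def card_cartesian_product nat_add_distrib nat_mult_distrib)
  have fS': "finite S'" using inj sub T(1) inj_on_finite by blast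
  have S: "S \<subseteq> insert Infinity S'" by (auto simp: S'_def)
  thus "finite S" using fS' finite_subset by blast
  have "card S \<le> card (insert Infinity S')" using S fS' by (intro card_mono) auto
  also have "\<dots> \<le> 1 + card S'" using fS' by (simp add: card_insert_if)
  also have "card S' \<le> (2 * X + 1) * X * 2"
    using card_inj_on_le[OF inj sub T(1)] T(2) by simp
  finally show "card S \<le> 1 + 2 * (2 * X + 1) * X" by simp
qed

section \<open>Counting lattice points\<close>

text \<open>The lattice of rank \<open>r\<close> is modelled as the group of integral polynomials of degree
  less than \<open>r\<close>: this makes vectors of different lengths elements of one additive group,
  and \<open>pCons\<close> splits off the first coordinate.\<close>

definition lat :: "nat \<Rightarrow> int poly set" where
  "lat r = {p. \<forall>i\<ge>r. coeff p i = 0}"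

definition additive_fun :: "('a::plus \<Rightarrow> 'b::plus) \<Rightarrow> bool" where
  "additive_fun f \<longleftrightarrow> (\<forall>x y. f (x + y) = f x + f y)"

definition sym_bilinear :: "('a::ab_group_add \<Rightarrow> 'a \<Rightarrow> real) \<Rightarrow> bool" where
  "sym_bilinear b \<longleftrightarrow> (\<forall>x y. b x y = b y x) \<and> (\<forall>x. additive_fun (b x))"

text \<open>The maps are additive on all polynomials but inverse to each other only on
  \<open>lat r\<close>, so additivity can be applied without membership conditions.\<close>

definition lat_iso :: "nat \<Rightarrow> (int poly \<Rightarrow> int poly) \<Rightarrow> (int poly \<Rightarrow> int poly) \<Rightarrow> bool" where
  "lat_iso r f g \<longleftrightarrow> additive_fun f \<and> additive_fun g \<and>
     (\<forall>p\<in>lat r. f p \<in> lat r \<and> g p \<in> lat r \<and> f (g p) = p \<and> g (f p) = p)"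

definition lat_aut :: "nat \<Rightarrow> (int poly \<Rightarrow> int poly) \<Rightarrow> bool" where
  "lat_aut r f \<longleftrightarrow> (\<exists>g. lat_iso r f g)"

text \<open>Gram-Schmidt coordinates: \<open>c i j\<close> is the coefficient of the j-th basis
  vector along the i-th orthogonalised vector, whose squared length is the \<open>\<beta> i\<close>
  of later statements.\<close>

definition tri :: "nat \<Rightarrow> (nat \<Rightarrow> nat \<Rightarrow> real) \<Rightarrow> int poly \<Rightarrow> nat \<Rightarrow> real" where
  "tri r c p i = of_int (coeff p i) + (\<Sum>j\<in>{Suc i..<r}. c i j * of_int (coeff p j))"

lemma additive_funD: "additive_fun f \<Longrightarrow> f (x + y) = f x + f y"
  by (simp add: additive_fun_def)

lemma additive_fun_0: "additive_fun f \<Longrightarrow> f 0 = 0"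
  for f :: "'a::ab_group_add \<Rightarrow> 'b::ab_group_add"
  using additive_funD[of f 0 0] by simp

lemma additive_fun_minus: "additive_fun f \<Longrightarrow> f (- x) = - f x"
  for f :: "'a::ab_group_add \<Rightarrow> 'b::ab_group_add"
  using additive_funD[of f x "- x"] additive_fun_0[of f] by (simp add: eq_neg_iff_add_eq_0 add.commute)

lemma additive_fun_sum: "additive_fun f \<Longrightarrow> f (sum g A) = (\<Sum>i\<in>A. f (g i))"
  for f :: "'a::ab_group_add \<Rightarrow> 'b::ab_group_add"
  by (induction A rule: infinite_finite_induct) (auto simp: additive_fun_0 additive_funD)

lemma additive_fun_smult:
  fixes f :: "int poly \<Rightarrow> real"
  assumes f: "additive_fun f"
  shows "f (smult k x) = of_int k * f x"
proof -
  have nat: "f (smult (int n) x) = of_nat n * f x" for n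
    by (induction n) (auto simp: additive_fun_0[OF f] additive_funD[OF f] smult_add_left algebra_simps)
  show ?thesis
  proof (cases "k \<ge> 0")
    case True thus ?thesis using nat[of "nat k"] by simp
  next
    case False
    have "f (smult (- k) x) = - f (smult k x)"
      using additive_fun_minus[OF f, of "smult k x"] by simp
    thus ?thesis using False nat[of "nat (- k)"] by simp
  qed
qed

lemma lat_decompose:
  assumes "p \<in> lat r"
  shows "p = (\<Sum>i<r. smult (coeff p i) (monom 1 i))"
proof (rule poly_eqI)
  fix n
  have "coeff (\<Sum>i<r. smult (coeff p i) (monom 1 i)) n = (\<Sum>i<r. if i = n then coeff p i else 0)"
    unfolding coeff_sum by (intro sum.cong) auto
  also have "\<dots> = coeff p n" using assms by (simp add: lat_def)
  finally show "coeff p n = coeff (\<Sum>i<r. smult (coeff p i) (monom 1 i)) n" ..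
qed

lemma additive_fun_expand:
  fixes f :: "int poly \<Rightarrow> real"
  assumes "additive_fun f" "p \<in> lat r"
  shows "f p = (\<Sum>i<r. of_int (coeff p i) * f (monom 1 i))"
  by (subst lat_decompose[OF assms(2)])
    (simp add: additive_fun_sum[OF assms(1)] additive_fun_smult[OF assms(1)])

lemma additive_fun_compose:
  "additive_fun f \<Longrightarrow> additive_fun g \<Longrightarrow> additive_fun (\<lambda>x. f (g x))"
  by (simp add: additive_fun_def)

lemma pCons_lat_iff [simp]: "pCons x p \<in> lat (Suc r) \<longleftrightarrow> p \<in> lat r"
  by (force simp: lat_def coeff_pCons split: nat.splits)

lemma lat_0 [simp]: "lat 0 = {0}"
  by (auto simp: lat_def poly_eq_iff)

lemma one_in_lat [simp]: "1 \<in> lat (Suc r)"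
  by (simp add: one_pCons lat_def coeff_pCons split: nat.splits)

lemma monom_in_lat [simp]: "i < r \<Longrightarrow> monom 1 i \<in> lat r"
  by (auto simp: lat_def)

lemma lat_smult: "p \<in> lat r \<Longrightarrow> smult k p \<in> lat r"
  by (simp add: lat_def)

section \<open>Automorphisms and reduced bases of the lattice\<close>

lemma lat_isoD:
  assumes "lat_iso r f g"
  shows "additive_fun f" "\<And>p. p \<in> lat r \<Longrightarrow> f p \<in> lat r" "additive_fun g"
    "\<And>p. p \<in> lat r \<Longrightarrow> g p \<in> lat r" "\<And>p. p \<in> lat r \<Longrightarrow> f (g p) = p" "\<And>p. p \<in> lat r \<Longrightarrow> g (f p) = p"
  using assms by (auto simp: lat_iso_def)

lemma lat_aut_image: "lat_aut r f \<Longrightarrow> p \<in> lat r \<Longrightarrow> f p \<in> lat r"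
  and lat_aut_additive: "lat_aut r f \<Longrightarrow> additive_fun f"
  by (auto simp: lat_aut_def dest: lat_isoD)

lemma lat_autI:
  assumes "additive_fun f" "\<And>p. p \<in> lat r \<Longrightarrow> f p \<in> lat r" "additive_fun g"
    "\<And>p. p \<in> lat r \<Longrightarrow> g p \<in> lat r" "\<And>p. p \<in> lat r \<Longrightarrow> f (g p) = p" "\<And>p. p \<in> lat r \<Longrightarrow> g (f p) = p"
  shows "lat_aut r f"
  using assms unfolding lat_aut_def lat_iso_def by blast

lemma lat_aut_id: "lat_aut r (\<lambda>p. p)"
  by (rule lat_autI[where g = "\<lambda>p. p"]) (auto simp: additive_fun_def)

lemma lat_aut_compose:
  assumes "lat_aut r f" "lat_aut r f'"
  shows "lat_aut r (\<lambda>p. f (f' p))"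
proof -
  obtain g where "lat_iso r f g" using assms(1) by (auto simp: lat_aut_def)
    note g = lat_isoD[OF this]
  obtain g' where "lat_iso r f' g'" using assms(2) by (auto simp: lat_aut_def)
    note g' = lat_isoD[OF this]
  show ?thesis
    by (rule lat_autI[where g = "\<lambda>p. g' (g p)"])
      (use g g' in \<open>auto intro: additive_fun_compose\<close>)
qed

text \<open>A block matrix with an entry 1 in front: it extends a change of basis of the projected
  lattice and keeps the first coordinate.\<close>

definition lift_aut :: "(int poly \<Rightarrow> int poly) \<Rightarrow> int poly \<Rightarrow> int poly" where
  "lift_aut f p = pCons (coeff p 0) (f (poly_shift 1 p))"

lemma lift_aut_pCons [simp]: "lift_aut f (pCons x p) = pCons x (f p)"
proof -
  have "poly_shift 1 (pCons x p) = p" by (rule poly_eqI) (simp add: coeff_poly_shift)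
  thus ?thesis by (simp add: lift_aut_def)
qed

lemma additive_fun_pCons:
  assumes "\<And>x y p q. f (pCons (x + y) (p + q)) = f (pCons x p) + f (pCons y q)"
  shows "additive_fun f"
  unfolding additive_fun_def
proof (intro allI)
  fix p q show "f (p + q) = f p + f q"
    by (cases p; cases q) (simp add: assms)
qed

lemma lat_Suc_cases:
  assumes "p \<in> lat (Suc r)"
  obtains x q where "p = pCons x q" "q \<in> lat r"
  using assms by (cases p) auto

lemma lat_aut_lift:
  assumes "lat_aut r f"
  shows "lat_aut (Suc r) (lift_aut f)"
proof -
  obtain g where "lat_iso r f g" using assms by (auto simp: lat_aut_def)
    note g = lat_isoD[OF this]
  show ?thesis
  proof (rule lat_autI[where g = "lift_aut g"])
    show "additive_fun (lift_aut f)" "additive_fun (lift_aut g)"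
      by (auto intro!: additive_fun_pCons simp: additive_funD[OF g(1)] additive_funD[OF g(3)])
  qed (use g in \<open>auto elim!: lat_Suc_cases\<close>)
qed

text \<open>The reduce-and-swap step of basis reduction: the unit vector \<open>e0\<close> goes to
  \<open>k e0 + e1\<close>, and \<open>e1\<close> goes to \<open>e0\<close>.\<close>

definition swap_aut :: "int \<Rightarrow> int poly \<Rightarrow> int poly" where
  "swap_aut k p = pCons (k * coeff p 0 + coeff p 1) (pCons (coeff p 0) (poly_shift 2 p))"

lemma swap_aut_pCons [simp]:
  "swap_aut k (pCons x (pCons y p)) = pCons (k * x + y) (pCons x p)"
proof -
  have "poly_shift 2 (pCons x (pCons y p)) = p"
    by (rule poly_eqI) (simp add: coeff_poly_shift numeral_2_eq_2)
  thus ?thesis by (simp add: swap_aut_def)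
qed

definition swap_inv :: "int \<Rightarrow> int poly \<Rightarrow> int poly" where
  "swap_inv k p = pCons (coeff p 1) (pCons (coeff p 0 - k * coeff p 1) (poly_shift 2 p))"

lemma swap_inv_pCons [simp]:
  "swap_inv k (pCons x (pCons y p)) = pCons y (pCons (x - k * y) p)"
proof -
  have "poly_shift 2 (pCons x (pCons y p)) = p"
    by (rule poly_eqI) (simp add: coeff_poly_shift numeral_2_eq_2)
  thus ?thesis by (simp add: swap_inv_def)
qed

lemma lat_aut_swap: "lat_aut (Suc (Suc r)) (swap_aut k)"
proof (rule lat_autI[where g = "swap_inv k"])
  have shift: "poly_shift 2 (p + q) = poly_shift 2 p + poly_shift 2 q" for p q :: "int poly"
    by (rule poly_eqI) (simp add: coeff_poly_shift)
  show "additive_fun (swap_aut k)" "additive_fun (swap_inv k)"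
    by (auto simp: additive_fun_def swap_aut_def swap_inv_def shift algebra_simps)
qed (auto elim!: lat_Suc_cases)

lemma round_error: "(of_int (- round x) + x) ^ 2 \<le> (1/4 :: real)"
proof -
  have "\<bar>of_int (- round x) + x\<bar> \<le> 1/2" using of_int_round_abs_le[of x] by (simp add: abs_minus_commute)
  hence "\<bar>of_int (- round x) + x\<bar> ^ 2 \<le> (1/2) ^ 2" by (intro power_mono) auto
  thus ?thesis by (simp add: power2_eq_square)
qed

text \<open>A reduced basis in the sense of Lenstra, Lenstra and Lovasz, without size reduction.
  The first vector is chosen of minimal length among all vectors that are part of a basis,
  which gives the inequality for the next Gram--Schmidt length.\<close>

theorem reduced_basis:
  assumes "sym_bilinear b" and "\<And>p. p \<in> lat r \<Longrightarrow> p \<noteq> 0 \<Longrightarrow> b p p > 0"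
    and "\<And>T. finite {p \<in> lat r. b p p \<le> T}"
  obtains f \<beta> c where "lat_aut r f" "\<And>i. i < r \<Longrightarrow> \<beta> i > 0"
    "\<And>i. Suc i < r \<Longrightarrow> 3 / 4 * \<beta> i \<le> \<beta> (Suc i)"
    "\<And>p q. p \<in> lat r \<Longrightarrow> q \<in> lat r \<Longrightarrow> b (f p) (f q) = (\<Sum>i<r. \<beta> i * tri r c p i * tri r c q i)"
proof -
  have "\<exists>f \<beta> c. lat_aut r f \<and> (\<forall>i<r. \<beta> i > 0) \<and> (\<forall>i. Suc i < r \<longrightarrow> 3 / 4 * \<beta> i \<le> \<beta> (Suc i)) \<and>
    (\<forall>p\<in>lat r. \<forall>q\<in>lat r. b (f p) (f q) = (\<Sum>i<r. \<beta> i * tri r c p i * tri r c q i))"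
    using assms
  proof (induction r arbitrary: b)
    case 0
    hence "b 0 0 = 0" using additive_fun_0 by (auto simp: sym_bilinear_def)
    thus ?case using lat_aut_id by (intro exI[of _ "\<lambda>p. p"]) auto
  next
    case (Suc r)
    \<comment> \<open>The polynomial 1 is the first unit vector, so \<open>A\<close> consists of the
      vectors that occur first in some basis. Passing to \<open>A1\<close> makes the set finite, and
      the vector 1 keeps it non-empty.\<close>
    define A where "A = {f 1 | f. lat_aut (Suc r) f}"
    have A: "A \<subseteq> lat (Suc r)" "1 \<in> A"
      unfolding A_def by (auto intro: lat_aut_image intro!: exI[of _ "\<lambda>p. p"] lat_aut_id)
    define A1 where "A1 = {p \<in> A. b p p \<le> b 1 1}"
    have "finite A1" unfolding A1_def
      by (rule finite_subset[OF _ Suc.prems(3)[of "b 1 1"]]) (use A in auto)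
    moreover have "A1 \<noteq> {}" using A by (auto simp: A1_def)
    ultimately have "Min ((\<lambda>p. b p p) ` A1) \<in> (\<lambda>p. b p p) ` A1"
      and min: "\<And>p. p \<in> A1 \<Longrightarrow> Min ((\<lambda>p. b p p) ` A1) \<le> b p p"
      by simp_all
    then obtain p0 where p0: "p0 \<in> A1" "\<And>p. p \<in> A1 \<Longrightarrow> b p0 p0 \<le> b p p"
      by (metis (mono_tags, lifting) imageE)
    have p0min: "b p0 p0 \<le> b p p" if "p \<in> A" for p
      using p0(1) p0(2)[of p] that by (cases "b p p \<le> b 1 1") (auto simp: A1_def)
    obtain f0 where f0: "lat_aut (Suc r) f0" "p0 = f0 1" using p0(1) by (auto simp: A1_def A_def)
    obtain g0 where "lat_iso (Suc r) f0 g0" using f0(1) by (auto simp: lat_aut_def)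
    note g0 = lat_isoD[OF this]
    define b1 where "b1 p q = b (f0 p) (f0 q)" for p q
    have b_sym: "b x y = b y x" and b_add: "b x (y + z) = b x y + b x z" for x y z
      using Suc.prems(1) by (auto simp: sym_bilinear_def additive_fun_def)
    have b1_sym: "b1 p q = b1 q p" for p q unfolding b1_def by (rule b_sym)
    have b1_add: "additive_fun (b1 p)" for p
      unfolding additive_fun_def b1_def by (simp add: additive_funD[OF g0(1)] b_add)
    have b1_pos: "b1 p p > 0" if "p \<in> lat (Suc r)" "p \<noteq> 0" for p
    proof -
      have "f0 p \<noteq> 0" using g0(6)[OF that(1)] that(2) additive_fun_0[OF g0(3)] by auto
      thus ?thesis using Suc.prems(2)[OF g0(2)[OF that(1)]] by (simp add: b1_def)
    qed
    have b1_fin: "finite {p \<in> lat (Suc r). b1 p p \<le> T}" for T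
    proof -
      have "{p \<in> lat (Suc r). b1 p p \<le> T} \<subseteq> g0 ` {p \<in> lat (Suc r). b p p \<le> T}"
      proof
        fix p assume "p \<in> {p \<in> lat (Suc r). b1 p p \<le> T}"
        thus "p \<in> g0 ` {p \<in> lat (Suc r). b p p \<le> T}"
          using g0(2,6) by (intro image_eqI[of _ _ "f0 p"]) (auto simp: b1_def)
      qed
      thus ?thesis using Suc.prems(3)[of T] finite_subset by blast
    qed
    define a where "a = b1 1 1"
    have a: "a > 0" unfolding a_def by (rule b1_pos) auto
    have amin: "a \<le> b1 (f 1) (f 1)" if "lat_aut (Suc r) f" for f
    proof -
      have "f0 (f 1) \<in> A" unfolding A_def using lat_aut_compose[OF f0(1) that] by auto
      thus ?thesis using p0min f0(2) by (simp add: a_def b1_def)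
    qed
    \<comment> \<open>\<open>l\<close> is the Gram-Schmidt coefficient along the first vector and
      \<open>g\<close> the form on the projection orthogonal to it, as \<open>split\<close>
      shows.\<close>
    define l where "l w = b1 1 (pCons 0 w) / a" for w
    define g where "g w w' = b1 (pCons 0 w) (pCons 0 w') - a * l w * l w'" for w w'
    have pC: "additive_fun (\<lambda>w::int poly. pCons 0 w)" by (simp add: additive_fun_def)
    have l_add: "additive_fun l"
      using additive_fun_compose[OF b1_add pC, of 1] by (simp add: additive_fun_def l_def add_divide_distrib)
    have g_bil: "sym_bilinear g"
    proof -
      have "g x (y + z) = g x y + g x z" for x y z
        using additive_funD[OF additive_fun_compose[OF b1_add pC]] additive_funD[OF l_add]
        by (simp add: g_def algebra_simps)
      moreover have "g x y = g y x" for x y by (simp add: g_def b1_sym[of "pCons 0 x"])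
      ultimately show ?thesis by (simp add: sym_bilinear_def additive_fun_def)
    qed
    have split: "b1 (pCons x w) (pCons y w') = a * (of_int x + l w) * (of_int y + l w') + g w w'"
      for x y w w'
    proof -
      have dec: "pCons x w = smult x 1 + pCons 0 w" for x :: int and w by (simp add: one_pCons)
      have e: "b1 q (pCons x w) = of_int x * b1 q 1 + b1 q (pCons 0 w)" for q x w
        by (subst dec) (simp only: additive_funD[OF b1_add] additive_fun_smult[OF b1_add])
      have l: "b1 1 (pCons 0 w) = a * l w" for w using a by (simp add: l_def)
      have e': "b1 (pCons x w) q = of_int x * b1 1 q + b1 (pCons 0 w) q" for q x w
        unfolding b1_sym[of _ q] by (rule e)
      have "b1 (pCons x w) (pCons y w') = of_int x * (of_int y * a + a * l w')
          + (of_int y * (a * l w) + b1 (pCons 0 w) (pCons 0 w'))"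
        unfolding e'[of x w "pCons y w'"] e[of 1 y w'] e[of "pCons 0 w" y w'] l
          b1_sym[of "pCons 0 w" 1] a_def[symmetric] ..
      thus ?thesis by (simp add: g_def algebra_simps)
    qed
    \<comment> \<open>Rounding the first coordinate lifts a vector of the projected lattice at the
      cost of at most \<open>a / 4\<close> in squared length.\<close>
    have near: "b1 (pCons (- round (l w)) w) (pCons (- round (l w)) w) \<le> a / 4 + g w w" for w
    proof -
      have "a * (of_int (- round (l w)) + l w) ^ 2 \<le> a * (1/4)"
        using a by (intro mult_left_mono round_error) auto
      thus ?thesis unfolding split by (simp add: power2_eq_square mult.assoc)
    qed
    \<comment> \<open>Positivity at lattice points alone is not enough, since a form with irrational
      coefficients may degenerate over the reals. If \<open>g w w\<close> were not positive, the
      multiples of \<open>w\<close> would have infinitely many lifts of bounded length, against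
      discreteness.\<close>
    have g_pos: "g w w > 0" if w: "w \<in> lat r" "w \<noteq> 0" for w
    proof (rule ccontr)
      assume "\<not> g w w > 0"
      hence g0: "g w w \<le> 0" by simp
      have gk: "g (smult k w) (smult k w) \<le> 0" for k
      proof -
        have ga: "additive_fun (g p)" and gs: "g p p' = g p' p" for p p'
          using g_bil by (auto simp: sym_bilinear_def)
        have "g (smult k w) (smult k w) = of_int k * g (smult k w) w"
          by (rule additive_fun_smult[OF ga])
        also have "g (smult k w) w = of_int k * g w w"
          unfolding gs[of "smult k w" w] by (rule additive_fun_smult[OF ga])
        also have "of_int k * (of_int k * g w w) = of_int k ^ 2 * g w w" by (simp add: power2_eq_square)
        also have "\<dots> \<le> 0" using g0 by (intro mult_nonneg_nonpos) auto
        finally show ?thesis .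
      qed
      define v where "v k = pCons (- round (l (smult k w))) (smult k w)" for k
      have "v k \<in> {p \<in> lat (Suc r). b1 p p \<le> a}" for k
        using near[of "smult k w"] gk[of k] a w lat_smult by (simp add: v_def)
      hence "range v \<subseteq> {p \<in> lat (Suc r). b1 p p \<le> a}" by blast
      hence "finite (range v)" using b1_fin finite_subset by blast
      moreover have "inj v"
      proof (rule injI)
        fix j k assume "v j = v k"
        hence "smult (j - k) w = 0" by (simp add: v_def smult_diff_left)
        thus "j = k" using w(2) by simp
      qed
      ultimately show False using finite_imageD infinite_UNIV_int by blast
    qed
    have g_fin: "finite {w \<in> lat r. g w w \<le> T}" for T
    proof -
      have "{w \<in> lat r. g w w \<le> T} \<subseteq> poly_shift 1 ` {p \<in> lat (Suc r). b1 p p \<le> a / 4 + T}"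
      proof
        fix w assume w: "w \<in> {w \<in> lat r. g w w \<le> T}"
        have "w = poly_shift 1 (pCons (- round (l w)) w)"
          by (rule poly_eqI) (simp add: coeff_poly_shift)
        moreover have "pCons (- round (l w)) w \<in> {p \<in> lat (Suc r). b1 p p \<le> a / 4 + T}"
          using near[of w] w by simp
        ultimately show "w \<in> poly_shift 1 ` {p \<in> lat (Suc r). b1 p p \<le> a / 4 + T}" by blast
      qed
      thus ?thesis using b1_fin finite_subset by blast
    qed
    obtain f' \<beta>' c' where f': "lat_aut r f'" and \<beta>': "\<And>i. i < r \<Longrightarrow> \<beta>' i > 0"
        "\<And>i. Suc i < r \<Longrightarrow> 3 / 4 * \<beta>' i \<le> \<beta>' (Suc i)"
      and eq': "\<And>p q. p \<in> lat r \<Longrightarrow> q \<in> lat r \<Longrightarrow>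
        g (f' p) (f' q) = (\<Sum>i<r. \<beta>' i * tri r c' p i * tri r c' q i)"
      using Suc.IH[OF g_bil g_pos g_fin] by blast
    have f'_add: "additive_fun f'" by (rule lat_aut_additive[OF f'])
    define f where "f p = f0 (lift_aut f' p)" for p
    define \<beta> where "\<beta> = case_nat a \<beta>'"
    define c where "c i j = (case i of 0 \<Rightarrow> l (f' (monom 1 (j - 1))) | Suc i \<Rightarrow> c' i (j - 1))" for i j
    have aut: "lat_aut (Suc r) f"
      unfolding f_def by (rule lat_aut_compose[OF f0(1) lat_aut_lift[OF f']])
    have pos: "\<forall>i<Suc r. \<beta> i > 0" using a \<beta>' by (auto simp: \<beta>_def split: nat.splits)
    have lovasz: "3 / 4 * a \<le> \<beta>' 0" if r0: "r > 0"
    proof -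
      obtain r' where r': "r = Suc r'" using r0 by (cases r) auto
      have one: "(1 :: int poly) \<in> lat r" by (simp add: r')
      have tri1: "tri r c' 1 i = (if i = 0 then 1 else 0)" for i
        by (auto simp: tri_def one_pCons coeff_pCons split: nat.splits intro!: sum.neutral)
      have "g (f' 1) (f' 1) = (\<Sum>i<r. if i = 0 then \<beta>' i else 0)"
        unfolding eq'[OF one one] tri1 by (rule sum.cong) auto
      hence g1: "g (f' 1) (f' 1) = \<beta>' 0" using r0 by simp
      define k where "k = - round (l (f' 1))"
      \<comment> \<open>The first vector of the corresponding basis is a short lift of the first
        reduced vector of the projection. By minimality its squared length is at least
        \<open>a\<close>, of which rounding explains only \<open>a / 4\<close>; hence the factor
        3/4.\<close>
      have "lat_aut (Suc r) (\<lambda>p. lift_aut f' (swap_aut k p))"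
        unfolding r' by (rule lat_aut_compose[OF lat_aut_lift[OF f'[unfolded r']] lat_aut_swap])
      from amin[OF this] have "a \<le> b1 (pCons k (f' 1)) (pCons k (f' 1))"
        using swap_aut_pCons[of k 1 0 0] by (simp add: one_pCons)
      also have "\<dots> \<le> a / 4 + g (f' 1) (f' 1)" unfolding k_def by (rule near)
      finally show ?thesis using g1 by simp
    qed
    have siegel: "\<forall>i. Suc i < Suc r \<longrightarrow> 3 / 4 * \<beta> i \<le> \<beta> (Suc i)"
    proof (intro allI impI)
      fix i assume "Suc i < Suc r"
      thus "3 / 4 * \<beta> i \<le> \<beta> (Suc i)" using lovasz \<beta>'(2) by (cases i) (auto simp: \<beta>_def)
    qed
    have tri0: "tri (Suc r) c (pCons x w) 0 = of_int x + l (f' w)" if "w \<in> lat r" for x w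
    proof -
      have "l (f' w) = (\<Sum>i<r. of_int (coeff w i) * l (f' (monom 1 i)))"
        by (rule additive_fun_expand[OF additive_fun_compose[OF l_add f'_add] that])
      also have "\<dots> = (\<Sum>j\<in>{Suc 0..<Suc r}. c 0 j * of_int (coeff (pCons x w) j))"
        unfolding sum.shift_bounds_Suc_ivl c_def by (simp add: lessThan_atLeast0 mult.commute)
      finally show ?thesis by (simp add: tri_def)
    qed
    have triS: "tri (Suc r) c (pCons x w) (Suc i) = tri r c' w i" for x w i
      unfolding tri_def sum.shift_bounds_Suc_ivl c_def by simp
    have "b (f p) (f q) = (\<Sum>i<Suc r. \<beta> i * tri (Suc r) c p i * tri (Suc r) c q i)"
      if pq: "p \<in> lat (Suc r)" "q \<in> lat (Suc r)" for p q
    proof -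
      obtain x w where p: "p = pCons x w" "w \<in> lat r" by (rule lat_Suc_cases[OF pq(1)])
      obtain y w' where q: "q = pCons y w'" "w' \<in> lat r" by (rule lat_Suc_cases[OF pq(2)])
      have "b (f p) (f q) = b1 (pCons x (f' w)) (pCons y (f' w'))"
        by (simp add: f_def b1_def p q)
      also have "\<dots> = (\<Sum>i<Suc r. \<beta> i * tri (Suc r) c p i * tri (Suc r) c q i)"
        unfolding split eq'[OF p(2) q(2)] sum.lessThan_Suc_shift unfolding p(1) q(1) triS
          tri0[OF p(2)] tri0[OF q(2)] by (simp add: \<beta>_def)
      finally show ?thesis .
    qed
    thus ?case using aut pos siegel by blast
  qed
  thus thesis using that by blast
qed

section \<open>Volume comparison between boxes and balls\<close>

lemma box_emeasure:
  fixes u v :: "nat \<Rightarrow> real"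
  assumes "\<And>i. i < r \<Longrightarrow> u i \<le> v i"
  shows "emeasure (Pi\<^sub>M {..<r} (\<lambda>_. lborel)) (Pi\<^sub>E {..<r} (\<lambda>i. {u i..v i})) = ennreal (\<Prod>i<r. v i - u i)"
proof -
  interpret product_sigma_finite "\<lambda>_::nat. lborel :: real measure" by standard
  have "emeasure (Pi\<^sub>M {..<r} (\<lambda>_. lborel)) (Pi\<^sub>E {..<r} (\<lambda>i. {u i..v i}))
      = (\<Prod>i<r. emeasure lborel {u i..v i})"
    by (rule emeasure_PiM) auto
  also have "\<dots> = (\<Prod>i<r. ennreal (v i - u i))"
    using assms by (intro prod.cong) auto
  also have "\<dots> = ennreal (\<Prod>i<r. v i - u i)"
    using assms by (intro prod_ennreal) auto
  finally show ?thesis .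
qed

lemma sqrt_prod: "sqrt (\<Prod>i\<in>A. f i) = (\<Prod>i\<in>A. sqrt (f i))"
  by (induction A rule: infinite_finite_induct) (auto simp: real_sqrt_mult)

text \<open>The ball lies in a cube of side 2. This supplies an explicit bound for
  \<open>Omega\<close>.\<close>

lemma unit_ball_vol_le: "unit_ball_vol (real r) \<le> 2 ^ r"
proof -
  let ?M = "Pi\<^sub>M {..<r} (\<lambda>_::nat. lborel :: real measure)"
  let ?B = "{f. sqrt (\<Sum>i\<in>{..<r}. (f i)\<^sup>2) \<le> 1} \<inter> space ?M"
  have sub: "?B \<subseteq> Pi\<^sub>E {..<r} (\<lambda>i. {- 1..1})"
  proof
    fix f assume f: "f \<in> ?B"
    have "f i \<in> {- 1..1}" if i: "i < r" for i
    proof -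
      have "(f i)\<^sup>2 \<le> (\<Sum>i<r. (f i)\<^sup>2)" using i by (intro member_le_sum) auto
      also have "\<dots> \<le> 1" using f by simp
      finally show ?thesis by (auto simp: abs_square_le_1 abs_le_iff)
    qed
    thus "f \<in> Pi\<^sub>E {..<r} (\<lambda>i. {- 1..1})" using f by (auto simp: space_PiM PiE_def Pi_def)
  qed
  have "emeasure ?M ?B \<le> emeasure ?M (Pi\<^sub>E {..<r} (\<lambda>i. {- 1..1}))"
    by (rule emeasure_mono[OF sub]) (auto intro!: sets_PiM_I_finite)
  hence "ennreal (unit_ball_vol (real r)) \<le> ennreal (2 ^ r)"
    using emeasure_cball_aux[of "{..<r}" 1] by (subst (asm) box_emeasure) auto
  thus ?thesis by simp
qed

text \<open>Rounding the coordinates from the last one to the first is Babai's nearest plane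
  algorithm.\<close>

lemma nearest_plane:
  fixes \<beta> y :: "nat \<Rightarrow> real"
  assumes \<beta>: "\<And>i. i < r \<Longrightarrow> \<beta> i > 0"
  obtains p where "p \<in> lat r" "\<And>i. i < r \<Longrightarrow> \<bar>y i - sqrt (\<beta> i) * tri r c p i\<bar> \<le> sqrt (\<beta> i) / 2"
proof -
  have "\<exists>p\<in>lat r. \<forall>i. r - k \<le> i \<and> i < r \<longrightarrow> \<bar>y i - sqrt (\<beta> i) * tri r c p i\<bar> \<le> sqrt (\<beta> i) / 2"
    if "k \<le> r" for k
    using that
  proof (induction k)
    case 0
    show ?case by (rule bexI[of _ 0]) (auto simp: lat_def)
  next
    case (Suc k)
    then obtain p where p: "p \<in> lat r"
      "\<And>i. r - k \<le> i \<Longrightarrow> i < r \<Longrightarrow> \<bar>y i - sqrt (\<beta> i) * tri r c p i\<bar> \<le> sqrt (\<beta> i) / 2" by auto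
    define m where "m = r - Suc k"
    have m: "m < r" "r - k = Suc m" using Suc.prems by (auto simp: m_def)
    define z where "z = round (y m / sqrt (\<beta> m) - tri r c p m)"
    define p' where "p' = p + monom z m"
    have "p' \<in> lat r" using p(1) m(1) by (auto simp: p'_def lat_def)
    moreover have "\<bar>y i - sqrt (\<beta> i) * tri r c p' i\<bar> \<le> sqrt (\<beta> i) / 2" if "m \<le> i" "i < r" for i
    proof (cases "i = m")
      case True
      have "tri r c p' m = of_int z + tri r c p m"
        by (simp add: tri_def p'_def)
      hence "y m - sqrt (\<beta> m) * tri r c p' m
          = sqrt (\<beta> m) * ((y m / sqrt (\<beta> m) - tri r c p m) - of_int z)"
        using \<beta>[OF m(1)] by (simp add: field_simps)
      moreover have "\<bar>(y m / sqrt (\<beta> m) - tri r c p m) - of_int z\<bar> \<le> 1/2"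
        unfolding z_def by (subst abs_minus_commute) (rule of_int_round_abs_le)
      ultimately show ?thesis using \<beta>[OF m(1)] True
        mult_left_mono[of "\<bar>(y m / sqrt (\<beta> m) - tri r c p m) - of_int z\<bar>" "1/2" "sqrt (\<beta> m)"]
        by (simp add: abs_mult)
    next
      case False
      hence "tri r c p' i = tri r c p i" using that by (simp add: tri_def p'_def)
      thus ?thesis using p(2)[of i] False that m(2) by simp
    qed
    ultimately show ?case unfolding m_def by auto
  qed
  from this[of r] show thesis using that by auto
qed

text \<open>By \<open>nearest_plane\<close>, every point of the ball of radius
  \<open>\<rho> - d\<close> lies in a box with sides \<open>sqrt (\<beta> i)\<close> centred at a
  lattice point, which is at distance at most \<open>d\<close>, half the diagonal of the box. That
  lattice point belongs to the ball of radius \<open>\<rho>\<close>, and the volume of each box is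
  the covolume of the lattice.\<close>

theorem lattice_point_count:
  fixes \<beta> :: "nat \<Rightarrow> real" and c :: "nat \<Rightarrow> nat \<Rightarrow> real" and r :: nat
  defines "Q \<equiv> \<lambda>p. \<Sum>i<r. \<beta> i * (tri r c p i)\<^sup>2" and "d \<equiv> sqrt (\<Sum>i<r. \<beta> i) / 2"
  assumes \<beta>: "\<And>i. i < r \<Longrightarrow> \<beta> i > 0" and fin: "finite {p \<in> lat r. Q p \<le> \<rho>\<^sup>2}" and \<rho>: "d < \<rho>"
  shows "unit_ball_vol (real r) * (\<rho> - d) ^ r \<le> real (card {p \<in> lat r. Q p \<le> \<rho>\<^sup>2}) * sqrt (\<Prod>i<r. \<beta> i)"
proof -
  let ?M = "Pi\<^sub>M {..<r} (\<lambda>_::nat. lborel :: real measure)"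
  let ?B = "{f. sqrt (\<Sum>i\<in>{..<r}. (f i)\<^sup>2) \<le> \<rho> - d} \<inter> space ?M"
  define S where "S = {p \<in> lat r. Q p \<le> \<rho>\<^sup>2}"
  define Y where "Y p i = sqrt (\<beta> i) * tri r c p i" for p i
  define box where "box p = Pi\<^sub>E {..<r} (\<lambda>i. {Y p i - sqrt (\<beta> i) / 2..Y p i + sqrt (\<beta> i) / 2})" for p
  have d0: "d \<ge> 0" unfolding d_def using sum_nonneg[of "{..<r}" \<beta>] \<beta> by (simp add: less_imp_le)
  have QY: "Q p = (\<Sum>i<r. (Y p i)\<^sup>2)" for p
    unfolding Q_def Y_def using \<beta> by (intro sum.cong) (auto simp: power_mult_distrib less_imp_le)
  have sub: "?B \<subseteq> (\<Union>p\<in>S. box p)"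
  proof
    fix y assume y: "y \<in> ?B"
    obtain p where p: "p \<in> lat r" "\<And>i. i < r \<Longrightarrow> \<bar>y i - Y p i\<bar> \<le> sqrt (\<beta> i) / 2"
      using nearest_plane[where r = r and \<beta> = \<beta> and c = c and y = y] \<beta> unfolding Y_def by blast
    have "L2_set (Y p) {..<r} = L2_set (\<lambda>i. y i + (Y p i - y i)) {..<r}" by simp
    also have "\<dots> \<le> L2_set y {..<r} + L2_set (\<lambda>i. Y p i - y i) {..<r}" by (rule L2_set_triangle_ineq)
    also have "L2_set y {..<r} \<le> \<rho> - d" using y by (simp add: L2_set_def)
    also have "L2_set (\<lambda>i. Y p i - y i) {..<r} \<le> d"
    proof -
      have "(Y p i - y i)\<^sup>2 \<le> \<beta> i / 4" if "i < r" for i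
      proof -
        have "\<bar>y i - Y p i\<bar>\<^sup>2 \<le> (sqrt (\<beta> i) / 2)\<^sup>2" using p(2)[OF that] by (intro power_mono) auto
        thus ?thesis using \<beta>[OF that] by (simp add: power_divide power2_commute)
      qed
      hence "(\<Sum>i<r. (Y p i - y i)\<^sup>2) \<le> (\<Sum>i<r. \<beta> i / 4)" by (intro sum_mono) auto
      also have "\<dots> = (\<Sum>i<r. \<beta> i) / 4" by (simp add: sum_divide_distrib)
      finally have "L2_set (\<lambda>i. Y p i - y i) {..<r} \<le> sqrt ((\<Sum>i<r. \<beta> i) / 4)"
        unfolding L2_set_def by (rule real_sqrt_le_mono)
      thus ?thesis by (simp add: d_def real_sqrt_divide)
    qed
    finally have "sqrt (Q p) \<le> \<rho>" by (simp add: L2_set_def QY)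
    hence "Q p \<le> \<rho>\<^sup>2" by (rule sqrt_le_D)
    hence "p \<in> S" using p(1) by (simp add: S_def)
    moreover have "y i \<in> {Y p i - sqrt (\<beta> i) / 2..Y p i + sqrt (\<beta> i) / 2}" if "i < r" for i
      using p(2)[OF that] unfolding atLeastAtMost_iff abs_le_iff by linarith
    hence "y \<in> box p" using y by (auto simp: box_def space_PiM PiE_def Pi_def)
    ultimately show "y \<in> (\<Union>p\<in>S. box p)" by blast
  qed
  have box_sets: "box p \<in> sets ?M" for p
    unfolding box_def by (rule sets_PiM_I_finite) auto
  have box_em: "emeasure ?M (box p) = ennreal (sqrt (\<Prod>i<r. \<beta> i))" for p
    unfolding box_def using \<beta> by (subst box_emeasure) (auto simp: sqrt_prod less_imp_le)
  have pn: "(\<Prod>i<r. \<beta> i) \<ge> 0" using \<beta> by (intro prod_nonneg) (auto simp: less_imp_le)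
  have finS: "finite S" using fin by (simp add: S_def)
  have "ennreal (unit_ball_vol (real r) * (\<rho> - d) ^ r) = emeasure ?M ?B"
    using emeasure_cball_aux[of "{..<r}" "\<rho> - d"] \<rho> by simp
  also have "\<dots> \<le> emeasure ?M (\<Union>p\<in>S. box p)"
    using box_sets finS by (intro emeasure_mono[OF sub] sets.finite_UN) auto
  also have "\<dots> \<le> (\<Sum>p\<in>S. emeasure ?M (box p))"
    using box_sets finS by (intro emeasure_subadditive_finite) auto
  also have "\<dots> = ennreal (real (card S) * sqrt (\<Prod>i<r. \<beta> i))"
    unfolding box_em using pn by (simp add: ennreal_mult ennreal_of_nat_eq_real_of_nat)
  finally show ?thesis
    unfolding S_def[symmetric] using pn by (subst (asm) ennreal_le_iff) auto
qed

text \<open>\<open>f\<close> is given by an integral matrix with integral inverse, so its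
  determinant is 1 or -1 and its square does not affect the Gram determinant. In the new basis the
  Gram matrix is \<open>transpose_mat C * D\<close> with \<open>C\<close> unit upper triangular and
  \<open>D\<close> upper triangular with diagonal \<open>\<beta>\<close>. This links the covolume of
  the lattice point count to the regulator.\<close>

lemma gram_determinant:
  assumes b: "sym_bilinear b" and aut: "lat_aut r f"
    and eq: "\<And>p q. p \<in> lat r \<Longrightarrow> q \<in> lat r \<Longrightarrow> b (f p) (f q) = (\<Sum>i<r. \<beta> i * tri r c p i * tri r c q i)"
  shows "Determinant.det (mat r r (\<lambda>(i, j). b (monom 1 i) (monom 1 j))) = (\<Prod>i<r. \<beta> i)"
proof -
  have b_sym: "b x y = b y x" and b_add: "additive_fun (b x)" for x y
    using b by (auto simp: sym_bilinear_def)
  obtain g where "lat_iso r f g" using aut by (auto simp: lat_aut_def)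
  note g = lat_isoD[OF this]
  define e where "e i = (monom 1 i :: int poly)" for i
  have e: "e i \<in> lat r" if "i < r" for i using that by (simp add: e_def)
  have fe: "f (e i) \<in> lat r" "g (e i) \<in> lat r" if "i < r" for i using e[OF that] g by auto
  define Ui Vi where "Ui = mat r r (\<lambda>(i, j). coeff (f (e j)) i)"
    and "Vi = mat r r (\<lambda>(i, j). coeff (g (e j)) i)"
  define U where "U = map_mat real_of_int Ui"
  define G where "G = mat r r (\<lambda>(i, j). b (e i) (e j))"
  define C where "C = mat r r (\<lambda>(k, i). tri r c (e i) k)"
  define D where "D = mat r r (\<lambda>(k, i). \<beta> k * tri r c (e i) k)"
  have carr: "Ui \<in> carrier_mat r r" "Vi \<in> carrier_mat r r" "U \<in> carrier_mat r r" "G \<in> carrier_mat r r"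
    "C \<in> carrier_mat r r" "D \<in> carrier_mat r r"
    by (auto simp: Ui_def Vi_def U_def G_def C_def D_def)
  have smult_hom: "additive_fun h \<Longrightarrow> h (smult k p) = smult k (h p)"
    for h :: "int poly \<Rightarrow> int poly" and k p
  proof (rule poly_eqI)
    fix n assume h: "additive_fun h"
    have "additive_fun (\<lambda>p. real_of_int (coeff (h p) n))"
      using additive_funD[OF h] by (simp add: additive_fun_def)
    from additive_fun_smult[OF this, of k p]
    have "real_of_int (coeff (h (smult k p)) n) = real_of_int (k * coeff (h p) n)" by simp
    thus "coeff (h (smult k p)) n = coeff (smult k (h p)) n" by (simp only: of_int_eq_iff coeff_smult)
  qed
  have "Ui * Vi = 1\<^sub>m r"
  proof (rule eq_matI)
    fix i j assume ij: "i < dim_row (1\<^sub>m r)" "j < dim_col (1\<^sub>m r)"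
    have "f (g (e j)) = f (\<Sum>k<r. smult (coeff (g (e j)) k) (e k))"
      using lat_decompose[OF fe(2), of j] ij by (simp add: e_def)
    also have "\<dots> = (\<Sum>k<r. smult (coeff (g (e j)) k) (f (e k)))"
      by (simp add: additive_fun_sum[OF g(1)] smult_hom[OF g(1)])
    finally have fg: "f (g (e j)) = (\<Sum>k<r. smult (coeff (g (e j)) k) (f (e k)))" .
    have "f (g (e j)) = e j" using g(5)[OF e] ij by simp
    from arg_cong[OF fg[unfolded this], of "\<lambda>p. coeff p i"]
    have "coeff (e j) i = (\<Sum>k<r. coeff (g (e j)) k * coeff (f (e k)) i)"
      by (simp add: coeff_sum)
    moreover have "(Ui * Vi) $$ (i, j) = (\<Sum>k<r. coeff (f (e k)) i * coeff (g (e j)) k)"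
      using ij by (simp add: Ui_def Vi_def scalar_prod_def lessThan_atLeast0)
    ultimately show "(Ui * Vi) $$ (i, j) = 1\<^sub>m r $$ (i, j)"
      using ij by (auto simp: e_def mult.commute split: if_splits)
  qed (auto simp: Ui_def Vi_def)
  hence "Determinant.det Ui * Determinant.det Vi = 1"
    using det_mult[OF carr(1,2)] by simp
  hence "(Determinant.det Ui)\<^sup>2 = 1" by (auto simp: zmult_eq_1_iff)
  hence "real_of_int ((Determinant.det Ui)\<^sup>2) = 1" by simp
  hence detU: "Determinant.det U * Determinant.det U = 1"
    unfolding U_def of_int_hom.hom_det by (simp add: power2_eq_square)
  have expand: "b (f (e i)) q = (\<Sum>k<r. real_of_int (coeff (f (e i)) k) * b (e k) q)" if "i < r" for i q
    using additive_fun_expand[OF b_add fe(1)[OF that], of q] by (simp add: b_sym[of _ q] e_def)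
  have "transpose_mat U * (G * U) = transpose_mat C * D"
  proof (rule eq_matI)
    fix i j assume "i < dim_row (transpose_mat C * D)" "j < dim_col (transpose_mat C * D)"
    hence ij: "i < r" "j < r" using carr by auto
    have GU: "(G * U) $$ (k, j) = b (e k) (f (e j))" if "k < r" for k
    proof -
      have "(G * U) $$ (k, j) = (\<Sum>l<r. b (e k) (e l) * real_of_int (coeff (f (e j)) l))"
        using that ij by (simp add: G_def U_def Ui_def scalar_prod_def lessThan_atLeast0)
      also have "\<dots> = b (e k) (f (e j))"
        unfolding b_sym[of "e k" "f (e j)"] expand[OF ij(2)]
        by (rule sum.cong) (auto simp: b_sym[of "e k"] mult.commute)
      finally show ?thesis .
    qed
    have "(transpose_mat U * (G * U)) $$ (i, j) = (\<Sum>k<r. U $$ (k, i) * (G * U) $$ (k, j))"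
      using ij carr by (simp add: scalar_prod_def lessThan_atLeast0)
    also have "\<dots> = (\<Sum>k<r. real_of_int (coeff (f (e i)) k) * b (e k) (f (e j)))"
      by (rule sum.cong) (use ij GU in \<open>auto simp: U_def Ui_def\<close>)
    also have "\<dots> = b (f (e i)) (f (e j))" by (rule expand[OF ij(1), symmetric])
    also have "\<dots> = (\<Sum>k<r. \<beta> k * tri r c (e i) k * tri r c (e j) k)"
      by (rule eq[OF e[OF ij(1)] e[OF ij(2)]])
    also have "\<dots> = (transpose_mat C * D) $$ (i, j)"
      using ij by (simp add: C_def D_def scalar_prod_def lessThan_atLeast0 mult_ac)
    finally show "(transpose_mat U * (G * U)) $$ (i, j) = (transpose_mat C * D) $$ (i, j)" .
  qed (use carr in auto)
  moreover have "Determinant.det (transpose_mat U * (G * U)) = Determinant.det G * (Determinant.det U * Determinant.det U)"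
    using carr by (subst det_mult[of _ r]; (subst det_mult[of _ r])?) (auto simp: det_transpose)
  moreover have "Determinant.det (transpose_mat C * D) = Determinant.det C * Determinant.det D"
    using carr by (subst det_mult[of _ r]) (auto simp: det_transpose)
  ultimately have "Determinant.det G = Determinant.det C * Determinant.det D"
    using detU by simp
  moreover have tri_e: "tri r c (e i) k = (if k = i then 1 else 0)" if "i \<le> k" for i k
    unfolding tri_def e_def using that by (auto intro!: sum.neutral)
  have "Determinant.det C = 1"
    by (subst det_upper_triangular[OF _ carr(5)])
      (auto simp: upper_triangular_def C_def tri_e prod_list_diag_prod)
  moreover have "Determinant.det D = (\<Prod>i<r. \<beta> i)"
    by (subst det_upper_triangular[OF _ carr(6)])
      (auto simp: upper_triangular_def D_def tri_e prod_list_diag_prod lessThan_atLeast0)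
  ultimately show ?thesis unfolding G_def e_def by simp
qed

section \<open>Class numbers from points of small height\<close>

text \<open>A common prime factor p of the coefficients gives \<open>p ^ 2 dvd D\<close>. For odd p
  this contradicts squarefreeness of \<open>D div 4\<close>; for p = 2, \<open>D div 4\<close> would
  itself be a discriminant, hence 0 or 1 modulo 4. So the forms built from points are automatically
  primitive.\<close>

lemma fundamental_primitive:
  assumes D: "fundamental_discriminant D" "4 dvd D" and f: "bqf_disc (a, b, c) = D"
  shows "bqf_primitive (a, b, c)"
proof (rule ccontr)
  assume "\<not> ?thesis"
  hence g: "gcd a (gcd b c) \<noteq> 1" by simp
  have D4: "(D div 4) mod 4 \<in> {2, 3}" "squarefree (D div 4)"
    using D by (auto simp: fundamental_discriminant_def)
  hence "D \<noteq> 0" by auto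
  hence "gcd a (gcd b c) \<noteq> 0" using f by auto
  moreover have "\<not> is_unit (gcd a (gcd b c))" using g by simp
  ultimately obtain p where p: "prime p" "p dvd gcd a (gcd b c)"
    using prime_divisor_exists by blast
  hence "p dvd a" "p dvd b" "p dvd c" by auto
  then obtain a' b' c' where abc: "a = p * a'" "b = p * b'" "c = p * c'"
    by (metis dvdE)
  have Dp: "D = p ^ 2 * (b' ^ 2 - 4 * a' * c')"
    using f unfolding abc by (simp add: algebra_simps power2_eq_square)
  obtain n where n: "D = 4 * n" using D(2) by auto
  show False
  proof (cases "p = 2")
    case True
    hence "n = b' ^ 2 - 4 * a' * c'" using n Dp by simp
    moreover have "b' ^ 2 mod 4 = 0 \<or> b' ^ 2 mod 4 = 1"
    proof (cases "even b'")
      case True thus ?thesis by (auto elim!: evenE simp: power2_eq_square)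
    next
      case False
      then obtain k where "b' = 2 * k + 1" by (auto elim: oddE)
      hence "b' ^ 2 = 1 + 4 * (k * k + k)" by (simp add: power2_eq_square algebra_simps)
      thus ?thesis using mod_mult_self2[of 1 4 "k * k + k"] by simp
    qed
    moreover have "(b' ^ 2 - 4 * (a' * c')) mod 4 = b' ^ 2 mod 4"
    proof -
      have "(u - 4 * v) mod 4 = u mod 4" for u v :: int by presburger
      thus ?thesis .
    qed
    ultimately have "n mod 4 = 0 \<or> n mod 4 = 1" by (simp add: mult.assoc)
    thus False using D4(1) n by auto
  next
    case False
    have "coprime (p ^ 2) 4"
    proof -
      have "coprime p 2" by (rule primes_coprime[OF p(1) _ False]) simp
      hence "coprime (p ^ 2) (2 ^ 2)" by (simp only: coprime_power_left_iff coprime_power_right_iff) simp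
      moreover have "(2::int) ^ 2 = 4" by simp
      ultimately show ?thesis by (simp only:)
    qed
    moreover have "p ^ 2 dvd 4 * n" using Dp n by (metis dvd_triv_left)
    ultimately have "p ^ 2 dvd n" using coprime_dvd_mult_right_iff by blast
    hence "is_unit p" using D4(2) n by (auto simp: squarefree_def)
    thus False using p(1) by auto
  qed
qed

section \<open>Definite forms of a fixed discriminant and their classes\<close>

lemma bqf_complete_square:
  "4 * a * bqf_eval (a, b, c) x y = (2 * a * x + b * y) ^ 2 - bqf_disc (a, b, c) * y ^ 2"
  by (simp add: power2_eq_square algebra_simps)

lemma bqf_pos_def_iff:
  assumes "bqf_disc (a, b, c) < 0"
  shows "bqf_pos_def (a, b, c) \<longleftrightarrow> a > 0"
proof
  assume "bqf_pos_def (a, b, c)"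
  from this[unfolded bqf_pos_def_def, rule_format, of 1 0] show "a > 0" by simp
next
  assume a: "a > 0"
  show "bqf_pos_def (a, b, c)" unfolding bqf_pos_def_def
  proof (intro allI impI)
    fix x y :: int assume xy: "(x, y) \<noteq> (0, 0)"
    have "(2 * a * x + b * y) ^ 2 - bqf_disc (a, b, c) * y ^ 2 > 0"
    proof (cases "y = 0")
      case True thus ?thesis using xy a by simp
    next
      case False
      hence "bqf_disc (a, b, c) * y ^ 2 < 0" using assms by (intro mult_neg_pos) auto
      thus ?thesis using zero_le_power2[of "2 * a * x + b * y"] by linarith
    qed
    thus "bqf_eval (a, b, c) x y > 0"
      unfolding bqf_complete_square[symmetric] using a by (simp add: zero_less_mult_iff)
  qed
qed

context
  fixes D :: int
  assumes fund: "fundamental_discriminant D" "4 dvd D" and neg: "D < 0"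
begin

lemma bqf_forms_iff: "(a, b, c) \<in> bqf_forms D \<longleftrightarrow> a > 0 \<and> b ^ 2 - 4 * a * c = D"
  using bqf_pos_def_iff[of a b c] fundamental_primitive[OF fund, of a b c] neg
  by (auto simp: bqf_forms_def)

lemma bqf_equivI:
  assumes "f \<in> bqf_forms D" "g \<in> bqf_forms D" "p * s - q * r = 1"
    and "\<And>x y. bqf_eval g x y = bqf_eval f (p * x + q * y) (r * x + s * y)"
  shows "(f, g) \<in> bqf_equiv D"
proof -
  have "\<exists>p q r s. p * s - q * r = 1 \<and>
      (\<forall>x y. bqf_eval g x y = bqf_eval f (p * x + q * y) (r * x + s * y))"
    using assms(3,4) by blast
  thus ?thesis unfolding bqf_equiv_def using assms(1,2) by simp
qed

lemma equiv_bqf_equiv: "equiv (bqf_forms D) (bqf_equiv D)"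
proof (rule equivI)
  show "bqf_equiv D \<subseteq> bqf_forms D \<times> bqf_forms D" by (auto simp: bqf_equiv_def)
  show "refl_on (bqf_forms D) (bqf_equiv D)"
    by (rule refl_onI) (rule bqf_equivI[of _ _ 1 1 0 0]; simp)
  show "sym (bqf_equiv D)"
  proof (rule symI)
    fix f g assume "(f, g) \<in> bqf_equiv D"
    then obtain p q r s where fg: "f \<in> bqf_forms D" "g \<in> bqf_forms D" and det: "p * s - q * r = 1"
      and e: "\<And>x y. bqf_eval g x y = bqf_eval f (p * x + q * y) (r * x + s * y)"
      unfolding bqf_equiv_def by blast
    show "(g, f) \<in> bqf_equiv D"
    proof (rule bqf_equivI[OF fg(2,1), of s p "- q" "- r"])
      show "s * p - - q * - r = 1" using det by (simp add: mult.commute)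
      fix x y
      have "p * (s * x + - q * y) + q * (- r * x + p * y) = (p * s - q * r) * x"
        "r * (s * x + - q * y) + s * (- r * x + p * y) = (p * s - q * r) * y"
        by (simp_all add: algebra_simps)
      thus "bqf_eval f x y = bqf_eval g (s * x + - q * y) (- r * x + p * y)"
        unfolding e det by simp
    qed
  qed
  show "trans (bqf_equiv D)"
  proof (rule transI)
    fix f g h assume "(f, g) \<in> bqf_equiv D" "(g, h) \<in> bqf_equiv D"
    then obtain p q r s p' q' r' s' where fgh: "f \<in> bqf_forms D" "h \<in> bqf_forms D"
      and det: "p * s - q * r = 1" "p' * s' - q' * r' = 1"
      and e: "\<And>x y. bqf_eval g x y = bqf_eval f (p * x + q * y) (r * x + s * y)"
        "\<And>x y. bqf_eval h x y = bqf_eval g (p' * x + q' * y) (r' * x + s' * y)"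
      unfolding bqf_equiv_def by blast
    show "(f, h) \<in> bqf_equiv D"
    proof (rule bqf_equivI[OF fgh, of "p * p' + q * r'" "r * q' + s * s'" "p * q' + q * s'" "r * p' + s * r'"])
      have "(p * p' + q * r') * (r * q' + s * s') - (p * q' + q * s') * (r * p' + s * r')
          = (p * s - q * r) * (p' * s' - q' * r')" by (simp add: algebra_simps)
      thus "(p * p' + q * r') * (r * q' + s * s') - (p * q' + q * s') * (r * p' + s * r') = 1"
        using det by simp
      fix x y
      have "p * (p' * x + q' * y) + q * (r' * x + s' * y) = (p * p' + q * r') * x + (p * q' + q * s') * y"
        "r * (p' * x + q' * y) + s * (r' * x + s' * y) = (r * p' + s * r') * x + (r * q' + s * s') * y"
        by (simp_all add: algebra_simps)
      thus "bqf_eval h x y = bqf_eval f ((p * p' + q * r') * x + (p * q' + q * s') * y)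
          ((r * p' + s * r') * x + (r * q' + s * s') * y)"
        unfolding e by simp
    qed
  qed
qed

text \<open>Gauss reduction by extremality: an equivalent form with least leading coefficient is
  translated until \<open>\<bar>b\<bar> \<le> a\<close>, and exchanging the variables shows that
  \<open>c\<close> is not smaller than \<open>a\<close>.\<close>

lemma reduction:
  assumes f: "f \<in> bqf_forms D"
  obtains a b c where "(f, (a, b, c)) \<in> bqf_equiv D" "\<bar>b\<bar> \<le> a" "a \<le> c"
proof -
  have "(f, f) \<in> bqf_equiv D" using equiv_bqf_equiv f by (meson equivE refl_onD)
  then obtain g where g: "(f, g) \<in> bqf_equiv D"
    and least: "\<And>g'. (f, g') \<in> bqf_equiv D \<Longrightarrow> nat (fst g) \<le> nat (fst g')"
    using ex_has_least_nat[of "\<lambda>g. (f, g) \<in> bqf_equiv D" f "\<lambda>g. nat (fst g)"] by blast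
  obtain a b c where abc: "g = (a, b, c)" by (cases g)
  have gf: "g \<in> bqf_forms D" using g by (auto simp: bqf_equiv_def)
  hence a: "a > 0" and disc: "b ^ 2 - 4 * a * c = D" unfolding abc bqf_forms_iff by auto
  define k where "k = - ((b + a) div (2 * a))"
  define b1 c1 where "b1 = b + 2 * a * k" and "c1 = a * k ^ 2 + b * k + c"
  have "b + a = 2 * a * ((b + a) div (2 * a)) + (b + a) mod (2 * a)" by simp
  hence "b1 = (b + a) mod (2 * a) - a" unfolding b1_def k_def by (simp add: algebra_simps)
  hence b1: "\<bar>b1\<bar> \<le> a"
    using a pos_mod_sign[of "2 * a" "b + a"] pos_mod_bound[of "2 * a" "b + a"] by linarith
  have disc1: "b1 ^ 2 - 4 * a * c1 = D"
    unfolding disc[symmetric] b1_def c1_def by (simp add: power2_eq_square algebra_simps)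
  have g1: "(a, b1, c1) \<in> bqf_forms D" using a disc1 bqf_forms_iff by simp
  have gg1: "(g, (a, b1, c1)) \<in> bqf_equiv D"
    by (rule bqf_equivI[OF gf g1, of 1 1 k 0])
      (simp_all add: abc b1_def c1_def power2_eq_square algebra_simps)
  have fg1: "(f, (a, b1, c1)) \<in> bqf_equiv D"
    using equiv_bqf_equiv g gg1 by (meson equivE transD)
  have "c1 > 0"
  proof (rule ccontr)
    assume "\<not> c1 > 0"
    hence "4 * a * c1 \<le> 0" using a by (simp add: mult_nonneg_nonpos)
    thus False using disc1 neg zero_le_power2[of b1] by linarith
  qed
  hence g2: "(c1, - b1, a) \<in> bqf_forms D" using disc1 bqf_forms_iff by (simp add: mult_ac)
  have "((a, b1, c1), (c1, - b1, a)) \<in> bqf_equiv D"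
    by (rule bqf_equivI[OF g1 g2, of 0 0 "- 1" 1]) (simp_all add: power2_eq_square algebra_simps)
  hence "(f, (c1, - b1, a)) \<in> bqf_equiv D"
    using equiv_bqf_equiv fg1 by (meson equivE transD)
  hence "a \<le> c1" using least[of "(c1, - b1, a)"] abc a \<open>c1 > 0\<close> by simp
  thus thesis using that fg1 b1 by blast
qed

text \<open>\<open>card\<close> is 0 on infinite sets, so a lower bound for
  \<open>class_number\<close> needs finiteness. Reduced forms satisfy \<open>3 a^2 \<le> - D\<close>
  and therefore lie in a box.\<close>

lemma finite_classes: "finite (bqf_forms D // bqf_equiv D)"
proof -
  define R where "R = {(a, b, c). (a, b, c) \<in> bqf_forms D \<and> \<bar>b\<bar> \<le> a \<and> a \<le> c}"
  have "R \<subseteq> {0..- D} \<times> {D..- D} \<times> {0..D ^ 2 - D}"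
  proof
    fix f assume "f \<in> R"
    then obtain a b c where f: "f = (a, b, c)" "a > 0" "b ^ 2 - 4 * a * c = D" "\<bar>b\<bar> \<le> a" "a \<le> c"
      by (auto simp: R_def bqf_forms_iff)
    have b2: "b ^ 2 \<le> a * a" using f(4) power_mono[of "\<bar>b\<bar>" a 2] by (simp add: power2_eq_square)
    have ac: "a * a \<le> a * c" using f by simp
    have "a \<le> a * a" using f(2) by (simp add: mult_le_cancel_left1)
    hence a: "a \<le> - D" using f(2,3) b2 ac unfolding mult.assoc by linarith
    have "1 * c \<le> a * c" using f by (intro mult_right_mono) auto
    moreover have "b ^ 2 \<le> D ^ 2"
      using f(4) a power_mono[of "\<bar>b\<bar>" "- D" 2] by simp
    moreover have "0 \<le> a * c" using f by simp
    ultimately have "c \<le> D ^ 2 - D" using f(3) unfolding mult.assoc by linarith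
    thus "f \<in> {0..- D} \<times> {D..- D} \<times> {0..D ^ 2 - D}" using a f by auto
  qed
  hence "finite R" by (rule finite_subset) auto
  moreover have "bqf_forms D // bqf_equiv D \<subseteq> (\<lambda>g. bqf_equiv D `` {g}) ` R"
  proof
    fix X assume "X \<in> bqf_forms D // bqf_equiv D"
    then obtain f where f: "f \<in> bqf_forms D" "X = bqf_equiv D `` {f}" by (auto elim: quotientE)
    obtain a b c where g: "(f, (a, b, c)) \<in> bqf_equiv D" "\<bar>b\<bar> \<le> a" "a \<le> c"
      using reduction[OF f(1)] .
    hence "(a, b, c) \<in> R" by (auto simp: R_def bqf_equiv_def)
    moreover have "X = bqf_equiv D `` {(a, b, c)}"
      using f(2) g(1) equiv_bqf_equiv by (simp add: equiv_class_eq)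
    ultimately show "X \<in> (\<lambda>g. bqf_equiv D `` {g}) ` R" by blast
  qed
  ultimately show ?thesis using finite_subset by blast
qed

text \<open>A value of a form at a vector with non-zero second coordinate is at least \<open>- D / 4a\<close>.\<close>

lemma equiv_small_leading_coefficients:
  assumes "((a, b, c), (a', b', c')) \<in> bqf_equiv D" and "4 * a * a' < - D"
  shows "a = a'"
proof -
  obtain p q r s where f: "(a, b, c) \<in> bqf_forms D" and det: "p * s - q * r = 1"
    and e: "\<And>x y. bqf_eval (a', b', c') x y = bqf_eval (a, b, c) (p * x + q * y) (r * x + s * y)"
    using assms(1) unfolding bqf_equiv_def by blast
  have disc: "bqf_disc (a, b, c) = D" using f by (simp add: bqf_forms_def)
  have a': "a' = bqf_eval (a, b, c) p r" using e[of 1 0] by simp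
  have "4 * a * a' = (2 * a * p + b * r) ^ 2 - D * r ^ 2"
    unfolding a' bqf_complete_square disc ..
  hence "- (D * r ^ 2) < - D" using assms(2) zero_le_power2[of "2 * a * p + b * r"] by linarith
  hence "- D * r ^ 2 < - D * 1" by simp
  hence "r ^ 2 < 1" using neg by (subst (asm) mult_less_cancel_left_pos) auto
  hence "\<not> r ^ 2 > 0" by linarith
  hence r: "r = 0" by simp
  hence "p * s = 1" using det by simp
  hence "p ^ 2 = 1" by (auto simp: zmult_eq_1_iff)
  thus ?thesis using a' r by simp
qed

end

section \<open>Forms attached to rational points\<close>

lemma rat_square_integer:
  fixes y :: rat
  assumes "y ^ 2 = of_int n"
  obtains m where "y = of_int m"
proof -
  obtain u v where q: "coprime u v" "v > 0" "y = of_int u / of_int v"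
    by (rule quotient_of_cases)
  have "of_int (u ^ 2) = (of_int (n * v ^ 2) :: rat)"
    using assms q by (simp add: power_divide field_simps)
  hence "u ^ 2 = n * v ^ 2" by (simp only: of_int_eq_iff)
  hence "v ^ 2 dvd u ^ 2" by simp
  hence "v dvd u" by simp
  hence "v = 1" using q by (metis coprime_absorb_right zdvd1_eq abs_of_pos)
  thus thesis using that q by simp
qed

text \<open>The integer \<open>m\<close> is \<open>y d^2\<close>, and \<open>- T\<close> is the
  cubic at \<open>- t\<close>. Modulo \<open>a\<close> the numerator \<open>A\<close> is
  \<open>- t d\<close>, so \<open>m^2\<close> becomes \<open>- T d^4\<close>; as \<open>d\<close> is
  invertible modulo \<open>a\<close>, with inverse \<open>e\<close>, \<open>- T\<close> is the
  square of \<open>m e^2\<close>. Twice this root is the middle coefficient.\<close>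

lemma form_of_point:
  assumes P: "Affine x y \<in> rational_points a4 a6" and q: "quotient_of x = (A, d)"
  obtains b c where "b ^ 2 - 4 * (A + t * d) * c = - D_E a4 a6 t"
proof -
  have ad: "coprime A d" "d > 0" "x = of_int A / of_int d"
    using quotient_of_coprime quotient_of_denom_pos quotient_of_div q by blast+
  define a T where "a = A + t * d" and "T = t ^ 3 + a4 * t - a6"
  have xd: "of_int A = x * of_int d" using ad by auto
  have c: "y ^ 2 = x ^ 3 + of_int a4 * x + of_int a6" using P by simp
  have "(y * of_int d ^ 2) ^ 2 = y ^ 2 * of_int d ^ 4" by (simp add: power_mult_distrib)
  also have "\<dots> = of_int (d * (A ^ 3 + a4 * A * d ^ 2 + a6 * d ^ 3))"
    unfolding c of_int_arith xd by Groebner_Basis.algebra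
  finally obtain m where m: "y * of_int d ^ 2 = of_int m" using rat_square_integer by blast
  have "of_int (m ^ 2) = (of_int (d * (A ^ 3 + a4 * A * d ^ 2 + a6 * d ^ 3)) :: rat)"
    using \<open>(y * of_int d ^ 2) ^ 2 = y ^ 2 * of_int d ^ 4\<close>
      \<open>y ^ 2 * of_int d ^ 4 = of_int (d * (A ^ 3 + a4 * A * d ^ 2 + a6 * d ^ 3))\<close> m by simp
  hence m2: "m ^ 2 = d * (A ^ 3 + a4 * A * d ^ 2 + a6 * d ^ 3)" by (simp only: of_int_eq_iff)
  have "coprime d a" using ad(1) unfolding a_def
    by (metis coprime_commute coprime_iff_gcd_eq_1 gcd_add_mult mult.commute add.commute)
  then obtain e where e: "[d * e = 1] (mod a)" using cong_solve_coprime_int by blast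
  have A: "[A = - (t * d)] (mod a)" by (simp add: cong_iff_dvd_diff a_def)
  have "[(m * e ^ 2) ^ 2 = d * (A ^ 3 + a4 * A * d ^ 2 + a6 * d ^ 3) * e ^ 4] (mod a)"
    by (simp add: power_mult_distrib m2)
  also have "[d * (A ^ 3 + a4 * A * d ^ 2 + a6 * d ^ 3) * e ^ 4 =
      d * ((- (t * d)) ^ 3 + a4 * (- (t * d)) * d ^ 2 + a6 * d ^ 3) * e ^ 4] (mod a)"
    by (intro cong_mult cong_add cong_pow A cong_refl)
  also have "d * ((- (t * d)) ^ 3 + a4 * (- (t * d)) * d ^ 2 + a6 * d ^ 3) * e ^ 4
      = - T * (d * e) ^ 4" unfolding T_def by Groebner_Basis.algebra
  also have "[- T * (d * e) ^ 4 = - T * 1 ^ 4] (mod a)"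
    by (intro cong_mult cong_pow e cong_refl)
  finally have "a dvd (m * e ^ 2) ^ 2 + T" by (simp add: cong_iff_dvd_diff)
  then obtain c where "(m * e ^ 2) ^ 2 + T = a * c" ..
  hence "(2 * (m * e ^ 2)) ^ 2 - 4 * a * c = - D_E a4 a6 t"
    by (simp add: D_E_def T_def power_mult_distrib algebra_simps)
  thus thesis using that a_def by blast
qed

text \<open>The point at infinity accounts for the 1 and the sign of y for the factor 2. The last
  hypothesis makes the product of two leading coefficients small enough for
  \<open>equiv_small_leading_coefficients\<close>. The bound on \<open>t\<close> makes
  \<open>A + t d\<close> positive and lets it determine \<open>A\<close> and \<open>d\<close>,
  because two numerators differ by less than \<open>t\<close>.\<close>

lemma class_number_lower_bound:
  fixes X :: nat
  assumes fund: "fundamental_discriminant (- D_E a4 a6 t)" and t: "t > 2 * int X"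
    and D: "4 * (int X * (1 + t)) ^ 2 < D_E a4 a6 t"
  shows "card {P \<in> rational_points a4 a6. pt_height P \<le> int X} \<le> 1 + 2 * class_number (- D_E a4 a6 t)"
proof -
  define D where "D = - D_E a4 a6 t"
  have D4: "4 dvd D" unfolding D_def D_E_def by simp
  have "0 \<le> 4 * (int X * (1 + t)) ^ 2" by simp
  hence neg: "D < 0" using assms(3) unfolding D_def by linarith
  have fund: "fundamental_discriminant D" using fund by (simp add: D_def)
  define S where "S = {P \<in> rational_points a4 a6. pt_height P \<le> int X} - {Infinity}"
  define lead where "lead P = (case P of Affine x y \<Rightarrow>
      fst (quotient_of x) + t * snd (quotient_of x) | Infinity \<Rightarrow> 0)" for P
  have ex: "\<exists>f. f \<in> bqf_forms D \<and> fst f = lead P" if PS: "P \<in> S" for P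
  proof -
    obtain x y where P: "P = Affine x y" using PS by (cases P) (auto simp: S_def)
    obtain A d where q: "quotient_of x = (A, d)" "d > 0" by (rule quotient_of_cases)
    have AX: "\<bar>A\<bar> \<le> int X" using PS q by (auto simp: S_def P)
    have "t * 1 \<le> t * d" using q(2) t by (intro mult_left_mono) auto
    hence "A + t * d > 0" using AX t by linarith
    moreover obtain b c where "b ^ 2 - 4 * (A + t * d) * c = D"
      using form_of_point[OF _ q(1), of y a4 a6 t] PS unfolding D_def by (auto simp: S_def P)
    ultimately show ?thesis
      using bqf_forms_iff[OF fund D4 neg] q by (intro exI[of _ "(A + t * d, b, c)"]) (simp add: lead_def P)
  qed
  \<comment> \<open>The other coefficients depend on the choice of a square root. Any form with the
    right leading coefficient will do, as only that coefficient is compared.\<close>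
  define form where "form P = (SOME f. f \<in> bqf_forms D \<and> fst f = lead P)" for P
  have form: "form P \<in> bqf_forms D" "fst (form P) = lead P" if "P \<in> S" for P
    using someI_ex[OF ex[OF that]] unfolding form_def by auto
  have small: "lead P \<le> int X * (1 + t)" if PS: "P \<in> S" for P
  proof -
    obtain x y where P: "P = Affine x y" using PS by (cases P) (auto simp: S_def)
    obtain A d where q: "quotient_of x = (A, d)" "d > 0" by (rule quotient_of_cases)
    have "A \<le> int X" "t * d \<le> t * int X"
      using PS q t by (auto simp: S_def P intro!: mult_left_mono)
    thus ?thesis using q by (simp add: lead_def P algebra_simps)
  qed
  have lead_pos: "lead P > 0" if "P \<in> S" for P
    using form[OF that] bqf_forms_iff[OF fund D4 neg] by (cases "form P") auto
  define \<phi> where "\<phi> P = (bqf_equiv D `` {form P}, (case P of Affine x y \<Rightarrow> y \<ge> 0 | Infinity \<Rightarrow> True))" for P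
  have inj: "inj_on \<phi> S"
  proof (rule inj_onI)
    fix P Q assume PQ: "P \<in> S" "Q \<in> S" "\<phi> P = \<phi> Q"
    obtain x1 y1 where P: "P = Affine x1 y1" using PQ by (cases P) (auto simp: S_def)
    obtain x2 y2 where Q: "Q = Affine x2 y2" using PQ by (cases Q) (auto simp: S_def)
    obtain A1 d1 where q1: "quotient_of x1 = (A1, d1)" "d1 > 0" by (rule quotient_of_cases)
    obtain A2 d2 where q2: "quotient_of x2 = (A2, d2)" "d2 > 0" by (rule quotient_of_cases)
    have "bqf_equiv D `` {form P} = bqf_equiv D `` {form Q}" using PQ(3) by (simp add: \<phi>_def)
    hence "(form P, form Q) \<in> bqf_equiv D"
      using eq_equiv_class[OF _ equiv_bqf_equiv[OF fund D4 neg]] form PQ by blast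
    moreover have "4 * lead P * lead Q < - D"
    proof -
      have "lead P * lead Q \<le> (int X * (1 + t)) * (int X * (1 + t))"
        using small[OF PQ(1)] small[OF PQ(2)] lead_pos[OF PQ(1)] lead_pos[OF PQ(2)]
        by (intro mult_mono) auto
      thus ?thesis using D by (simp add: D_def power2_eq_square)
    qed
    ultimately have "lead P = lead Q"
      using equiv_small_leading_coefficients[OF fund D4 neg] form[OF PQ(1)] form[OF PQ(2)]
      by (cases "form P"; cases "form Q") auto
    hence eq: "A1 - A2 = t * (d2 - d1)" using q1 q2 by (simp add: lead_def P Q algebra_simps)
    have "\<bar>A1\<bar> \<le> int X" "\<bar>A2\<bar> \<le> int X" using PQ q1 q2 by (auto simp: S_def P Q)
    hence lt: "\<bar>t * (d2 - d1)\<bar> < t" unfolding eq[symmetric] using t by linarith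
    have "d1 = d2"
    proof (rule ccontr)
      assume "d1 \<noteq> d2"
      hence "t * 1 \<le> t * \<bar>d2 - d1\<bar>" using t by (intro mult_left_mono) auto
      thus False using lt t by (simp add: abs_mult)
    qed
    hence x: "x1 = x2" using eq q1 q2 quotient_of_inject by simp
    have "y1 ^ 2 = y2 ^ 2" using PQ(1,2) x by (simp add: S_def P Q)
    moreover have "y1 \<ge> 0 \<longleftrightarrow> y2 \<ge> 0" using PQ(3) by (simp add: \<phi>_def P Q)
    ultimately have "y1 = y2" by (auto simp: power2_eq_iff)
    thus "P = Q" using P Q x by simp
  qed
  have sub: "\<phi> ` S \<subseteq> (bqf_forms D // bqf_equiv D) \<times> (UNIV :: bool set)"
    using form by (auto simp: \<phi>_def intro: quotientI)
  have fin: "finite ((bqf_forms D // bqf_equiv D) \<times> (UNIV :: bool set))"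
    using finite_classes[OF fund D4 neg] by simp
  have fS: "finite S" using inj sub fin inj_on_finite by blast
  have "{P \<in> rational_points a4 a6. pt_height P \<le> int X} \<subseteq> insert Infinity S"
    by (auto simp: S_def)
  hence "card {P \<in> rational_points a4 a6. pt_height P \<le> int X} \<le> card (insert Infinity S)"
    using fS by (intro card_mono) auto
  also have "\<dots> \<le> 1 + card S" using fS by (simp add: card_insert_if)
  also have "card S \<le> class_number D * 2"
    using card_inj_on_le[OF inj sub fin] by (simp add: class_number_def card_cartesian_product)
  finally show ?thesis by (simp add: D_def)
qed

section \<open>A recursive function\<close>

text \<open>A majorant that is easy to program: a tower of fixed height dominates all explicit
  bounds below.\<close>

fun tower :: "nat \<Rightarrow> nat \<Rightarrow> nat" where
  "tower 0 n = n"
| "tower (Suc k) n = 2 ^ tower k n"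

text \<open>In the step of \<open>RPrim\<close> the arguments are the counter, the previous value
  and the parameters, so \<open>RProj 1\<close> is the previous value.\<close>

definition rf_add :: recf where
  "rf_add = RPrim (RProj 0) (RComp RSucc [RProj 1])"

definition rf_double :: recf where
  "rf_double = RComp rf_add [RProj 0, RProj 0]"

definition rf_exp :: recf where
  "rf_exp = RPrim (RComp RSucc [RZero]) (RComp rf_double [RProj 1])"

fun rf_tower :: "nat \<Rightarrow> recf \<Rightarrow> recf" where
  "rf_tower 0 f = f"
| "rf_tower (Suc k) f = RComp rf_exp [rf_tower k f]"

lemma rec_eval_Proj: "i < length xs \<Longrightarrow> y = xs ! i \<Longrightarrow> rec_eval (RProj i) xs y"
  by (auto intro: rec_eval.proj)

lemma rec_eval_Succ: "rec_eval g xs y \<Longrightarrow> rec_eval (RComp RSucc [g]) xs (Suc y)"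
  by (rule rec_eval.comp[where ys = "[y]"]) (auto intro: rec_eval.succ)

lemma rec_eval_comp1:
  "rec_eval g xs y \<Longrightarrow> rec_eval f [y] z \<Longrightarrow> rec_eval (RComp f [g]) xs z"
  by (rule rec_eval.comp[where ys = "[y]"]) auto

lemma rec_eval_comp2:
  "rec_eval g xs y \<Longrightarrow> rec_eval g' xs y' \<Longrightarrow> rec_eval f [y, y'] z
    \<Longrightarrow> rec_eval (RComp f [g, g']) xs z"
  by (rule rec_eval.comp[where ys = "[y, y']"]) auto

lemma rec_eval_add: "rec_eval rf_add [n, x] (n + x)"
proof (induction n)
  case 0
  show ?case unfolding rf_add_def by (rule rec_eval.prim_0) (simp add: rec_eval_Proj)
next
  case (Suc n)
  show ?case unfolding rf_add_def add_Suc
    by (rule rec_eval.prim_Suc[OF Suc[unfolded rf_add_def]])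
      (intro rec_eval_Succ rec_eval_Proj; simp)
qed

lemma rec_eval_double: "rec_eval rf_double [n] (2 * n)"
  unfolding rf_double_def mult_2
  by (intro rec_eval_comp2[OF _ _ rec_eval_add] rec_eval_Proj; simp)

lemma rec_eval_exp: "rec_eval rf_exp [n] (2 ^ n)"
proof (induction n)
  case 0
  show ?case unfolding rf_exp_def
    using rec_eval.prim_0[OF rec_eval_Succ[OF rec_eval.zero[of "[]"]]] by simp
next
  case (Suc n)
  have "rec_eval (RComp rf_double [RProj 1]) [n, 2 ^ n] (2 * 2 ^ n)"
    by (rule rec_eval_comp1[OF rec_eval_Proj rec_eval_double]) auto
  thus ?case unfolding rf_exp_def power_Suc
    by (rule rec_eval.prim_Suc[OF Suc[unfolded rf_exp_def]])
qed

lemma rec_eval_tower: "rec_eval f xs n \<Longrightarrow> rec_eval (rf_tower k f) xs (tower k n)"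
  by (induction k) (auto intro: rec_eval_comp1 rec_eval_exp)

text \<open>Negative integers have odd codes. This is why the bound has the form
  \<open>- int (Suc n)\<close>: its code is the successor of a doubled value.\<close>

lemma int_encode_neg: "int_encode (- int (Suc n)) = Suc (2 * n)"
  by (simp add: int_encode_def sum_encode_def)

text \<open>This lets the sum of the input codes bound the absolute values of all inputs at
  once.\<close>

lemma int_encode_ge: "\<bar>i\<bar> \<le> int (int_encode i)"
  by (auto simp: int_encode_def sum_encode_def)

lemma effectively_computable_tower:
  "effectively_computable_on A
     (\<lambda>x. - int (Suc (tower k (sum_list (encode_input x)))))"
proof -
  define s where "s = RComp rf_add [RProj 0, RComp rf_add [RProj 1, RComp rf_add [RProj 2,
      RComp rf_add [RProj 3, RProj 4]]]]"
  have s: "rec_eval s (encode_input x) (sum_list (encode_input x))" for x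
  proof (cases x)
    case (fields a4 a6 r q)
    have "rec_eval s [a, b, c, d, e] (a + (b + (c + (d + e))))" for a b c d e
      unfolding s_def
      by (intro rec_eval_comp2[OF _ _ rec_eval_add] rec_eval_Proj; simp)
    thus ?thesis using fields by simp
  qed
  have "rec_eval (RComp RSucc [RComp rf_double [rf_tower k s]]) (encode_input x)
      (int_encode (- int (Suc (tower k (sum_list (encode_input x))))))" for x
    unfolding int_encode_neg
    by (intro rec_eval_Succ rec_eval_comp1[OF _ rec_eval_double] rec_eval_tower s)
  thus ?thesis unfolding effectively_computable_on_def by blast
qed

section \<open>Bases modulo torsion\<close>

context comm_group
begin

text \<open>\<open>tors\<close>, \<open>lcomb\<close> and \<open>basis_mod_tors\<close> are the
  counterparts, in any commutative group, of \<open>torsion_points\<close>, \<open>lin_comb\<close>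
  and \<open>mw_basis\<close>; \<open>basis_mod_tors_mw_group\<close> makes the
  identification.\<close>

definition tors :: "'a set" where
  "tors = {x \<in> carrier G. \<exists>n::nat. n > 0 \<and> x [^] n = \<one>}"

definition lcomb :: "'a list \<Rightarrow> (nat \<Rightarrow> int) \<Rightarrow> 'a" where
  "lcomb xs n = finprod G (\<lambda>i. (xs ! i) [^] n i) {..<length xs}"

definition basis_mod_tors :: "'a list \<Rightarrow> bool" where
  "basis_mod_tors xs \<longleftrightarrow> set xs \<subseteq> carrier G \<and>
     (\<forall>y \<in> carrier G. \<exists>n. \<exists>t \<in> tors. y = lcomb xs n \<otimes> t) \<and>
     (\<forall>n. lcomb xs n \<in> tors \<longrightarrow> (\<forall>i<length xs. n i = 0))"

lemma tors_carrier: "t \<in> tors \<Longrightarrow> t \<in> carrier G"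
  by (simp add: tors_def)

lemma one_tors: "\<one> \<in> tors"
  unfolding tors_def by (auto intro!: exI[of _ "1::nat"])

lemma tors_mult_inv:
  assumes "t \<in> tors" "u \<in> tors"
  shows "t \<otimes> inv u \<in> tors"
proof -
  obtain m n :: nat where mn: "m > 0" "t [^] m = \<one>" "n > 0" "u [^] n = \<one>"
    using assms by (auto simp: tors_def)
  have tu: "t \<in> carrier G" "u \<in> carrier G" using assms tors_carrier by auto
  have "t [^] (m * n) = \<one>" using mn(2) tu by (simp add: nat_pow_pow[symmetric])
  moreover have "u [^] (m * n) = \<one>"
    using mn(4) tu nat_pow_pow[OF tu(2), of n m] by (simp add: mult.commute)
  ultimately have "(t \<otimes> inv u) [^] (m * n) = \<one>"
    using tu by (simp add: nat_pow_distrib nat_pow_inv)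
  thus ?thesis using mn tu unfolding tors_def by (auto intro!: exI[of _ "m * n"])
qed

lemma cross:
  assumes "a \<in> carrier G" "t \<in> carrier G" "b \<in> carrier G" "u \<in> carrier G" and eq: "a \<otimes> t = b \<otimes> u"
  shows "a \<otimes> inv b = u \<otimes> inv t"
proof -
  have "a \<otimes> inv b = (a \<otimes> inv b) \<otimes> (t \<otimes> inv t)" using assms(1-4) by simp
  also have "\<dots> = (a \<otimes> t) \<otimes> (inv t \<otimes> inv b)"
    using assms(1-4) by (simp only: m_ac m_closed inv_closed)
  also have "\<dots> = (b \<otimes> u) \<otimes> (inv b \<otimes> inv t)" using assms(1-4) by (simp only: eq m_ac m_closed inv_closed)
  also have "\<dots> = (b \<otimes> inv b) \<otimes> (u \<otimes> inv t)" using assms(1-4) by (simp only: m_ac m_closed inv_closed)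
  also have "\<dots> = u \<otimes> inv t" using assms(1-4) by simp
  finally show ?thesis .
qed

lemma lcomb_closed: "set xs \<subseteq> carrier G \<Longrightarrow> lcomb xs n \<in> carrier G"
  unfolding lcomb_def by (intro finprod_closed) (auto intro!: int_pow_closed dest: nth_mem)

lemma lcomb_add:
  assumes "set xs \<subseteq> carrier G"
  shows "lcomb xs (\<lambda>i. m i + n i) = lcomb xs m \<otimes> lcomb xs n"
proof -
  have xs: "xs ! i \<in> carrier G" if "i < length xs" for i using assms that by auto
  have "lcomb xs (\<lambda>i. m i + n i) = finprod G (\<lambda>i. (xs ! i) [^] m i \<otimes> (xs ! i) [^] n i) {..<length xs}"
    unfolding lcomb_def by (rule finprod_cong') (use xs in \<open>auto simp: int_pow_mult\<close>)
  also have "\<dots> = lcomb xs m \<otimes> lcomb xs n"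
    unfolding lcomb_def by (rule finprod_multf) (use xs in auto)
  finally show ?thesis .
qed

lemma lcomb_zero: "lcomb xs (\<lambda>i. 0) = \<one>"
  unfolding lcomb_def by simp

lemma lcomb_diff:
  assumes "set xs \<subseteq> carrier G"
  shows "lcomb xs (\<lambda>i. m i - n i) = lcomb xs m \<otimes> inv (lcomb xs n)"
proof -
  have "lcomb xs (\<lambda>i. m i - n i) \<otimes> lcomb xs n = lcomb xs m"
    using lcomb_add[OF assms, of "\<lambda>i. m i - n i" n] by simp
  thus ?thesis using lcomb_closed[OF assms] by (metis inv_solve_right)
qed

lemma lcomb_unit:
  assumes "set xs \<subseteq> carrier G" "k < length xs"
  shows "lcomb xs (\<lambda>i. if i = k then 1 else 0) = xs ! k"
proof -
  have xs: "xs ! i \<in> carrier G" if "i < length xs" for i using assms that by auto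
  have "lcomb xs (\<lambda>i. if i = k then 1 else 0) = finprod G (\<lambda>i. if i = k then xs ! i else \<one>) {..<length xs}"
    unfolding lcomb_def by (rule finprod_cong') (use xs in auto)
  also have "\<dots> = xs ! k"
    by (rule finprod_singleton_swap) (use assms xs in auto)
  finally show ?thesis .
qed

lemma additive_int_finprod:
  assumes f: "\<And>x y. x \<in> carrier G \<Longrightarrow> y \<in> carrier G \<Longrightarrow> f (x \<otimes> y) = f x + f y"
    and xs: "set xs \<subseteq> carrier G"
  shows "f (lcomb xs n) = (\<Sum>i<length xs. n i * (f (xs ! i) :: int))"
proof -
  have f1: "f \<one> = 0" using f[of \<one> \<one>] by simp
  have finv: "f (inv x) = - f x" if "x \<in> carrier G" for x
    using f[of x "inv x"] that f1 by simp
  have fnat: "f (x [^] (k::nat)) = int k * f x" if "x \<in> carrier G" for x k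
    by (induction k) (use that f f1 in \<open>auto simp: algebra_simps\<close>)
  have fint: "f (x [^] (k::int)) = k * f x" if x: "x \<in> carrier G" for x k
  proof (cases k rule: int_cases2)
    case (nonneg n)
    thus ?thesis using fnat[OF x, of n] by (simp add: int_pow_int)
  next
    case (nonpos n)
    thus ?thesis using fnat[OF x, of n] finv[OF nat_pow_closed[OF x, of n]]
      by (simp add: int_pow_neg_int[OF x])
  qed
  have ffin: "f (finprod G g A) = (\<Sum>i\<in>A. f (g i))" if "finite A" "g \<in> A \<rightarrow> carrier G" for g and A :: "nat set"
    using that by (induction A rule: finite_induct) (auto simp: f1 f Pi_def)
  have xi: "xs ! i \<in> carrier G" if "i < length xs" for i using xs that nth_mem by blast
  have "f (lcomb xs n) = (\<Sum>i<length xs. f ((xs ! i) [^] n i))"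
    unfolding lcomb_def by (rule ffin) (use xi in \<open>auto intro!: int_pow_closed\<close>)
  also have "\<dots> = (\<Sum>i<length xs. n i * f (xs ! i))"
    by (rule sum.cong) (use xi fint in auto)
  finally show ?thesis .
qed

text \<open>The coordinate functions of two bases are expressed through each other by matrices
  \<open>U\<close> and \<open>V\<close> with \<open>U V = 1\<close> and \<open>V U = 1\<close>, and \<open>trace (U V) = trace (V U)\<close>.\<close>

lemma basis_length_unique:
  assumes xs: "basis_mod_tors xs" and ys: "basis_mod_tors ys"
  shows "length xs = length ys"
proof -
  \<comment> \<open>Some choice of coordinates modulo torsion. Only the values below
    \<open>length zs\<close> are determined, which is what \<open>unique\<close> records; the others
    do not affect \<open>lcomb\<close>.\<close>
  define co where "co zs y = (SOME n. \<exists>t\<in>tors. y = lcomb zs n \<otimes> t)" for zs y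
  have co: "\<exists>t\<in>tors. y = lcomb zs (co zs y) \<otimes> t" if "basis_mod_tors zs" "y \<in> carrier G" for zs y
  proof -
    have "\<exists>n. \<exists>t\<in>tors. y = lcomb zs n \<otimes> t" using that unfolding basis_mod_tors_def by blast
    from someI_ex[OF this] show ?thesis unfolding co_def .
  qed
  have unique: "n i = co zs y i"
    if zs: "basis_mod_tors zs" and t: "t \<in> tors" "y = lcomb zs n \<otimes> t" and i: "i < length zs" for zs y n t i
  proof -
    have zc: "set zs \<subseteq> carrier G" using zs by (simp add: basis_mod_tors_def)
    have lc: "lcomb zs k \<in> carrier G" for k by (rule lcomb_closed[OF zc])
    have tc: "t \<in> carrier G" using t tors_carrier by auto
    have "y \<in> carrier G" using t lc tc by simp
    then obtain u where u: "u \<in> tors" "y = lcomb zs (co zs y) \<otimes> u" using co[OF zs] by blast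
    have uc: "u \<in> carrier G" using u tors_carrier by auto
    have "lcomb zs n \<otimes> t = lcomb zs (co zs y) \<otimes> u" using t u by simp
    hence "lcomb zs n \<otimes> inv (lcomb zs (co zs y)) = u \<otimes> inv t"
      by (rule cross[OF lc tc lc uc])
    hence "lcomb zs (\<lambda>i. n i - co zs y i) \<in> tors"
      using tors_mult_inv[OF u(1) t(1)] by (simp add: lcomb_diff[OF zc])
    thus ?thesis using zs i by (auto simp: basis_mod_tors_def)
  qed
  have add: "co zs (x \<otimes> y) i = co zs x i + co zs y i"
    if zs: "basis_mod_tors zs" and xy: "x \<in> carrier G" "y \<in> carrier G" and i: "i < length zs" for zs x y i
  proof -
    have zc: "set zs \<subseteq> carrier G" using zs by (simp add: basis_mod_tors_def)
    obtain t u where tu: "t \<in> tors" "x = lcomb zs (co zs x) \<otimes> t" "u \<in> tors" "y = lcomb zs (co zs y) \<otimes> u"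
      using co[OF zs] xy by meson
    have c: "t \<in> carrier G" "u \<in> carrier G" using tu tors_carrier by auto
    have "inv u \<in> tors" using tors_mult_inv[OF one_tors tu(3)] c by simp
    hence "t \<otimes> u \<in> tors" using tors_mult_inv[OF tu(1)] c by fastforce
    moreover have "x \<otimes> y = lcomb zs (\<lambda>i. co zs x i + co zs y i) \<otimes> (t \<otimes> u)"
    proof -
      define A B where "A = lcomb zs (co zs x)" and "B = lcomb zs (co zs y)"
      have AB: "A \<in> carrier G" "B \<in> carrier G" unfolding A_def B_def by (rule lcomb_closed[OF zc])+
      have "x \<otimes> y = (A \<otimes> t) \<otimes> (B \<otimes> u)" using tu by (simp add: A_def B_def)
      also have "\<dots> = (A \<otimes> B) \<otimes> (t \<otimes> u)" using AB c by (simp add: m_ac)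
      finally show ?thesis unfolding lcomb_add[OF zc] A_def B_def .
    qed
    ultimately show ?thesis using unique[OF zs _ _ i] by metis
  qed
  have delta: "co zs (zs ! k) i = (if i = k then 1 else 0)"
    if zs: "basis_mod_tors zs" and "i < length zs" "k < length zs" for zs i k
  proof -
    have zc: "set zs \<subseteq> carrier G" using zs by (simp add: basis_mod_tors_def)
    have "zs ! k = lcomb zs (\<lambda>i. if i = k then 1 else 0) \<otimes> \<one>"
    proof -
      have "zs ! k \<in> carrier G" using zc that(3) nth_mem by blast
      thus ?thesis unfolding lcomb_unit[OF zc that(3)] by simp
    qed
    from unique[OF zs one_tors this that(2)] show ?thesis by simp
  qed
  have tors0: "co zs t i = 0" if zs: "basis_mod_tors zs" and "t \<in> tors" "i < length zs" for zs t i
    using unique[OF zs that(2) _ that(3), of t "\<lambda>i. 0"] that(2) tors_carrier by (simp add: lcomb_zero)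
  have trans: "co zs y i = (\<Sum>j<length ws. co ws y j * co zs (ws ! j) i)"
    if zs: "basis_mod_tors zs" and ws: "basis_mod_tors ws" and y: "y \<in> carrier G" and i: "i < length zs" for zs ws y i
  proof -
    have wc: "set ws \<subseteq> carrier G" using ws by (simp add: basis_mod_tors_def)
    obtain t where t: "t \<in> tors" "y = lcomb ws (co ws y) \<otimes> t" using co[OF ws y] by blast
    have "co zs y i = co zs (lcomb ws (co ws y)) i + co zs t i"
      by (subst t(2), rule add[OF zs lcomb_closed[OF wc] tors_carrier[OF t(1)] i])
    also have "co zs t i = 0" by (rule tors0[OF zs t(1) i])
    also have "co zs (lcomb ws (co ws y)) i = (\<Sum>j<length ws. co ws y j * co zs (ws ! j) i)"
      by (rule additive_int_finprod[where f = "\<lambda>x. co zs x i", OF add[OF zs _ _ i] wc])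
    finally show ?thesis by simp
  qed
  have tr: "int (length zs) = (\<Sum>i<length zs. \<Sum>j<length ws. co ws (zs ! i) j * co zs (ws ! j) i)"
    if zs: "basis_mod_tors zs" and ws: "basis_mod_tors ws" for zs ws
  proof -
    have zc: "set zs \<subseteq> carrier G" using zs by (simp add: basis_mod_tors_def)
    have "int (length zs) = (\<Sum>i<length zs. co zs (zs ! i) i)"
      using delta[OF zs] by simp
    also have "\<dots> = (\<Sum>i<length zs. \<Sum>j<length ws. co ws (zs ! i) j * co zs (ws ! j) i)"
      by (rule sum.cong[OF refl], rule trans[OF zs ws]) (use zc in auto)
    finally show ?thesis .
  qed
  have "int (length xs) = (\<Sum>i<length xs. \<Sum>j<length ys. co ys (xs ! i) j * co xs (ys ! j) i)"
    by (rule tr[OF xs ys])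
  also have "\<dots> = (\<Sum>j<length ys. \<Sum>i<length xs. co xs (ys ! j) i * co ys (xs ! i) j)"
    by (subst sum.swap) (simp add: mult.commute)
  also have "\<dots> = int (length ys)" by (rule tr[OF ys xs, symmetric])
  finally show ?thesis by simp
qed

end

context height_group
begin

lemma tors_q_add:
  assumes "t \<in> tors" "x \<in> carrier G"
  shows "q (x \<otimes> t) = q x"
  using assms q_add_torsion unfolding tors_def by auto

text \<open>The division by 2 turns \<open>B\<close> into the height pairing in its prescribed
  normalisation, so that the Gram determinant of the basis is the regulator itself.\<close>

lemma sym_bilinear_lcomb:
  assumes xs: "set xs \<subseteq> carrier G"
  shows "sym_bilinear (\<lambda>p p'. B (lcomb xs (coeff p)) (lcomb xs (coeff p')) / 2)"
proof -
  note lc = lcomb_closed[OF xs]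
  have add: "lcomb xs (coeff (p + p')) = lcomb xs (coeff p) \<otimes> lcomb xs (coeff p')" for p p'
  proof -
    have "coeff (p + p') = (\<lambda>i. coeff p i + coeff p' i)" by auto
    thus ?thesis by (simp only: lcomb_add[OF xs])
  qed
  show ?thesis unfolding sym_bilinear_def additive_fun_def
  proof (intro conjI allI)
    fix x y z
    show "B (lcomb xs (coeff x)) (lcomb xs (coeff y)) / 2 = B (lcomb xs (coeff y)) (lcomb xs (coeff x)) / 2"
      by (simp add: B_commute[OF lc[of "coeff x"] lc[of "coeff y"]])
    show "B (lcomb xs (coeff x)) (lcomb xs (coeff (y + z))) / 2
        = B (lcomb xs (coeff x)) (lcomb xs (coeff y)) / 2 + B (lcomb xs (coeff x)) (lcomb xs (coeff z)) / 2"
      unfolding add by (subst (1 2 3) B_commute) (auto simp: lc B_add add_divide_distrib)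
  qed
qed

lemma lcomb_coeff_inj:
  assumes xs: "basis_mod_tors xs"
    and p: "p \<in> lat (length xs)" "p' \<in> lat (length xs)" and t: "t \<in> tors" "t' \<in> tors"
    and eq: "lcomb xs (coeff p) \<otimes> t = lcomb xs (coeff p') \<otimes> t'"
  shows "p = p'" "t = t'"
proof -
  have xc: "set xs \<subseteq> carrier G" using xs by (simp add: basis_mod_tors_def)
  note lc = lcomb_closed[OF xc]
  have tc: "t \<in> carrier G" "t' \<in> carrier G" using t tors_carrier by auto
  have "lcomb xs (coeff p) \<otimes> inv (lcomb xs (coeff p')) = t' \<otimes> inv t"
    by (rule cross[OF lc tc(1) lc tc(2) eq])
  hence "lcomb xs (\<lambda>i. coeff p i - coeff p' i) \<in> tors"
    using tors_mult_inv[OF t(2,1)] by (simp add: lcomb_diff[OF xc])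
  hence z: "\<forall>i<length xs. coeff p i - coeff p' i = 0"
  proof -
    have "\<forall>n. lcomb xs n \<in> tors \<longrightarrow> (\<forall>i<length xs. n i = 0)"
      using xs by (simp add: basis_mod_tors_def)
    from spec[OF this, of "\<lambda>i. coeff p i - coeff p' i"] show ?thesis
      using \<open>lcomb xs (\<lambda>i. coeff p i - coeff p' i) \<in> tors\<close> by simp
  qed
  show pp: "p = p'"
  proof (rule poly_eqI)
    show "coeff p i = coeff p' i" for i
      using z p by (cases "i < length xs") (auto simp: lat_def)
  qed
  show "t = t'" using eq lc tc pp by simp
qed

end

lemma tri_monom: "i \<le> k \<Longrightarrow> tri r c (monom 1 i) k = (if k = i then 1 else 0)"
  unfolding tri_def by (auto intro!: sum.neutral)

context height_group
begin

lemma finite_q_le: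
  assumes "\<And>T. finite {x \<in> carrier G. h x \<le> T}"
  shows "finite {x \<in> carrier G. q x \<le> T}"
proof (rule finite_subset[OF _ assms[of "T + K"]])
  show "{x \<in> carrier G. q x \<le> T} \<subseteq> {x \<in> carrier G. h x \<le> T + K}"
    using q_diff_h by (auto simp: abs_le_iff) (smt (verit))
qed

lemma tors_q_zero: "t \<in> tors \<Longrightarrow> q t = 0"
  unfolding tors_def using torsion_q by auto

text \<open>\<open>\<beta> 0\<close> is the value of the form at a non-zero lattice vector, hence at
  least \<open>\<mu>\<close>, and a reduced basis loses at most a factor 3/4 per step. Translating
  the lattice points by torsion leaves \<open>q\<close> unchanged and produces distinct group
  elements, which gives the factor \<open>card tors\<close>.\<close>

theorem point_count:
  fixes xs :: "'a list"
  defines "r \<equiv> length xs"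
  assumes xs: "basis_mod_tors xs"
    and hfin: "\<And>T. finite {x \<in> carrier G. h x \<le> T}"
    and low: "\<And>x. x \<in> carrier G \<Longrightarrow> x \<notin> tors \<Longrightarrow> \<mu> \<le> q x / 2" and \<mu>: "\<mu> > 0"
  obtains \<beta> :: "nat \<Rightarrow> real" where "\<And>i. i < r \<Longrightarrow> (3 / 4) ^ r * \<mu> \<le> \<beta> i"
    "Determinant.det (mat r r (\<lambda>(i, j). B (xs ! i) (xs ! j) / 2)) = (\<Prod>i<r. \<beta> i)"
    "\<And>\<rho>. sqrt (\<Sum>i<r. \<beta> i) / 2 < \<rho> \<Longrightarrow>
       real (card tors) * (unit_ball_vol (real r) * (\<rho> - sqrt (\<Sum>i<r. \<beta> i) / 2) ^ r)
       \<le> real (card {x \<in> carrier G. q x / 2 \<le> \<rho>\<^sup>2}) * sqrt (\<Prod>i<r. \<beta> i)"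
proof -
  have xc: "set xs \<subseteq> carrier G" using xs by (simp add: basis_mod_tors_def)
  note lc = lcomb_closed[OF xc]
  define b where "b p p' = B (lcomb xs (coeff p)) (lcomb xs (coeff p')) / 2" for p p'
  have bil: "sym_bilinear b" unfolding b_def[abs_def] by (rule sym_bilinear_lcomb[OF xc])
  have bq: "b p p = q (lcomb xs (coeff p)) / 2" for p by (simp add: b_def B_self lc)
  have b_low: "\<mu> \<le> b p p" if p: "p \<in> lat r" "p \<noteq> 0" for p
  proof -
    have "lcomb xs (coeff p) \<notin> tors"
    proof
      assume t: "lcomb xs (coeff p) \<in> tors"
      have "coeff (0 :: int poly) = (\<lambda>i. 0)" by auto
      hence eq: "lcomb xs (coeff p) \<otimes> \<one> = lcomb xs (coeff 0) \<otimes> lcomb xs (coeff p)"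
        using lc by (simp add: lcomb_zero)
      have "p = 0"
        by (rule lcomb_coeff_inj(1)[OF xs _ _ one_tors t eq]) (use p in \<open>auto simp: r_def lat_def\<close>)
      thus False using p by simp
    qed
    thus ?thesis unfolding bq by (rule low[OF lc])
  qed
  have b_pos: "0 < b p p" if "p \<in> lat r" "p \<noteq> 0" for p
    using b_low[OF that] \<mu> by linarith
  have lcomb_inj: "inj_on (\<lambda>p. lcomb xs (coeff p)) (lat r)"
    by (rule inj_onI, rule lcomb_coeff_inj(1)[OF xs _ _ one_tors one_tors]) (use lc in \<open>auto simp: r_def\<close>)
  have b_fin: "finite {p \<in> lat r. b p p \<le> T}" for T
  proof (rule inj_on_finite)
    show "inj_on (\<lambda>p. lcomb xs (coeff p)) {p \<in> lat r. b p p \<le> T}"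
      by (rule inj_on_subset[OF lcomb_inj]) auto
    show "(\<lambda>p. lcomb xs (coeff p)) ` {p \<in> lat r. b p p \<le> T} \<subseteq> {x \<in> carrier G. q x \<le> 2 * T}"
      using lc by (auto simp: bq)
    show "finite {x \<in> carrier G. q x \<le> 2 * T}" by (rule finite_q_le[OF hfin])
  qed
  obtain f \<beta> c where f: "lat_aut r f" and \<beta>: "\<And>i. i < r \<Longrightarrow> \<beta> i > 0"
    "\<And>i. Suc i < r \<Longrightarrow> 3 / 4 * \<beta> i \<le> \<beta> (Suc i)"
    and eq: "\<And>p q. p \<in> lat r \<Longrightarrow> q \<in> lat r \<Longrightarrow> b (f p) (f q) = (\<Sum>i<r. \<beta> i * tri r c p i * tri r c q i)"
    using reduced_basis[OF bil b_pos b_fin] by blast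
  obtain g where "lat_iso r f g" using f by (auto simp: lat_aut_def)
  note g = lat_isoD[OF this]
  have \<beta>_low: "(3 / 4) ^ i * \<mu> \<le> \<beta> i" if "i < r" for i
    using that
  proof (induction i)
    case 0
    have one: "monom 1 0 \<in> lat r" by (rule monom_in_lat[OF 0])
    have tri0: "tri r c (monom 1 0) i = (if i = 0 then 1 else 0)" for i by (rule tri_monom) simp
    have "b (f (monom 1 0)) (f (monom 1 0)) = (\<Sum>i<r. if i = 0 then \<beta> i else 0)"
      unfolding eq[OF one one] tri0 by (rule sum.cong) auto
    also have "\<dots> = \<beta> 0" using 0 by simp
    finally have "b (f (monom 1 0)) (f (monom 1 0)) = \<beta> 0" .
    moreover have "f (monom 1 0) \<noteq> 0"
    proof
      assume z: "f (monom 1 0) = 0"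
      have "(0 :: int poly) = monom 1 0" using g(6)[OF one] additive_fun_0[OF g(3)] z by simp
      thus False by simp
    qed
    ultimately show ?case using b_low[OF g(2)[OF one]] by simp
  next
    case (Suc i)
    have "(3 / 4) ^ Suc i * \<mu> = 3 / 4 * ((3 / 4) ^ i * \<mu>)" by simp
    also have "\<dots> \<le> 3 / 4 * \<beta> i" using Suc by (intro mult_left_mono) auto
    also have "\<dots> \<le> \<beta> (Suc i)" by (rule \<beta>(2)[OF Suc.prems])
    finally show ?case .
  qed
  have 1: "(3 / 4) ^ r * \<mu> \<le> \<beta> i" if "i < r" for i
  proof -
    have "(3 / 4 :: real) ^ r \<le> (3 / 4) ^ i" using that by (intro power_decreasing) auto
    hence "(3 / 4) ^ r * \<mu> \<le> (3 / 4) ^ i * \<mu>" using \<mu> by (intro mult_right_mono) auto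
    thus ?thesis using \<beta>_low[OF that] by linarith
  qed
  have mono: "lcomb xs (coeff (monom 1 i)) = xs ! i" if "i < r" for i
  proof -
    have "coeff (monom (1::int) i) = (\<lambda>k. if k = i then 1 else 0)" by auto
    thus ?thesis using lcomb_unit[OF xc, of i] that by (simp add: r_def)
  qed
  have "mat r r (\<lambda>(i, j). B (xs ! i) (xs ! j) / 2) = mat r r (\<lambda>(i, j). b (monom 1 i) (monom 1 j))"
    by (rule eq_matI) (auto simp: b_def mono)
  hence 2: "Determinant.det (mat r r (\<lambda>(i, j). B (xs ! i) (xs ! j) / 2)) = (\<Prod>i<r. \<beta> i)"
    using gram_determinant[OF bil f eq] by simp
  have fin_tors: "finite tors"
    by (rule finite_subset[OF _ finite_q_le[OF hfin, of 0]]) (auto simp: tors_q_zero tors_carrier)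
  have 3: "real (card tors) * (unit_ball_vol (real r) * (\<rho> - sqrt (\<Sum>i<r. \<beta> i) / 2) ^ r)
       \<le> real (card {x \<in> carrier G. q x / 2 \<le> \<rho>\<^sup>2}) * sqrt (\<Prod>i<r. \<beta> i)"
    if \<rho>: "sqrt (\<Sum>i<r. \<beta> i) / 2 < \<rho>" for \<rho>
  proof -
    define S where "S = {p \<in> lat r. (\<Sum>i<r. \<beta> i * (tri r c p i)\<^sup>2) \<le> \<rho>\<^sup>2}"
    have S: "S = {p \<in> lat r. b (f p) (f p) \<le> \<rho>\<^sup>2}"
      unfolding S_def by (auto simp: eq power2_eq_square mult.assoc)
    have f_inj: "inj_on f (lat r)" by (rule inj_on_inverseI[where g = g]) (rule g(6))
    have finS: "finite S"
    proof (rule inj_on_finite)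
      show "inj_on f S" by (rule inj_on_subset[OF f_inj]) (auto simp: S_def)
      show "f ` S \<subseteq> {p \<in> lat r. b p p \<le> \<rho>\<^sup>2}" using g(2) by (auto simp: S)
    qed (rule b_fin)
    define F where "F = (\<lambda>(p, t). lcomb xs (coeff (f p)) \<otimes> t)"
    have F_inj: "inj_on F (S \<times> tors)"
    proof (rule inj_onI)
      fix z z' assume z: "z \<in> S \<times> tors" "z' \<in> S \<times> tors" "F z = F z'"
      obtain p t p' t' where zz: "z = (p, t)" "z' = (p', t')" by (cases z, cases z')
      have pp: "p \<in> lat r" "p' \<in> lat r" "t \<in> tors" "t' \<in> tors" using z zz by (auto simp: S_def)
      have "f p = f p'" "t = t'"
        using lcomb_coeff_inj[OF xs _ _ pp(3,4)] g(2)[OF pp(1)] g(2)[OF pp(2)] z(3)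
        by (auto simp: F_def zz r_def)
      thus "z = z'" using f_inj pp zz by (auto dest: inj_onD)
    qed
    have "F ` (S \<times> tors) \<subseteq> {x \<in> carrier G. q x / 2 \<le> \<rho>\<^sup>2}"
    proof
      fix x assume "x \<in> F ` (S \<times> tors)"
      then obtain p t where p: "p \<in> S" "t \<in> tors" "x = lcomb xs (coeff (f p)) \<otimes> t" by (auto simp: F_def)
      have "q x = q (lcomb xs (coeff (f p)))" unfolding p(3) by (rule tors_q_add[OF p(2) lc])
      hence "q x / 2 = b (f p) (f p)" by (simp add: bq)
      thus "x \<in> {x \<in> carrier G. q x / 2 \<le> \<rho>\<^sup>2}" using p lc tors_carrier by (auto simp: S)
    qed
    moreover have "finite {x \<in> carrier G. q x / 2 \<le> \<rho>\<^sup>2}"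
      using finite_q_le[OF hfin, of "2 * \<rho>\<^sup>2"] by (simp add: mult.commute)
    ultimately have card: "card S * card tors \<le> card {x \<in> carrier G. q x / 2 \<le> \<rho>\<^sup>2}"
      using card_inj_on_le[OF F_inj] by (simp add: card_cartesian_product)
    have "unit_ball_vol (real r) * (\<rho> - sqrt (\<Sum>i<r. \<beta> i) / 2) ^ r \<le> real (card S) * sqrt (\<Prod>i<r. \<beta> i)"
      unfolding S_def by (rule lattice_point_count[OF \<beta>(1) _ \<rho>]) (use finS in \<open>auto simp: S_def\<close>)
    hence "real (card tors) * (unit_ball_vol (real r) * (\<rho> - sqrt (\<Sum>i<r. \<beta> i) / 2) ^ r)
        \<le> real (card tors) * (real (card S) * sqrt (\<Prod>i<r. \<beta> i))" by (rule mult_left_mono) simp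
    also have "\<dots> = real (card S * card tors) * sqrt (\<Prod>i<r. \<beta> i)" by simp
    also have "\<dots> \<le> real (card {x \<in> carrier G. q x / 2 \<le> \<rho>\<^sup>2}) * sqrt (\<Prod>i<r. \<beta> i)"
    proof (intro mult_right_mono of_nat_mono card real_sqrt_ge_zero)
      show "0 \<le> (\<Prod>i<r. \<beta> i)" using \<beta>(1) by (intro prod_nonneg) (auto simp: less_imp_le)
    qed
    finally show ?thesis .
  qed
  show thesis by (rule that[OF 1 2 3])
qed

end

section \<open>Effective lower bound\<close>

lemma basis_mod_tors_mw_group:
  assumes "elliptic_curve a4 a6"
  shows "comm_group.basis_mod_tors (mw_group a4 a6) Ps \<longleftrightarrow> mw_basis a4 a6 Ps"
    and "comm_group.tors (mw_group a4 a6) = torsion_points a4 a6"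
proof -
  interpret comm_group "mw_group a4 a6" by (rule comm_group_mw_group[OF assms])
  have C: "carrier (mw_group a4 a6) = rational_points a4 a6" by (simp add: mw_group_def)
  have T: "tors = torsion_points a4 a6" unfolding tors_def torsion_points_def C ..
  have L: "lcomb Ps n = lin_comb a4 a6 Ps n" for n unfolding lcomb_def lin_comb_def ..
  show "comm_group.basis_mod_tors (mw_group a4 a6) Ps \<longleftrightarrow> mw_basis a4 a6 Ps"
    unfolding basis_mod_tors_def mw_basis_def C T L ..
  show "tors = torsion_points a4 a6" by (rule T)
qed

lemma power_diff_bound:
  fixes x D :: real
  assumes "r \<ge> 1" "0 \<le> D" "D \<le> x" "x > 0"
  shows "x ^ r - real r * D * x ^ (r - 1) \<le> (x - D) ^ r"
proof -
  obtain n where r: "r = Suc n" using assms(1) by (cases r) auto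
  have "1 + real r * (- D / x) \<le> (1 + - D / x) ^ r"
    by (rule Bernoulli_inequality) (use assms in \<open>simp add: field_simps\<close>)
  hence "x ^ r * (1 + real r * (- D / x)) \<le> x ^ r * (1 + - D / x) ^ r"
    using assms by (intro mult_left_mono) auto
  also have "\<dots> = (x * (1 + - D / x)) ^ r" by (rule power_mult_distrib[symmetric])
  also have "x * (1 + - D / x) = x - D" using assms by (simp add: field_simps)
  finally have "x ^ r * (1 + real r * (- D / x)) \<le> (x - D) ^ r" .
  moreover have "x ^ r * (1 + real r * (- D / x)) = x ^ r - real r * D * x ^ (r - 1)"
    using assms(4) by (simp add: r field_simps)
  ultimately show ?thesis by simp
qed

text \<open>Here \<open>S\<close> stands for the square root of \<open>log D\<close>,
  \<open>k\<close> absorbs the bounded loss in heights, and \<open>d\<close> is the half diagonal of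
  the lattice box. With \<open>x = S / sqrt 12\<close> the radius \<open>\<rho> - d\<close> is at
  least \<open>x - (d + k)\<close>, which is positive by \<open>S1\<close> because
  \<open>sqrt 12 < 4\<close>. The error of order \<open>S ^ (r - 1)\<close> and the 1 from the point
  at infinity stay below \<open>\<epsilon> * S ^ r\<close> by \<open>S2\<close>.\<close>

lemma estimate_from_point_count:
  fixes c d k \<epsilon> S H :: real and r :: nat
  assumes r: "r \<ge> 1" and c: "c \<ge> 0" and \<epsilon>: "\<epsilon> > 0" and d: "d \<ge> 0" and k: "k \<ge> 0"
    and S1: "4 * (d + k + 1) \<le> S" and S2: "(c * real r * (d + k) + 1) / \<epsilon> \<le> S"
    and count: "\<And>\<rho>. d < \<rho> \<Longrightarrow> \<rho>\<^sup>2 = S\<^sup>2 / 12 - k\<^sup>2 \<Longrightarrow> c * (\<rho> - d) ^ r \<le> 1 + 2 * H"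
  shows "1 / 2 * (c / sqrt (12 ^ r) - \<epsilon>) * S ^ r \<le> H"
proof -
  define x D where "x = S / sqrt 12" and "D = d + k"
  have S: "S \<ge> 4" using S1 d k by argo
  have s12: "sqrt 12 > 0" "sqrt 12 < 4" "sqrt 12 \<ge> 1" by (auto intro: real_less_lsqrt)
  have "S * sqrt 12 \<le> S * 4" using S s12 by (intro mult_left_mono) auto
  hence "S / 4 \<le> x" unfolding x_def using s12 by (simp add: field_simps)
  hence xD: "D + 1 \<le> x" using S1 by (simp add: D_def)
  have D: "D \<ge> 0" using d k by (simp add: D_def)
  have xS: "x \<le> S" unfolding x_def using S s12 by (simp add: field_simps mult_le_cancel_left1)
  have x2: "x\<^sup>2 = S\<^sup>2 / 12" by (simp add: x_def power_divide)
  define \<rho> where "\<rho> = sqrt (x\<^sup>2 - k\<^sup>2)"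
  have kx: "k \<le> x" using xD d by (simp add: D_def)
  have "k * k \<le> x * k" using kx k by (intro mult_right_mono) auto
  hence "(x - k)\<^sup>2 \<le> x\<^sup>2 - k\<^sup>2" by (simp add: power2_eq_square algebra_simps)
  hence \<rho>: "x - k \<le> \<rho>" unfolding \<rho>_def by (rule real_le_rsqrt)
  have "k\<^sup>2 \<le> x\<^sup>2" using kx k by (intro power_mono) auto
  hence \<rho>2: "\<rho>\<^sup>2 = S\<^sup>2 / 12 - k\<^sup>2" by (simp add: \<rho>_def x2)
  have d\<rho>: "d < \<rho>" using \<rho> xD by (simp add: D_def)
  have "x ^ r - real r * D * S ^ (r - 1) \<le> x ^ r - real r * D * x ^ (r - 1)"
    using D xD xS by (intro diff_left_mono mult_left_mono power_mono) auto
  also have "\<dots> \<le> (x - D) ^ r" by (rule power_diff_bound[OF r D]) (use xD D in auto)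
  also have "\<dots> \<le> (\<rho> - d) ^ r" using \<rho> xD by (intro power_mono) (auto simp: D_def)
  finally have "c * (x ^ r - real r * D * S ^ (r - 1)) \<le> 1 + 2 * H"
    using mult_left_mono[OF _ c] count[OF d\<rho> \<rho>2] by (meson order.trans)
  hence 1: "c * x ^ r \<le> 1 + 2 * H + c * real r * D * S ^ (r - 1)" by (simp add: algebra_simps)
  have "1 \<le> S ^ (r - 1)" using S by simp
  hence "c * real r * D * S ^ (r - 1) + 1 \<le> (c * real r * D + 1) * S ^ (r - 1)"
    by (simp add: algebra_simps)
  also have "\<dots> \<le> (\<epsilon> * S) * S ^ (r - 1)"
    using S2 \<epsilon> S by (intro mult_right_mono) (auto simp: D_def field_simps)
  also have "\<dots> = \<epsilon> * S ^ r" using r by (cases r) auto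
  finally have 2: "c * real r * D * S ^ (r - 1) + 1 \<le> \<epsilon> * S ^ r" .
  have "c / sqrt (12 ^ r) * S ^ r = c * x ^ r"
    by (simp add: x_def power_divide real_sqrt_power)
  hence "(c / sqrt (12 ^ r) - \<epsilon>) * S ^ r \<le> 2 * H"
    using 1 2 by (simp add: left_diff_distrib)
  thus ?thesis by simp
qed

text \<open>\<open>\<kappa>\<close> bounds the number of points with \<open>q \<le> 1\<close>, in
  particular the torsion, and \<open>\<nu>\<close> bounds all squared Gram-Schmidt lengths from
  below. The hypothesis \<open>\<epsilon> < c_const a4 a6 r\<close> bounds the regulator from above;
  dividing it by the lower bounds for the other factors bounds each squared length from above, and
  hence \<open>d\<close>.\<close>

lemma elliptic_point_count:
  fixes X r :: nat and a4 a6 :: int and \<epsilon> :: real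
  defines "\<kappa> \<equiv> real (1 + 2 * (2 * X + 1) * X)"
  defines "\<nu> \<equiv> (3 / 4) ^ r / (2 * \<kappa>\<^sup>2)"
  assumes E: "elliptic_curve a4 a6" and rank: "has_rank a4 a6 r"
    and X: "exp (height_const a4 a6 + 1) \<le> real X" and \<epsilon>: "\<epsilon> > 0" "\<epsilon> < c_const a4 a6 r"
  obtains d where "0 \<le> d" "d \<le> real r * \<kappa> * 2 ^ r / (\<epsilon> * \<nu> ^ r)" "c_const a4 a6 r \<le> \<kappa> * 2 ^ r / \<nu> ^ r"
    "\<forall>\<rho>>d. c_const a4 a6 r * (\<rho> - d) ^ r
      \<le> real (card {P \<in> rational_points a4 a6. weil_height P \<le> 2 * \<rho>\<^sup>2 + height_const a4 a6})"
proof -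
  define G K where "G = mw_group a4 a6" and "K = height_const a4 a6"
  interpret height_group G weil_height K
    unfolding G_def K_def by (rule height_group_mw_group[OF E])
  have C: "carrier G = rational_points a4 a6" by (simp add: G_def mw_group_def)
  have T: "tors = torsion_points a4 a6"
    using basis_mod_tors_mw_group(2)[OF E] by (simp add: G_def)
  have bas: "basis_mod_tors Ps \<longleftrightarrow> mw_basis a4 a6 Ps" for Ps
    using basis_mod_tors_mw_group(1)[OF E] by (simp add: G_def)
  define Ps where "Ps = (SOME Ps. mw_basis a4 a6 Ps)"
  obtain Qs where Qs: "mw_basis a4 a6 Qs" "length Qs = r" using rank by (auto simp: has_rank_def)
  have Ps: "basis_mod_tors Ps" unfolding bas Ps_def by (rule someI[of _ Qs]) (rule Qs)
  \<comment> \<open>\<open>regulator\<close> picks a basis of its own, while \<open>r\<close> is the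
    length of another one; invariance of the rank makes them agree.\<close>
  have len: "length Ps = r" using basis_length_unique[OF Ps] Qs bas by simp
  have can: "canonical_height a4 a6 P = q P / 2" if "P \<in> carrier G" for P
    using limI[OF h_pow_limit[OF that]] by (simp add: canonical_height_def G_def)
  have pair: "height_pairing a4 a6 P Q = B P Q / 2" if "P \<in> carrier G" "Q \<in> carrier G" for P Q
  proof -
    have PQ: "P \<otimes>\<^bsub>G\<^esub> Q \<in> carrier G" using that by simp
    show ?thesis
      unfolding height_pairing_def B_def G_def[symmetric] can[OF that(1)] can[OF that(2)] can[OF PQ]
      by simp
  qed
  have Pc: "Ps ! i \<in> carrier G" if "i < r" for i
    using Ps that len nth_mem unfolding basis_mod_tors_def by blast
  have height_le: "pt_height P \<le> int n \<longleftrightarrow> weil_height P \<le> ln (real n)" if "n > 0" for P n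
  proof -
    have "weil_height P \<le> ln (real n) \<longleftrightarrow> real_of_int (pt_height P) \<le> real n"
      unfolding weil_height_eq using pt_height_ge_1[of P] that by (intro ln_le_cancel_iff) auto
    thus ?thesis by linarith
  qed
  have hfin: "finite {P \<in> carrier G. weil_height P \<le> T}" for T
  proof (rule finite_subset[OF _ northcott(1)[of a4 a6 "nat \<lceil>exp T\<rceil>"]])
    show "{P \<in> carrier G. weil_height P \<le> T} \<subseteq> {P \<in> rational_points a4 a6. pt_height P \<le> int (nat \<lceil>exp T\<rceil>)}"
    proof safe
      fix P assume P: "P \<in> carrier G" "weil_height P \<le> T"
      have n: "nat \<lceil>exp T\<rceil> > 0" by simp
      have "T \<le> ln (real (nat \<lceil>exp T\<rceil>))"
        by (subst ln_ge_iff) (use n in \<open>auto simp: real_nat_ceiling_ge\<close>)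
      thus "pt_height P \<le> int (nat \<lceil>exp T\<rceil>)" using P by (simp only: height_le[OF n])
    qed (auto simp: C)
  qed
  have X0: "X > 0" using X by (metis exp_gt_zero not_le of_nat_0_less_iff order_less_le_trans)
  \<comment> \<open>The logarithmic height differs from \<open>q\<close> by at most
    \<open>K\<close>, so points with \<open>q \<le> 1\<close> have naive height at most
    \<open>X\<close>.\<close>
  have KX: "K + 1 \<le> ln (real X)"
    using X X0 by (subst ln_ge_iff) (auto simp: K_def)
  have sub1: "{P \<in> carrier G. q P \<le> 1} \<subseteq> {P \<in> rational_points a4 a6. pt_height P \<le> int X}"
  proof safe
    fix P assume P: "P \<in> carrier G" "q P \<le> 1"
    hence "weil_height P \<le> K + 1" using q_diff_h[OF P(1)] by (simp add: abs_le_iff)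
    thus "pt_height P \<le> int X" using KX by (simp add: height_le[OF X0])
  qed (auto simp: C)
  have fin1: "finite {P \<in> carrier G. q P \<le> 1}" by (rule finite_q_le[OF hfin])
  have card1: "card {P \<in> carrier G. q P \<le> 1} \<le> 1 + 2 * (2 * X + 1) * X"
    using card_mono[OF northcott(1) sub1] northcott(2)[of a4 a6 X] by linarith
  have \<kappa>1: "\<kappa> \<ge> 1" unfolding \<kappa>_def by simp
  define \<mu> where "\<mu> = 1 / (2 * \<kappa>\<^sup>2)"
  have \<mu>: "\<mu> > 0" using \<kappa>1 by (simp add: \<mu>_def)
  have low: "\<mu> \<le> q P / 2" if "P \<in> carrier G" "P \<notin> tors" for P
  proof -
    have "P [^]\<^bsub>G\<^esub> n \<noteq> \<one>\<^bsub>G\<^esub>" if "n > 0" for n :: nat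
      using \<open>P \<in> carrier G\<close> \<open>P \<notin> tors\<close> that unfolding tors_def by blast
    hence "1 / (real (1 + 2 * (2 * X + 1) * X))\<^sup>2 \<le> q P"
      by (intro q_lower_bound[OF fin1 card1 weil_height_nonneg that(1)])
    thus ?thesis by (simp add: \<mu>_def \<kappa>_def)
  qed
  obtain \<beta> :: "nat \<Rightarrow> real" where \<beta>: "\<And>i. i < r \<Longrightarrow> (3 / 4) ^ r * \<mu> \<le> \<beta> i"
    and det: "Determinant.det (mat r r (\<lambda>(i, j). B (Ps ! i) (Ps ! j) / 2)) = (\<Prod>i<r. \<beta> i)"
    and count: "\<And>\<rho>. sqrt (\<Sum>i<r. \<beta> i) / 2 < \<rho> \<Longrightarrow>
       real (card tors) * (unit_ball_vol (real r) * (\<rho> - sqrt (\<Sum>i<r. \<beta> i) / 2) ^ r)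
       \<le> real (card {x \<in> carrier G. q x / 2 \<le> \<rho>\<^sup>2}) * sqrt (\<Prod>i<r. \<beta> i)"
    using point_count[OF Ps hfin low \<mu>] unfolding len by blast
  define R where "R = (\<Prod>i<r. \<beta> i)"
  have \<nu>\<mu>: "\<nu> = (3 / 4) ^ r * \<mu>" by (simp add: \<nu>_def \<mu>_def)
  have \<nu>0: "\<nu> > 0" unfolding \<nu>\<mu> using \<mu> by simp
  have \<nu>1: "\<nu> \<le> 1"
  proof -
    have "(3 / 4 :: real) ^ r \<le> 1" by (rule power_le_one) auto
    moreover have "1 \<le> 2 * \<kappa>\<^sup>2" using \<kappa>1 one_le_power[of \<kappa> 2] by linarith
    ultimately show ?thesis unfolding \<nu>_def using \<kappa>1 by (simp add: divide_le_eq)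
  qed
  have \<beta>\<nu>: "\<nu> \<le> \<beta> i" if "i < r" for i using \<beta>[OF that] by (simp add: \<nu>\<mu>)
  have \<beta>0: "0 < \<beta> i" if "i < r" for i using \<beta>\<nu>[OF that] \<nu>0 by linarith
  have prod_low: "\<nu> ^ card A \<le> (\<Prod>i\<in>A. \<beta> i)" if "A \<subseteq> {..<r}" for A
  proof -
    have "(\<Prod>i\<in>A. \<nu>) \<le> (\<Prod>i\<in>A. \<beta> i)" using that \<beta>\<nu> \<nu>0 by (intro prod_mono) (auto simp: less_imp_le)
    thus ?thesis by simp
  qed
  have R\<nu>: "\<nu> ^ r \<le> R" unfolding R_def using prod_low[of "{..<r}"] by simp
  have \<nu>r: "\<nu> ^ r > 0" "\<nu> ^ r \<le> 1" using \<nu>0 \<nu>1 by (auto intro: power_le_one)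
  have R0: "R > 0" using R\<nu> \<nu>r by linarith
  have reg: "regulator a4 a6 = R"
  proof -
    have "mat r r (\<lambda>(i, j). height_pairing a4 a6 (Ps ! i) (Ps ! j))
        = mat r r (\<lambda>(i, j). B (Ps ! i) (Ps ! j) / 2)"
      by (rule eq_matI) (auto simp: pair Pc)
    thus ?thesis unfolding regulator_def regulator_of_def Ps_def[symmetric] len
      using det R0 by (simp add: R_def)
  qed
  define \<tau> where "\<tau> = real (card tors)"
  have tsub: "tors \<subseteq> {P \<in> carrier G. q P \<le> 1}" using tors_q_zero tors_carrier by auto
  have \<tau>: "0 \<le> \<tau>" "\<tau> \<le> \<kappa>"
    unfolding \<tau>_def \<kappa>_def
    by (rule of_nat_0_le_iff, rule of_nat_mono[OF order.trans[OF card_mono[OF fin1 tsub] card1]])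
  have Om: "Omega r = unit_ball_vol (real r)" by (simp add: Omega_def unit_ball_vol_def)
  have Om0: "0 \<le> Omega r" "Omega r \<le> 2 ^ r" unfolding Om using unit_ball_vol_le by auto
  define c where "c = c_const a4 a6 r"
  have c: "c = \<tau> / sqrt R * Omega r" by (simp add: c_def c_const_def \<tau>_def T reg)
  have \<tau>Om: "\<tau> * Omega r \<le> \<kappa> * 2 ^ r" using \<tau> Om0 \<kappa>1 by (intro mult_mono) auto
  have sq: "\<nu> ^ r \<le> sqrt R"
  proof (rule real_le_rsqrt)
    have "(\<nu> ^ r)\<^sup>2 \<le> \<nu> ^ r * 1" unfolding power2_eq_square using \<nu>r by (intro mult_left_mono) auto
    thus "(\<nu> ^ r)\<^sup>2 \<le> R" using R\<nu> by simp
  qed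
  define d where "d = sqrt (\<Sum>i<r. \<beta> i) / 2"
  have sum0: "0 \<le> (\<Sum>i<r. \<beta> i)" using \<beta>0 by (intro sum_nonneg) (auto simp: less_imp_le)
  have 1: "0 \<le> d" using sum0 by (simp add: d_def)
  have 3: "c \<le> \<kappa> * 2 ^ r / \<nu> ^ r"
  proof -
    have "c = \<tau> * Omega r / sqrt R" by (simp add: c)
    also have "\<dots> \<le> \<kappa> * 2 ^ r / \<nu> ^ r" using \<tau>Om sq \<nu>r \<tau> Om0 \<kappa>1 by (intro frac_le) auto
    finally show ?thesis .
  qed
  have 2: "d \<le> real r * \<kappa> * 2 ^ r / (\<epsilon> * \<nu> ^ r)"
  proof -
    have "\<epsilon> * sqrt R < \<tau> * Omega r"
      using \<epsilon>(2) R0 unfolding c_def[symmetric] c by (simp add: field_simps)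
    hence sR: "sqrt R \<le> \<kappa> * 2 ^ r / \<epsilon>" using \<tau>Om \<epsilon>(1) by (simp add: field_simps)
    have \<beta>_up: "\<beta> i \<le> R / \<nu> ^ r" if "i < r" for i
    proof -
      have "R = \<beta> i * (\<Prod>j\<in>{..<r} - {i}. \<beta> j)" unfolding R_def using that by (intro prod.remove) auto
      moreover have "\<nu> ^ r \<le> \<nu> ^ card ({..<r} - {i})"
        using \<nu>0 \<nu>1 by (intro power_decreasing) (auto simp: card_Diff_subset_Int)
      hence "\<nu> ^ r \<le> (\<Prod>j\<in>{..<r} - {i}. \<beta> j)" using prod_low[of "{..<r} - {i}"] by force
      ultimately have "\<beta> i * \<nu> ^ r \<le> R" using \<beta>0[OF that] by (simp add: mult_left_mono)
      thus ?thesis using \<nu>r by (simp add: field_simps)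
    qed
    have "(\<Sum>i<r. \<beta> i) \<le> real r * (R / \<nu> ^ r)"
      using sum_bounded_above[of "{..<r}" \<beta> "R / \<nu> ^ r"] \<beta>_up by simp
    also have "\<dots> \<le> (real r)\<^sup>2 * (R / (\<nu> ^ r)\<^sup>2)"
    proof (intro mult_mono)
      show "real r \<le> (real r)\<^sup>2" by (cases r) (auto simp: power2_eq_square algebra_simps)
      have "(\<nu> ^ r)\<^sup>2 \<le> \<nu> ^ r * 1" unfolding power2_eq_square using \<nu>r by (intro mult_left_mono) auto
      thus "R / \<nu> ^ r \<le> R / (\<nu> ^ r)\<^sup>2" using R0 \<nu>0
        by (intro divide_left_mono mult_pos_pos zero_less_power) auto
    qed (use R0 \<nu>r in auto)
    also have "\<dots> = (real r * sqrt R / \<nu> ^ r)\<^sup>2"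
      using R0 by (simp add: power_divide power_mult_distrib)
    finally have "(\<Sum>i<r. \<beta> i) \<le> (real r * sqrt R / \<nu> ^ r)\<^sup>2" .
    moreover have "0 \<le> real r * sqrt R / \<nu> ^ r" using \<nu>r R0 by simp
    ultimately have "sqrt (\<Sum>i<r. \<beta> i) \<le> real r * sqrt R / \<nu> ^ r"
      by (intro real_le_lsqrt)
    moreover have "d \<le> sqrt (\<Sum>i<r. \<beta> i)" using real_sqrt_ge_zero[OF sum0] by (simp add: d_def)
    ultimately have "d \<le> real r * sqrt R / \<nu> ^ r" by linarith
    also have "\<dots> \<le> real r * (\<kappa> * 2 ^ r / \<epsilon>) / \<nu> ^ r"
      using sR \<nu>r by (intro divide_right_mono mult_left_mono) auto
    finally show ?thesis by (simp add: field_simps)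
  qed
  have "c * (\<rho> - d) ^ r \<le> real (card {P \<in> rational_points a4 a6. weil_height P \<le> 2 * \<rho>\<^sup>2 + K})"
    if "d < \<rho>" for \<rho>
  proof -
    have "\<tau> * (Omega r * (\<rho> - d) ^ r) \<le> real (card {x \<in> carrier G. q x / 2 \<le> \<rho>\<^sup>2}) * sqrt R"
      using count[of \<rho>] that unfolding d_def \<tau>_def Om R_def by simp
    hence "c * (\<rho> - d) ^ r \<le> real (card {x \<in> carrier G. q x / 2 \<le> \<rho>\<^sup>2})"
      unfolding c using R0 by (simp add: field_simps)
    also have "\<dots> \<le> real (card {P \<in> rational_points a4 a6. weil_height P \<le> 2 * \<rho>\<^sup>2 + K})"
    proof (intro of_nat_mono card_mono)
      show "finite {P \<in> rational_points a4 a6. weil_height P \<le> 2 * \<rho>\<^sup>2 + K}"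
        using hfin by (simp add: C)
      show "{x \<in> carrier G. q x / 2 \<le> \<rho>\<^sup>2} \<subseteq> {P \<in> rational_points a4 a6. weil_height P \<le> 2 * \<rho>\<^sup>2 + K}"
      proof safe
        fix P assume P: "P \<in> carrier G" "q P / 2 \<le> \<rho>\<^sup>2"
        thus "weil_height P \<le> 2 * \<rho>\<^sup>2 + K" using q_diff_h[OF P(1)] by (simp add: abs_le_iff)
      qed (simp add: C)
    qed
    finally show ?thesis .
  qed
  hence 4: "\<forall>\<rho>>d. c * (\<rho> - d) ^ r \<le> real (card {P \<in> rational_points a4 a6. weil_height P \<le> 2 * \<rho>\<^sup>2 + K})"
    by blast
  show thesis by (rule that[OF 1 2 3[unfolded c_def] 4[unfolded c_def K_def]])
qed

section \<open>Explicit numerical bounds\<close>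

lemma two_power_mult_bound:
  fixes x y :: real
  assumes "0 \<le> x" "x \<le> 2 ^ a" "0 \<le> y" "y \<le> 2 ^ b"
  shows "x * y \<le> 2 ^ (a + b)"
  unfolding power_add using assms by (intro mult_mono) auto

lemma nat_le_two_power: "real n \<le> 2 ^ n"
  by (metis less_exp less_imp_le of_nat_le_iff of_nat_numeral of_nat_power)

text \<open>The estimate needs \<open>2 ^ (594 * s ^ 2) \<le> S\<close> for the square root
  \<open>S\<close> of \<open>log D\<close>, with 594 from \<open>constants_bound\<close>. Squaring
  gives 1188, and passing from \<open>log D\<close> to \<open>D\<close> through
  \<open>exp 1 \<le> 2 ^ 2\<close> adds the 1.\<close>

lemma tower_bound:
  assumes "s \<ge> 1"
  shows "2 ^ (2 ^ (1188 * s ^ 2 + 1)) \<le> tower 6 s"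
proof -
  have four: "2 * s + 11 \<le> 2 ^ (2 * s + 2)"
    using assms
  proof (induction s rule: dec_induct)
    case (step n)
    have "2 * Suc n + 11 \<le> 4 * (2 * n + 11)" by simp
    also have "\<dots> \<le> 4 * 2 ^ (2 * n + 2)" using step.IH by (rule mult_le_mono2)
    also have "\<dots> = 2 ^ (2 * Suc n + 2)" by simp
    finally show ?case .
  qed simp
  have "s + 1 \<le> 2 ^ s" by (metis Suc_eq_plus1 Suc_leI less_exp)
  hence "2 * s + 2 \<le> 2 ^ (s + 1)" by simp
  also have "\<dots> \<le> 2 ^ (2 ^ s)" using \<open>s + 1 \<le> 2 ^ s\<close> by (intro power_increasing) auto
  finally have t2: "2 * s + 2 \<le> tower 2 s" by (simp add: numeral_2_eq_2)
  have "2 * s + 11 \<le> 2 ^ (2 * s + 2)" by (rule four)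
  also have "\<dots> \<le> 2 ^ tower 2 s" using t2 by (intro power_increasing) auto
  finally have t3: "2 * s + 11 \<le> tower 3 s" by (simp add: eval_nat_numeral)
  have "s ^ 2 \<le> (2 ^ s) ^ 2" by (intro power_mono) (auto simp: less_imp_le)
  also have "\<dots> = 2 ^ (2 * s)" by (simp add: power_mult[symmetric] mult.commute)
  finally have "1189 * s ^ 2 \<le> 2 ^ 11 * 2 ^ (2 * s)" by (intro mult_le_mono) auto
  moreover have "1 \<le> s ^ 2" using assms by simp
  ultimately have "1188 * s ^ 2 + 1 \<le> 2 ^ (2 * s + 11)" by (simp add: power_add)
  also have "\<dots> \<le> 2 ^ tower 3 s" using t3 by (intro power_increasing) auto
  finally have t4: "1188 * s ^ 2 + 1 \<le> tower 4 s" by (simp add: eval_nat_numeral)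
  hence "(2::nat) ^ (1188 * s ^ 2 + 1) \<le> 2 ^ tower 4 s" by (intro power_increasing) auto
  hence "(2::nat) ^ (2 ^ (1188 * s ^ 2 + 1)) \<le> 2 ^ (2 ^ tower 4 s)" by (rule power_increasing) simp
  also have "\<dots> = tower 6 s" by (simp add: eval_nat_numeral)
  finally show ?thesis .
qed

text \<open>The basic quantities are at most powers of 2 with exponents linear in \<open>s\<close>;
  the \<open>r\<close>-th power of \<open>1 / \<nu>\<close> raises the order to
  \<open>s ^ 2\<close>. In \<open>X\<close> the factor 1470000 is \<open>3 * 700 ^ 2\<close>, where
  3 bounds \<open>exp 1\<close>, and \<open>3 * s\<close> bounds
  \<open>1 + \<bar>a4\<bar> + \<bar>a6\<bar>\<close>; thus \<open>X\<close> is at least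
  \<open>exp (K + 1)\<close> for the height constant \<open>K\<close>.\<close>

lemma constants_bound:
  fixes s r X :: nat and c d k \<epsilon> :: real
  defines "\<kappa> \<equiv> real (1 + 2 * (2 * X + 1) * X)"
  defines "\<nu> \<equiv> (3 / 4) ^ r / (2 * \<kappa>\<^sup>2)"
  assumes s: "s \<ge> 1" and r: "r \<le> s" and X: "X = 1470000 * (3 * s) ^ 10"
    and \<epsilon>: "\<epsilon> > 0" "1 / \<epsilon> \<le> real s"
    and c: "0 \<le> c" "c \<le> \<kappa> * 2 ^ r / \<nu> ^ r"
    and d: "0 \<le> d" "d \<le> real r * \<kappa> * 2 ^ r / (\<epsilon> * \<nu> ^ r)"
    and k: "0 \<le> k" "k \<le> real X"
  shows "4 * (d + k + 1) \<le> 2 ^ (594 * s ^ 2)" "(c * real r * (d + k) + 1) / \<epsilon> \<le> 2 ^ (594 * s ^ 2)"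
proof -
  have s2: "s \<le> s ^ 2" "1 \<le> s ^ 2" using s by (auto simp: power2_eq_square)
  have up: "x \<le> 2 ^ b" if "x \<le> 2 ^ a" "a \<le> b" for x :: real and a b :: nat
    by (rule order.trans[OF that(1) power_increasing[OF that(2)]]) simp
  have S: "real s \<le> 2 ^ s" by (rule nat_le_two_power)
  \<comment> \<open>The constant is \<open>1470000 * 3 ^ 10\<close>, which is less than
    \<open>2 ^ 37\<close>.\<close>
  have "real X = 86802030000 * real s ^ 10" by (simp add: X power_mult_distrib)
  also have "\<dots> \<le> 2 ^ 37 * (2 ^ s) ^ 10"
    using S by (intro mult_mono power_mono) auto
  also have "\<dots> = 2 ^ (37 + 10 * s)" by (simp add: power_add power_mult[symmetric] mult.commute)
  finally have X1: "real X \<le> 2 ^ (37 + 10 * s)" .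
  hence X2: "real X \<le> 2 ^ (47 * s)" by (rule up) (use s in simp)
  have "1 \<le> X" using X s by simp
  hence "X \<le> X * X" "1 \<le> X * X" by auto
  moreover have "1 + 2 * (2 * X + 1) * X = 1 + 2 * X + 4 * (X * X)" by (simp add: algebra_simps)
  ultimately have "1 + 2 * (2 * X + 1) * X \<le> 7 * (X * X)" by linarith
  hence "\<kappa> \<le> real (7 * (X * X))" unfolding \<kappa>_def by (rule of_nat_mono)
  also have "\<dots> \<le> 2 ^ 3 * (2 ^ (47 * s) * 2 ^ (47 * s))"
    using X2 by (simp only: of_nat_mult, intro mult_mono) auto
  also have "\<dots> = 2 ^ (3 + (47 * s + 47 * s))" by (simp only: power_add)
  finally have "\<kappa> \<le> 2 ^ (3 + (47 * s + 47 * s))" .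
  hence \<kappa>: "\<kappa> \<le> 2 ^ (97 * s)" by (rule up) (use s in simp)
  have \<kappa>1: "1 \<le> \<kappa>" by (simp add: \<kappa>_def)
  have \<nu>0: "\<nu> > 0" using \<kappa>1 by (simp add: \<nu>_def)
  have "1 / \<nu> = (4 / 3) ^ r * (2 * \<kappa>\<^sup>2)" by (simp add: \<nu>_def power_divide)
  also have "\<dots> \<le> 2 ^ r * (2 ^ 1 * (2 ^ (97 * s))\<^sup>2)"
    using \<kappa> \<kappa>1 by (intro mult_mono power_mono) auto
  also have "\<dots> = 2 ^ (r + (1 + 97 * s * 2))" by (simp only: power_add power_mult)
  finally have "1 / \<nu> \<le> 2 ^ (r + (1 + 97 * s * 2))" .
  hence "1 / \<nu> \<le> 2 ^ (196 * s)" by (rule up) (use s r in simp)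
  hence "(1 / \<nu>) ^ r \<le> (2 ^ (196 * s)) ^ r" using \<nu>0 by (intro power_mono) auto
  also have "\<dots> = 2 ^ (196 * s * r)" by (simp add: power_mult)
  finally have "(1 / \<nu>) ^ r \<le> 2 ^ (196 * s * r)" .
  hence \<nu>: "(1 / \<nu>) ^ r \<le> 2 ^ (196 * s ^ 2)" by (rule up) (use r in \<open>simp add: power2_eq_square\<close>)
  have \<nu>r: "0 \<le> (1 / \<nu>) ^ r" using \<nu>0 by simp
  have tr: "(2::real) ^ r \<le> 2 ^ s" using r by (intro power_increasing) auto
  have e: "1 / \<epsilon> \<le> 2 ^ s" "0 \<le> 1 / \<epsilon>" using \<epsilon> order.trans[OF \<epsilon>(2) S] by auto
  have rs: "real r \<le> 2 ^ s" using r S by linarith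
  have "c \<le> \<kappa> * (2 ^ r * (1 / \<nu>) ^ r)" using c(2) by (simp add: power_divide)
  also have "\<dots> \<le> 2 ^ (97 * s + (s + 196 * s ^ 2))"
    using \<kappa> \<kappa>1 tr \<nu> \<nu>r by (intro two_power_mult_bound mult_nonneg_nonneg) auto
  finally have c': "c \<le> 2 ^ (294 * s ^ 2)" by (rule up) (use s2 in simp)
  have "d \<le> real r * (\<kappa> * (2 ^ r * ((1 / \<epsilon>) * (1 / \<nu>) ^ r)))" using d(2) by (simp add: power_divide)
  also have "\<dots> \<le> 2 ^ (s + (97 * s + (s + (s + 196 * s ^ 2))))"
    using \<kappa> \<kappa>1 tr \<nu> \<nu>r rs e by (intro two_power_mult_bound mult_nonneg_nonneg) auto
  finally have d': "d \<le> 2 ^ (296 * s ^ 2)" by (rule up) (use s2 in simp)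
  have "k \<le> 2 ^ (47 * s)" using k X2 by linarith
  hence k': "k \<le> 2 ^ (296 * s ^ 2)" by (rule up) (use s2 in simp)
  have "d + k \<le> 2 ^ (296 * s ^ 2 + 1)" using d' k' by (simp add: power_add)
  hence D: "d + k \<le> 2 ^ (297 * s ^ 2)" by (rule up) (use s2 in simp)
  have one: "1 \<le> (2::real) ^ n" for n by simp
  have "4 * (d + k + 1) \<le> 8 * 2 ^ (297 * s ^ 2)" using D one[of "297 * s ^ 2"] by argo
  hence "4 * (d + k + 1) \<le> 2 ^ (297 * s ^ 2 + 3)" by (simp add: power_add)
  thus "4 * (d + k + 1) \<le> 2 ^ (594 * s ^ 2)" by (rule up) (use s2 in simp)
  have dk: "0 \<le> d + k" using d k by simp
  have "c * (real r * (d + k)) \<le> 2 ^ (294 * s ^ 2 + (s + 297 * s ^ 2))"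
    using c(1) c' rs D dk by (intro two_power_mult_bound mult_nonneg_nonneg) auto
  hence "c * (real r * (d + k)) \<le> 2 ^ (592 * s ^ 2)" by (rule up) (use s2 in simp)
  hence "c * (real r * (d + k)) + 1 \<le> 2 * 2 ^ (592 * s ^ 2)"
    using one[of "592 * s ^ 2"] by argo
  hence "c * real r * (d + k) + 1 \<le> 2 ^ (592 * s ^ 2 + 1)" by (simp add: mult.assoc power_add)
  moreover have "0 \<le> c * real r * (d + k) + 1" using c dk by simp
  ultimately have "(c * real r * (d + k) + 1) * (1 / \<epsilon>) \<le> 2 ^ (592 * s ^ 2 + 1 + s)"
    using e by (intro two_power_mult_bound)
  hence "(c * real r * (d + k) + 1) * (1 / \<epsilon>) \<le> 2 ^ (594 * s ^ 2)" by (rule up) (use s2 in simp)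
  thus "(c * real r * (d + k) + 1) / \<epsilon> \<le> 2 ^ (594 * s ^ 2)" by simp
qed

text \<open>If \<open>t < 3 + 8 s\<close>, then \<open>t \<le> 11 s\<close> and \<open>D_E\<close>
  is at most \<open>4 (11^3 + 11 + 1) s^3 = 5372 s^3\<close>; for \<open>t\<close> below
  \<open>- s\<close> the terms with \<open>t\<close> are not even positive. The bound on
  \<open>t\<close> is the one that places \<open>D_E\<close> between \<open>t (1 + t)^2\<close> and
  \<open>8 t^3\<close> in \<open>class_number_estimate\<close>.\<close>

lemma large_discriminant:
  fixes t a4 a6 :: int and s :: nat
  assumes s: "s \<ge> 1" and a: "\<bar>a4\<bar> \<le> int s" "\<bar>a6\<bar> \<le> int s" and D: "D_E a4 a6 t > 5372 * int s ^ 3"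
  shows "t \<ge> 3 + 8 * int s"
proof (rule ccontr)
  define S where "S = int s"
  have S: "S \<ge> 1" using s by (simp add: S_def)
  assume "\<not> ?thesis"
  hence t: "t \<le> 11 * S" using S by (simp add: S_def)
  have aS: "\<bar>a4\<bar> \<le> S" "\<bar>a6\<bar> \<le> S" using a by (auto simp: S_def)
  have S3: "S \<le> S ^ 3" "S ^ 2 \<le> S ^ 3" using S power_increasing[of 1 3 S] power_increasing[of 2 3 S] by auto
  have "t ^ 3 + a4 * t \<le> 1342 * S ^ 3"
  proof (cases "- S \<le> t")
    case True
    have "\<bar>t\<bar> \<le> 11 * S" using True t S by simp
    hence "\<bar>t ^ 3\<bar> \<le> (11 * S) ^ 3" "\<bar>a4 * t\<bar> \<le> S * (11 * S)"
      by (rule abs_power_bound, rule abs_mult_bound[OF aS(1)])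
    moreover have "(11 * S) ^ 3 = 1331 * S ^ 3" by (simp add: power_mult_distrib)
    moreover have "S * (11 * S) = 11 * S ^ 2" by (simp add: power2_eq_square)
    ultimately show ?thesis using S3 by linarith
  next
    case False
    have "S * 1 \<le> S * S" using S by (intro mult_left_mono) auto
    moreover have "S ^ 2 \<le> (- t) ^ 2" using False S by (intro power_mono) auto
    ultimately have "0 \<le> t ^ 2 + a4" using aS by (simp add: power2_eq_square)
    hence "(t ^ 2 + a4) * t \<le> 0" using False S by (intro mult_nonneg_nonpos) auto
    hence "t ^ 3 + a4 * t \<le> 0" by (simp add: power2_eq_square power3_eq_cube algebra_simps)
    thus ?thesis using S S3 by linarith
  qed
  moreover have "- a6 \<le> S" using aS by linarith
  ultimately have "D_E a4 a6 t \<le> 5372 * S ^ 3"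
    unfolding D_E_def right_diff_distrib distrib_left using S3(1) by linarith
  thus False using D by (simp add: S_def)
qed

text \<open>The number \<open>s\<close> measures the whole input: both coefficients, the rank and
  \<open>1 / \<epsilon>\<close>. With \<open>Y\<close> the integer part of
  \<open>sqrt t / 2\<close>, the points of height at most \<open>Y\<close> are bounded above by
  \<open>class_number_lower_bound\<close> and below by \<open>elliptic_point_count\<close>.\<close>

lemma class_number_estimate:
  fixes a4 a6 t :: int and s r :: nat and \<epsilon> :: real
  assumes E: "elliptic_curve a4 a6" and rank: "has_rank a4 a6 r" and r: "r \<ge> 1" "r \<le> s" and s: "s \<ge> 1"
    and a: "\<bar>a4\<bar> \<le> int s" "\<bar>a6\<bar> \<le> int s" and \<epsilon>: "\<epsilon> > 0" "1 / \<epsilon> \<le> real s"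
    and fund: "fundamental_discriminant (- D_E a4 a6 t)" and D: "D_E a4 a6 t > int (tower 6 s)"
  shows "1 / 2 * (c_const a4 a6 r / sqrt (12 ^ r) - \<epsilon>) * ln (real_of_int (D_E a4 a6 t)) powr (real r / 2)
    \<le> real (class_number (- D_E a4 a6 t))"
proof (cases "c_const a4 a6 r \<le> \<epsilon>")
  case True
  have "c_const a4 a6 r / sqrt (12 ^ r) \<le> \<epsilon>"
  proof (cases "c_const a4 a6 r \<le> 0")
    case True
    hence "c_const a4 a6 r / sqrt (12 ^ r) \<le> 0" by (simp add: divide_le_0_iff)
    thus ?thesis using \<epsilon> by linarith
  next
    case False
    have "1 \<le> sqrt (12 ^ r)" by simp
    hence "c_const a4 a6 r / sqrt (12 ^ r) \<le> c_const a4 a6 r / 1"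
      using False by (intro divide_left_mono) auto
    thus ?thesis using True by simp
  qed
  hence "1 / 2 * (c_const a4 a6 r / sqrt (12 ^ r) - \<epsilon>) \<le> 0" by simp
  hence "1 / 2 * (c_const a4 a6 r / sqrt (12 ^ r) - \<epsilon>) * ln (real_of_int (D_E a4 a6 t)) powr (real r / 2) \<le> 0"
    by (rule mult_nonpos_nonneg) simp
  thus ?thesis using of_nat_0_le_iff[of "class_number (- D_E a4 a6 t)"] by linarith
next
  case False
  define c K where "c = c_const a4 a6 r" and "K = height_const a4 a6"
  define X where "X = 1470000 * (3 * s) ^ 10"
  define \<Delta> where "\<Delta> = D_E a4 a6 t"
  define H where "H = real (class_number (- \<Delta>))"
  define m where "m = 1 + \<bar>real_of_int a4\<bar> + \<bar>real_of_int a6\<bar>"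
  have m: "1 \<le> m" "m \<le> 3 * real s"
  proof -
    have "\<bar>real_of_int a4\<bar> \<le> real s" "\<bar>real_of_int a6\<bar> \<le> real s" using a by linarith+
    thus "1 \<le> m" "m \<le> 3 * real s" using s by (auto simp: m_def)
  qed
  have m5: "m ^ 5 \<ge> 1" using m by simp
  have K: "K = 2 * ln (700 * m ^ 5)" by (simp add: K_def height_const_def m_def)
  have K0: "K \<ge> 0" unfolding K using m5 by simp
  have eX: "exp (K + 1) \<le> real X"
  proof -
    have "exp (K + 1) = (700 * m ^ 5) ^ 2 * exp 1"
    proof -
      have "exp (ln (700 * m ^ 5)) = 700 * m ^ 5" using m5 by (intro exp_ln) linarith
      thus ?thesis by (simp add: K exp_add exp_double)
    qed
    also have "\<dots> \<le> (700 * m ^ 5) ^ 2 * 3" using exp_le by (intro mult_left_mono) auto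
    also have "\<dots> = 1470000 * m ^ 10" by (simp add: power_mult_distrib power_mult[symmetric])
    also have "\<dots> \<le> 1470000 * (3 * real s) ^ 10" using m by (intro mult_left_mono power_mono) auto
    also have "\<dots> = real X" by (simp add: X_def)
    finally show ?thesis .
  qed
  have \<epsilon>c: "\<epsilon> < c_const a4 a6 r" using False by simp
  obtain d where d: "0 \<le> d" "d \<le> real r * real (1 + 2 * (2 * X + 1) * X) * 2 ^ r
        / (\<epsilon> * ((3 / 4) ^ r / (2 * (real (1 + 2 * (2 * X + 1) * X))\<^sup>2)) ^ r)"
    and c_up: "c \<le> real (1 + 2 * (2 * X + 1) * X) * 2 ^ r
        / ((3 / 4) ^ r / (2 * (real (1 + 2 * (2 * X + 1) * X))\<^sup>2)) ^ r"
    and count: "\<forall>\<rho>>d. c * (\<rho> - d) ^ r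
      \<le> real (card {P \<in> rational_points a4 a6. weil_height P \<le> 2 * \<rho>\<^sup>2 + K})"
    by (rule elliptic_point_count[OF E rank eX[unfolded K_def] \<epsilon>(1) \<epsilon>c, folded c_def K_def])
  \<comment> \<open>Chosen so that \<open>2 * \<rho>\<^sup>2 + K = L / 6 - 2\<close>; the 2 leaves
    room for the multiples of \<open>ln 2\<close> lost between \<open>L / 6\<close> and
    \<open>ln (sqrt T / 2)\<close>.\<close>
  define k where "k = sqrt ((K + 2) / 2)"
  have k2: "k\<^sup>2 = (K + 2) / 2" using K0 by (simp add: k_def)
  have k0: "0 \<le> k" using K0 by (simp add: k_def)
  have kX: "k \<le> real X"
  proof -
    have "k \<le> (K + 2) / 2" unfolding k_def
      using K0 by (intro real_le_lsqrt) (auto simp: power2_eq_square field_simps)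
    also have "\<dots> \<le> exp (K + 1)" using exp_ge_add_one_self[of "K + 1"] K0 by argo
    finally show ?thesis using eX by linarith
  qed
  have c0: "0 \<le> c" using False \<epsilon> by (simp add: c_def)
  note bounds = constants_bound[OF s r(2) X_def \<epsilon> c0 c_up d k0 kX]
  define L where "L = ln (real_of_int \<Delta>)"
  define S where "S = sqrt L"
  have tow: "2 ^ (2 ^ (1188 * s ^ 2 + 1)) < \<Delta>"
  proof -
    have "int (2 ^ (2 ^ (1188 * s ^ 2 + 1))) \<le> int (tower 6 s)"
      using tower_bound[OF s] by (rule of_nat_mono)
    also have "\<dots> < \<Delta>" using D by (simp add: \<Delta>_def)
    finally show ?thesis by (simp only: of_nat_power of_nat_numeral)
  qed
  have L: "2 ^ (1188 * s ^ 2) \<le> L"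
  proof -
    have "exp (2 ^ (1188 * s ^ 2) :: real) = exp 1 ^ (2 ^ (1188 * s ^ 2))"
      by (simp add: exp_of_nat_mult[symmetric])
    also have "\<dots> \<le> 4 ^ (2 ^ (1188 * s ^ 2))" using exp_le by (intro power_mono) auto
    also have "(4::real) ^ (2 ^ (1188 * s ^ 2)) = (2 ^ 2) ^ (2 ^ (1188 * s ^ 2))" by simp
    also have "\<dots> = 2 ^ (2 * 2 ^ (1188 * s ^ 2))" by (rule power_mult[symmetric])
    also have "\<dots> = real_of_int (2 ^ (2 ^ (1188 * s ^ 2 + 1)))" by simp
    also have "\<dots> \<le> real_of_int \<Delta>" using less_imp_le[OF tow] by (simp only: of_int_le_iff)
    finally have le: "exp (2 ^ (1188 * s ^ 2)) \<le> real_of_int \<Delta>" .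
    have "0 < real_of_int \<Delta>" by (rule order.strict_trans2[OF exp_gt_zero le])
    thus ?thesis unfolding L_def using le by (simp add: ln_ge_iff)
  qed
  have S: "2 ^ (594 * s ^ 2) \<le> S"
    unfolding S_def by (rule real_le_rsqrt) (use L in \<open>simp add: power_mult[symmetric]\<close>)
  have L0: "0 \<le> L" using order.trans[OF _ L] by simp
  have S2: "S\<^sup>2 = L" using L0 by (simp add: S_def)
  have tL: "t \<ge> 3 + 8 * int s"
  proof (rule large_discriminant[OF s a])
    have "5372 * int s ^ 3 \<le> int (2 ^ 13 * (2 ^ s) ^ 3)"
      unfolding of_nat_mult of_nat_power using less_exp[of s] by (intro mult_mono power_mono) auto
    also have "\<dots> = 2 ^ (13 + 3 * s)" by (simp add: power_add power_mult[symmetric] mult.commute)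
    also have "\<dots> \<le> 2 ^ (2 ^ (1188 * s ^ 2 + 1))"
    proof (intro power_increasing)
      have "13 + 3 * s \<le> 1188 * s ^ 2 + 1"
      proof -
        have "s \<le> s ^ 2" "1 \<le> s ^ 2" using s by (auto simp: power2_eq_square)
        thus ?thesis by linarith
      qed
      also have "\<dots> \<le> 2 ^ (1188 * s ^ 2 + 1)" using less_exp[of "1188 * s ^ 2 + 1"] by (rule less_imp_le)
      finally show "13 + 3 * s \<le> 2 ^ (1188 * s ^ 2 + 1)" .
    qed simp
    also have "\<dots> < D_E a4 a6 t" using tow by (simp add: \<Delta>_def)
    finally show "5372 * int s ^ 3 < D_E a4 a6 t" .
  qed
  define T where "T = real_of_int t"
  have T: "T \<ge> 3 + 8 * real s" using tL by (simp add: T_def)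
  have T11: "T \<ge> 11" using T s by linarith
  define Y where "Y = nat \<lfloor>sqrt T / 2\<rfloor>"
  have Y: "real Y \<le> sqrt T / 2" unfolding Y_def using T11 by (intro of_nat_floor) auto
  have "sqrt T < T"
    using T11 by (intro real_less_lsqrt) (auto simp: power2_eq_square)
  hence Y1: "t > 2 * int Y" using Y by (simp add: T_def)
  have Y2: "4 * (int Y * (1 + t)) ^ 2 < \<Delta>"
  proof -
    have "(2 * real Y)\<^sup>2 \<le> (sqrt T)\<^sup>2" using Y T11 by (intro power_mono) auto
    hence "real_of_int ((2 * int Y) ^ 2) \<le> real_of_int t" using T11 by (simp add: T_def)
    hence Yt: "(2 * int Y) ^ 2 \<le> t" by (simp only: of_int_le_iff)
    have "4 * (int Y * (1 + t)) ^ 2 = (2 * int Y) ^ 2 * (1 + t) ^ 2" by (simp add: power_mult_distrib)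
    also have "\<dots> \<le> t * (1 + t) ^ 2" using Yt by (intro mult_right_mono) auto
    also have "\<dots> < \<Delta>"
    proof -
      define Z where "Z = int s"
      have Z: "t \<ge> 3 + 8 * Z" "Z \<ge> 1" "\<bar>a4\<bar> \<le> Z" "\<bar>a6\<bar> \<le> Z" using tL s a by (auto simp: Z_def)
      have "- (Z * t) \<le> a4 * t" using Z mult_right_mono[of "- Z" a4 t] by simp
      moreover have "Z * 1 \<le> Z * t" using Z by (intro mult_left_mono) auto
      moreover have "t * (8 * Z + 3) \<le> t * t" using Z by (intro mult_left_mono) auto
      moreover have "t * (t * 3) \<le> t * (t * t)" using Z by (intro mult_left_mono) auto
      moreover have "0 < t * t" using Z by simp
      moreover have "\<Delta> - t * (1 + t) ^ 2 = 3 * (t * (t * t)) - 2 * (t * t) - t + 4 * (a4 * t) - 4 * a6"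
        by (simp add: \<Delta>_def D_E_def power2_eq_square power3_eq_cube algebra_simps)
      moreover have "t * (8 * Z + 3) = 8 * (Z * t) + 3 * t" by (simp add: algebra_simps)
      ultimately have "0 < \<Delta> - t * (1 + t) ^ 2" using Z by linarith
      thus ?thesis by simp
    qed
    finally show ?thesis .
  qed
  have hX: "card {P \<in> rational_points a4 a6. pt_height P \<le> int Y} \<le> 1 + 2 * class_number (- \<Delta>)"
    unfolding \<Delta>_def by (rule class_number_lower_bound[OF fund Y1 Y2[unfolded \<Delta>_def]])
  have LT: "L \<le> 3 * ln 2 + 3 * ln T"
  proof -
    have "\<Delta> \<le> 8 * t ^ 3"
    proof -
      define Z where "Z = int s"
      have Z: "t \<ge> 3 + 8 * Z" "Z \<ge> 1" "\<bar>a4\<bar> \<le> Z" "\<bar>a6\<bar> \<le> Z" using tL s a by (auto simp: Z_def)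
      have "a4 * t \<le> Z * t" using Z by (intro mult_right_mono) auto
      moreover have "t * (8 * Z + 3) \<le> t * t" using Z by (intro mult_left_mono) auto
      moreover have "t * (t * 3) \<le> t * (t * t)" using Z by (intro mult_left_mono) auto
      moreover have "t * (8 * Z + 3) = 8 * (Z * t) + 3 * t" by (simp add: algebra_simps)
      moreover have "0 \<le> t * t" by simp
      moreover have "Z * 1 \<le> Z * t" using Z by (intro mult_left_mono) auto
      moreover have "\<Delta> = 4 * (t * (t * t)) + 4 * (a4 * t) - 4 * a6"
        by (simp add: \<Delta>_def D_E_def power3_eq_cube)
      moreover have "8 * t ^ 3 = 8 * (t * (t * t))" by (simp add: power3_eq_cube)
      ultimately show ?thesis using Z by linarith
    qed
    hence "real_of_int \<Delta> \<le> real_of_int (8 * t ^ 3)" by (simp only: of_int_le_iff)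
    hence le: "real_of_int \<Delta> \<le> 2 ^ 3 * T ^ 3" by (simp add: T_def)
    have "0 < real_of_int \<Delta>"
      using tow by (metis of_int_0_less_iff order_less_trans zero_less_numeral zero_less_power)
    hence "L \<le> ln (2 ^ 3 * T ^ 3)" unfolding L_def by (rule ln_mono[OF le])
    also have "\<dots> = ln ((2 * T) ^ 3)" by (simp only: power_mult_distrib)
    also have "\<dots> = 3 * ln (2 * T)" using T11 by (subst ln_realpow) auto
    also have "\<dots> = 3 * ln 2 + 3 * ln T" using T11 by (simp add: ln_mult)
    finally show ?thesis .
  qed
  have main: "c * (\<rho> - d) ^ r \<le> 1 + 2 * H" if \<rho>: "d < \<rho>" "\<rho>\<^sup>2 = S\<^sup>2 / 12 - k\<^sup>2" for \<rho>
  proof -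
    have "2 * \<rho>\<^sup>2 + K = L / 6 - 2" unfolding \<rho>(2) S2 k2 by (simp add: field_simps)
    also have "\<dots> \<le> ln (sqrt T / 2)"
    proof -
      have "ln (sqrt T / 2) = ln T / 2 - ln 2" using T11 by (simp add: ln_div ln_sqrt)
      moreover have "ln (2::real) \<le> 1" using ln_le_minus_one[of 2] by simp
      ultimately show ?thesis using LT by linarith
    qed
    finally have le: "2 * \<rho>\<^sup>2 + K \<le> ln (sqrt T / 2)" .
    have sub: "{P \<in> rational_points a4 a6. weil_height P \<le> 2 * \<rho>\<^sup>2 + K}
        \<subseteq> {P \<in> rational_points a4 a6. pt_height P \<le> int Y}"
    proof safe
      fix P assume "weil_height P \<le> 2 * \<rho>\<^sup>2 + K"
      hence "ln (real_of_int (pt_height P)) \<le> ln (sqrt T / 2)" using le by (simp add: weil_height_eq)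
      hence "real_of_int (pt_height P) \<le> sqrt T / 2"
        using pt_height_ge_1[of P] T11 by (subst (asm) ln_le_cancel_iff) auto
      hence "pt_height P \<le> \<lfloor>sqrt T / 2\<rfloor>" by (simp add: le_floor_iff)
      thus "pt_height P \<le> int Y" using T11 by (simp add: Y_def)
    qed
    have "c * (\<rho> - d) ^ r \<le> real (card {P \<in> rational_points a4 a6. weil_height P \<le> 2 * \<rho>\<^sup>2 + K})"
      using count \<rho>(1) by blast
    also have "\<dots> \<le> real (1 + 2 * class_number (- \<Delta>))"
      using order.trans[OF card_mono[OF northcott(1) sub] hX] by (rule of_nat_mono)
    also have "\<dots> = 1 + 2 * H" by (simp add: H_def)
    finally show ?thesis .
  qed
  have "1 / 2 * (c / sqrt (12 ^ r) - \<epsilon>) * S ^ r \<le> H"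
    by (rule estimate_from_point_count[OF r(1) c0 \<epsilon>(1) d(1) k0 _ _ main])
      (rule order.trans[OF bounds(1) S], rule order.trans[OF bounds(2) S])
  moreover have "S ^ r = L powr (real r / 2)"
  proof -
    have "L > 0" by (rule order.strict_trans2[OF _ L]) simp
    hence "S ^ r = (L powr (1 / 2)) powr real r" by (simp add: S_def powr_half_sqrt powr_realpow)
    thus ?thesis by (simp add: powr_powr)
  qed
  ultimately show ?thesis by (simp add: c_def L_def H_def \<Delta>_def)
qed

text \<open>A program takes finite input, so a real \<open>\<epsilon>\<close> is represented by a
  rational \<open>q\<close> not above it. The lower bound for the class number decreases in
  \<open>\<epsilon>\<close>, hence the estimate for \<open>q\<close> implies the one for
  \<open>\<epsilon>\<close>.\<close>

theorem theorem1p2: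
  shows "\<exists>N :: int \<times> int \<times> nat \<times> rat \<Rightarrow> int.
    effectively_computable_on
      {(a4, a6, r, q). elliptic_curve a4 a6 \<and> has_rank a4 a6 r \<and> r \<ge> 1 \<and> q > 0} N \<and>
    (\<forall>(a4::int) (a6::int) (r::nat) (\<epsilon>::real) (q::rat).
       elliptic_curve a4 a6 \<and> has_rank a4 a6 r \<and> r \<ge> 1 \<and>
       \<epsilon> > 0 \<and> q > 0 \<and> of_rat q \<le> \<epsilon> \<longrightarrow>
       N (a4, a6, r, q) < 0 \<and>
       (\<forall>t::int.
          fundamental_discriminant (- D_E a4 a6 t) \<and> - D_E a4 a6 t < 0 \<and>
          - D_E a4 a6 t < N (a4, a6, r, q) \<longrightarrow>
          real (class_number (- D_E a4 a6 t)) \<ge>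
            1 / 2 * (c_const a4 a6 r / sqrt (12 ^ r) - \<epsilon>)
              * ln (real_of_int (D_E a4 a6 t)) powr (real r / 2)))"
proof -
  define s where "s x = sum_list (encode_input x)" for x
  define N where "N x = - int (Suc (tower 6 (s x)))" for x
  have "N (a4, a6, r, q) < 0 \<and>
       (\<forall>t::int.
          fundamental_discriminant (- D_E a4 a6 t) \<and> - D_E a4 a6 t < 0 \<and>
          - D_E a4 a6 t < N (a4, a6, r, q) \<longrightarrow>
          1 / 2 * (c_const a4 a6 r / sqrt (12 ^ r) - \<epsilon>) * ln (real_of_int (D_E a4 a6 t)) powr (real r / 2)
            \<le> real (class_number (- D_E a4 a6 t)))"
    if A: "elliptic_curve a4 a6 \<and> has_rank a4 a6 r \<and> r \<ge> 1 \<and> \<epsilon> > 0 \<and> q > 0 \<and> of_rat q \<le> \<epsilon>"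
    for a4 a6 :: int and r :: nat and \<epsilon> :: real and q :: rat
  proof (intro conjI allI impI)
    show "N (a4, a6, r, q) < 0" by (simp add: N_def)
    fix t assume t: "fundamental_discriminant (- D_E a4 a6 t) \<and> - D_E a4 a6 t < 0 \<and>
        - D_E a4 a6 t < N (a4, a6, r, q)"
    define z where "z = s (a4, a6, r, q)"
    obtain n d where nd: "quotient_of q = (n, d)" "d > 0" "q = of_int n / of_int d"
      by (rule quotient_of_cases)
    have z: "z = int_encode a4 + (int_encode a6 + (r + (int_encode n + int_encode d)))"
      by (simp add: z_def s_def nd(1))
    have "n > 0" using A nd by (simp add: zero_less_divide_iff)
    have q0: "(0::real) < of_rat q" using A by simp
    \<comment> \<open>The numerator of \<open>q\<close> is a positive integer, so
      \<open>1 / q\<close> is at most the denominator, whose code is a summand of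
      \<open>z\<close>.\<close>
    have "1 / (of_rat q :: real) = real_of_int d / real_of_int n"
      by (simp add: nd(3) of_rat_divide)
    also have "\<dots> \<le> real_of_int d / 1" using \<open>n > 0\<close> nd(2) by (intro divide_left_mono) auto
    also have "\<dots> \<le> real z" using int_encode_ge[of d] unfolding z by simp
    finally have q: "1 / (of_rat q :: real) \<le> real z" .
    have a: "\<bar>a4\<bar> \<le> int z" "\<bar>a6\<bar> \<le> int z" "r \<le> z"
      using int_encode_ge[of a4] int_encode_ge[of a6] unfolding z by auto
    have "1 / 2 * (c_const a4 a6 r / sqrt (12 ^ r) - \<epsilon>) * ln (real_of_int (D_E a4 a6 t)) powr (real r / 2)
        \<le> 1 / 2 * (c_const a4 a6 r / sqrt (12 ^ r) - of_rat q) * ln (real_of_int (D_E a4 a6 t)) powr (real r / 2)"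
      using A by (intro mult_right_mono mult_left_mono) auto
    also have "\<dots> \<le> real (class_number (- D_E a4 a6 t))"
      by (rule class_number_estimate[where s = z])
        (use A t a q q0 in \<open>auto simp: N_def z_def\<close>)
    finally show "1 / 2 * (c_const a4 a6 r / sqrt (12 ^ r) - \<epsilon>)
        * ln (real_of_int (D_E a4 a6 t)) powr (real r / 2) \<le> real (class_number (- D_E a4 a6 t))" .
  qed
  moreover have "effectively_computable_on
      {(a4, a6, r, q). elliptic_curve a4 a6 \<and> has_rank a4 a6 r \<and> r \<ge> 1 \<and> q > 0} N"
    unfolding N_def s_def by (rule effectively_computable_tower)
  ultimately show ?thesis by blast
qed

end
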